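(* Suppose that for each $\nu\in[0,\nu_*]$ and $h\in\mathbb W$ such that $F(\nu,h)=0$, either $D_hF|_{\nu,h}$ is invertible, or the following three conditions hold: \begin{itemize} \item $\operatorname{Range}(D_hF|_{\nu,h})\oplus\operatorname{span}\{D_\nu F|_{\nu,h}\}=\mathbb V$; \item $\int\alpha\,D_h^2F|_{\nu,h}\big(\Theta(\nu,h),\Theta(\nu,h)\big)\ne0$; \item $\int\alpha h\neq0$. \end{itemize} Then there exist finitely many intervals $I_k\subset\mathbb R$ and differentiable curves $(G_k,\mathbf h_k):I_k\to[0,\nu_*]\times\mathcal B_1$ such that, for $\nu\in[0,\nu_*]$, all the $\mathcal B_1$ fixed points of $\widetilde{\mathcal L}_\nu$ belong to $\bigcup_k\mathbf h_k(I_k)\subset\mathcal B_3$. More precisely, $\widetilde{\mathcal L}_{G_k(y)}\mathbf h_k(y)=\mathbf h_k(y)$ for all $y\in I_k$. Moreover, $\sharp\{G_k^{-1}(\nu)\}<\infty$ for all $\nu\in[0,\nu_*]$. Finally, if for some $h\in\mathbb W$ and $\nu\in(0,\nu_* )$ one has $F(\nu,h)=0$ and $D_hF|_{\nu,h}$ is not invertible, then there exists $\nu_1\in(0,\nu_* )$ such that $\sharp\{\bigcup_kG_k^{-1}(\nu_1)\}\ge3$ (that is, there are at least three invariant measures for $\widetilde{\mathcal L}_{\nu_1}$).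
   Context: Setting. Let $\mathbb T^d=\mathbb R^d/\mathbb Z^d$, with Lebesgue measure $m$; fix an integer $\bar r>12$, $T\in C^\infty(\mathbb T^d,\mathbb T^d)$, $\alpha\in C^\infty(\mathbb T^d,\mathbb R)$, $\beta\in C^\infty(\mathbb T^d,\mathbb R^d)$. For a distribution $h\in C^{\bar r}(\mathbb T^d,\mathbb R)'$ and $\varphi\in C^{\bar r}$ write $\int\varphi h:=h(\varphi)$; functions $h\in L^1$ are identified with $\varphi\mapsto\int\varphi h\,dm$; $h\ge0$ means $\int h\varphi\ge0$ for all $\varphi\ge0$ in $C^{\bar r}$. For $\nu\in\mathbb R$ and $h\in C^{\bar r}(\mathbb T^d,\mathbb R)'$ with $h(1)=1$ let $T_{\nu,h}(x)=T(x)+\nu\beta(x)\,h(\alpha)\bmod 1$. The transfer operator $\mathcal L_S$ of a map $S:\mathbb T^d\to\mathbb T^d$ is defined on distributions by $\int g\,\mathcal L_Sh=\int g\circ S\,h$; its restrictions to subspaces are denoted by the same symbol. $\widetilde{\mathcal L}_\nu(h):=\mathcal L_{T_{\nu,h}}h$. $L(X,Y)$ denotes the bounded linear operators from $X$ to $Y$. Standing assumptions. $\mathcal T\subset C^{\bar r}(\mathbb T^d,\mathbb T^d)$ is a set of surjective maps closed under composition, and $\nu_*>0$ is such that $T_{\nu,h}\in\mathcal T$ for all $\nu\in[0,\nu_*]$ and all probability measures $h$. $\mathcal B_0,\dots,\mathcal B_3$ are Banach spaces with $C^{\bar r}(\mathbb T^d,\mathbb R)'\supset\mathcal B_0\supset\mathcal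 B_1\supset\mathcal B_2\supset\mathcal B_3\supset C^{\bar r}(\mathbb T^d,\mathbb R)$ and $C^{\bar r}(\mathbb T^d,\mathbb R)'\supset\mathcal B_3'\supset\mathcal B_2'\supset\mathcal B_1'\supset\mathcal B_0'\supset C^{\bar r}(\mathbb T^d,\mathbb R)$ (one-to-one embeddings extending $h\mapsto(\phi\mapsto\int h\phi)$, and $\|\cdot\|_{\mathcal B_i}\le\|\cdot\|_{\mathcal B_{i+1}}$), $C^{\bar r}(\mathbb T^d,\mathbb R)$ being dense in each $\mathcal B_i$ and $\mathcal B_i'$. For a fixed, large enough $K_\star>0$, $$\mathbb W=\{h\in\mathcal B_1:\|h\|_{\mathcal B_1}\le K_\star,\ h\ge0,\ \textstyle\int h=1\},\qquad \mathbb V=\{f\in\mathcal B_1:\textstyle\int f=0\}.$$ There are $K,C_*\ge1$, $\bar c,\hat c>0$, $\vartheta\in(0,1)$ such that: (A1) $\mathcal L_S\in L(\mathcal B_i,\mathcal B_i)$ for all $S\in\mathcal T$, $i\in\{0,\dots,3\}$. (A2) $\partial_{x_k}\in L(\mathcal B_{i+1},\mathcal B_i)$ for $k\in\{1,\dots,d\}$, $i\in\{0,1,2\}$. (A3) $\|ah\|_{\mathcal B_i}\le C_*\|a\|_{C^{\bar ci+\hat c}}\|h\|_{\mathcal B_i}$ for $a\in C^{\bar ci+\hat c}$, and $|\int h|\le C_*\|h\|_{\mathcal B_0}$. (A4) The unit ball of $\mathcal B_{i+1}$ is relatively compact in $\mathcal B_i$, $i\in\{0,1,2\}$. (A5) For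 all $n\in\mathbb N$, $S_1,\dots,S_n\in\mathcal T$, $i\in\{1,2,3\}$, $\phi\in\mathcal B_i$: $\|\mathcal L_{S_n}\cdots\mathcal L_{S_1}\phi\|_{\mathcal B_0}\le C_*\|\phi\|_{\mathcal B_0}$ and $\|\mathcal L_{S_n}\cdots\mathcal L_{S_1}\phi\|_{\mathcal B_i}\le C_*\vartheta^n\|\phi\|_{\mathcal B_i}+K\|\phi\|_{\mathcal B_{i-1}}$. (A6) There is $\bar n\in\mathbb N$ such that for all $n\ge\bar n$, $S_1,\dots,S_n\in\mathcal T$, $i\in\{1,2,3\}$: $\|\mathcal L_{S_n}\cdots\mathcal L_{S_1}|_{\mathbb V\cap\mathcal B_i}\|_{\mathcal B_i}<\vartheta^n$. The function $F$. For $(\nu,h)\in\Omega:=[0,\nu_*]\times\mathbb W$ let $H(\nu,h)$ be the unique probability measure in $\mathbb W$ with $\mathcal L_{T_{\nu,h}}H(\nu,h)=H(\nu,h)$ (it belongs to $\mathcal B_3$). $F:\Omega\to\mathbb V$ is $F(\nu,h)=h-H(\nu,h)$; thus $F(\nu,h)=0$ iff $\widetilde{\mathcal L}_\nu h=h$. Let $$\Theta(\nu,h)=-(\mathrm{Id}-\mathcal L_{T_{\nu,h}})^{-1}\operatorname{div}\big(\mathcal L_{T_{\nu,h}}(\beta H(\nu,h))\big),$$ where $\mathcal L_{T_{\nu,h}}$ acts componentwise on vectors and the inverse is taken on zero-average elements. The derivatives of $F$ are, for $\phi,\bar\phi\in\mathbb V$: $D_hF|_{\nu,h}(\phi)=\phi-\nu\Theta(\nu,h)\int\alpha\phi$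 (an operator $\mathbb V\to\mathbb V$), $D_\nu F|_{\nu,h}=-\Theta(\nu,h)\int\alpha h$, and (with values in $\mathcal B_0$), writing $\mathcal L=\mathcal L_{T_{\nu,h}}$, $H=H(\nu,h)$, $$D_h^2F|_{\nu,h}(\phi,\bar\phi)=-\Big\{2\sum_{i,j}(\mathrm{Id}-\mathcal L)^{-1}\partial_{x_i}\big[\mathcal L\beta_i(\mathrm{Id}-\mathcal L)^{-1}\partial_{x_j}(\mathcal L\beta_jH)\big]+(\mathrm{Id}-\mathcal L)^{-1}\sum_{i,j}\partial_{x_i}\partial_{x_j}[\mathcal L\beta_i\beta_jH]\Big\}\nu^2\int\alpha\phi\int\alpha\bar\phi .$$ Convention. The fixed points (invariant measures) of $\widetilde{\mathcal L}_\nu$ considered are only the probability measures $h\in\mathcal B_1$ with $\widetilde{\mathcal L}_\nu h=h$ for which $h$ is the SRB measure of $T_{\nu,h}$, i.e. $h=H(\nu,h)$. *)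

theory Defs
  imports "HOL-Probability.Probability"
begin

section \<open>The torus and spaces of functions on it\<close>

text \<open>
  Functions on the torus are \<open>\<int>\<^sup>d\<close>-periodic functions on \<open>\<real>\<^sup>d\<close>, and maps from the torus to itself
  are represented by lifts to \<open>\<real>\<^sup>d\<close>. Nothing below distinguishes two lifts of the same map, because
  maps only enter through compositions \<open>g \<circ> S\<close> with \<open>g\<close> periodic; this is why the reduction
  modulo 1 in the definition of \<open>T\<^bsub>\<nu>,h\<^esub>\<close> leaves no trace.
\<close>

definition lattice :: "(real ^ 'd) set" where
  "lattice = {v. \<forall>i. v $ i \<in> \<int>}"

definition periodic :: "(real ^ 'd \<Rightarrow> 'b) \<Rightarrow> bool" where
  "periodic f \<longleftrightarrow> (\<forall>x. \<forall>v\<in>lattice. f (x + v) = f x)"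

definition pd :: "'d \<Rightarrow> (real ^ 'd \<Rightarrow> real) \<Rightarrow> real ^ 'd \<Rightarrow> real" where
  "pd i f x = frechet_derivative f (at x) (axis i 1)"

definition pds :: "'d list \<Rightarrow> (real ^ 'd \<Rightarrow> real) \<Rightarrow> real ^ 'd \<Rightarrow> real" where
  "pds is f = fold pd is f"

primrec Ck :: "nat \<Rightarrow> (real ^ 'd \<Rightarrow> real) \<Rightarrow> bool" where
  "Ck 0 f \<longleftrightarrow> continuous_on UNIV f"
| "Ck (Suc k) f \<longleftrightarrow> f differentiable_on UNIV \<and> (\<forall>i. Ck k (pd i f))"

definition CT :: "nat \<Rightarrow> (real ^ 'd \<Rightarrow> real) set" where
  "CT k = {f. periodic f \<and> Ck k f}"

definition CT_norm :: "nat \<Rightarrow> (real ^ 'd \<Rightarrow> real) \<Rightarrow> real" where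
  "CT_norm k f = Max ((\<lambda>is. SUP x. \<bar>pds is f x\<bar>) ` {is. length is \<le> k})"

text \<open>
  \<open>C\<^sup>s\<close> for real \<open>s \<ge> 0\<close>: the usual \<open>C\<^sup>k\<close> if \<open>s = k\<close> is an integer, and otherwise the Hoelder space
  of functions in \<open>C\<^sup>k\<close>, \<open>k = \<lfloor>s\<rfloor>\<close>, whose derivatives of order \<open>k\<close> are \<open>(s - k)\<close>-Hoelder. The
  quotient below is \<open>0\<close> for \<open>x = y\<close>.
\<close>

definition holder_quot :: "real \<Rightarrow> (real ^ 'd \<Rightarrow> real) \<Rightarrow> (real ^ 'd) \<times> (real ^ 'd) \<Rightarrow> real" where
  "holder_quot \<gamma> f = (\<lambda>(x, y). \<bar>f x - f y\<bar> / dist x y powr \<gamma>)"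

definition Cs :: "real \<Rightarrow> (real ^ 'd \<Rightarrow> real) set" where
  "Cs s = {f \<in> CT (nat \<lfloor>s\<rfloor>).
     frac s \<noteq> 0 \<longrightarrow> (\<forall>is. length is = nat \<lfloor>s\<rfloor> \<longrightarrow> bdd_above (range (holder_quot (frac s) (pds is f))))}"

definition Cs_norm :: "real \<Rightarrow> (real ^ 'd \<Rightarrow> real) \<Rightarrow> real" where
  "Cs_norm s f = CT_norm (nat \<lfloor>s\<rfloor>) f +
     (if frac s = 0 then 0
      else Max ((\<lambda>is. SUP p. holder_quot (frac s) (pds is f) p) ` {is. length is = nat \<lfloor>s\<rfloor>}))"

definition torus_map :: "nat \<Rightarrow> (real ^ 'd \<Rightarrow> real ^ 'd) \<Rightarrow> bool" where
  "torus_map k S \<longleftrightarrow>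
     (\<forall>x. \<forall>v\<in>lattice. S (x + v) - S x \<in> lattice) \<and> (\<forall>i. Ck k (\<lambda>x. S x $ i))"

definition torus_surj :: "(real ^ 'd \<Rightarrow> real ^ 'd) \<Rightarrow> bool" where
  "torus_surj S \<longleftrightarrow> (\<forall>y. \<exists>x. S x - y \<in> lattice)"


section \<open>Distributions of order r\<close>

type_synonym 'd dist = "(real ^ 'd \<Rightarrow> real) \<Rightarrow> real"

text \<open>
  The dual of \<open>C\<^sup>r\<close>. Elements are normalised to vanish outside \<open>C\<^sup>r\<close>, so that equality of
  functionals on \<open>C\<^sup>r\<close> is equality in HOL. The integral of \<open>h\<close> is its value at the constant 1.
\<close>

definition distribution :: "nat \<Rightarrow> 'd::finite dist \<Rightarrow> bool" where
  "distribution r h \<longleftrightarrow>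
     (\<forall>\<phi>. \<phi> \<notin> CT r \<longrightarrow> h \<phi> = 0) \<and>
     (\<forall>\<phi>\<in>CT r. \<forall>\<psi>\<in>CT r. \<forall>a b. h (\<lambda>x. a * \<phi> x + b * \<psi> x) = a * h \<phi> + b * h \<psi>) \<and>
     (\<exists>C. \<forall>\<phi>\<in>CT r. \<bar>h \<phi>\<bar> \<le> C * CT_norm r \<phi>)"

definition fun_dist :: "nat \<Rightarrow> (real ^ 'd \<Rightarrow> real) \<Rightarrow> 'd dist" where
  "fun_dist r f = (\<lambda>\<phi>. if \<phi> \<in> CT r then (LINT x:cbox 0 1|lborel. \<phi> x * f x) else 0)"

definition dist_nonneg :: "nat \<Rightarrow> 'd::finite dist \<Rightarrow> bool" where
  "dist_nonneg r h \<longleftrightarrow> (\<forall>\<phi>\<in>CT r. (\<forall>x. \<phi> x \<ge> 0) \<longrightarrow> h \<phi> \<ge> 0)"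

abbreviation one_fun :: "real ^ 'd \<Rightarrow> real" where
  "one_fun \<equiv> (\<lambda>x. 1)"

text \<open>
  Probability measures on the torus are the images of Borel probability measures on \<open>\<real>\<^sup>d\<close> under
  the projection, and a periodic function has the same integral against both.
\<close>

definition prob_dist :: "nat \<Rightarrow> 'd::finite dist \<Rightarrow> bool" where
  "prob_dist r h \<longleftrightarrow>
     (\<exists>\<mu>. prob_space \<mu> \<and> sets \<mu> = sets borel \<and>
        h = (\<lambda>\<phi>. if \<phi> \<in> CT r then (LINT x|\<mu>. \<phi> x) else 0))"

definition transfer :: "nat \<Rightarrow> (real ^ 'd \<Rightarrow> real ^ 'd) \<Rightarrow> 'd dist \<Rightarrow> 'd dist" where
  "transfer r S h = (\<lambda>g. if g \<in> CT r then h (g \<circ> S) else 0)"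

definition dmult :: "nat \<Rightarrow> (real ^ 'd \<Rightarrow> real) \<Rightarrow> 'd dist \<Rightarrow> 'd dist" where
  "dmult r a h = (\<lambda>\<phi>. if \<phi> \<in> CT r then h (\<lambda>x. a x * \<phi> x) else 0)"

text \<open>
  The distributional derivative of \<open>h \<in> (C\<^sup>r)'\<close> is a priori only a functional on \<open>C\<^bsup>r+1\<^esup>\<close>. If it
  extends continuously to \<open>C\<^sup>r\<close>, the extension is unique because \<open>C\<^bsup>r+1\<^esup>\<close> is dense in \<open>C\<^sup>r\<close>.
\<close>

definition is_dpd :: "nat \<Rightarrow> 'd \<Rightarrow> 'd::finite dist \<Rightarrow> 'd dist \<Rightarrow> bool" where
  "is_dpd r i h g \<longleftrightarrow> distribution r g \<and> (\<forall>\<phi>\<in>CT (Suc r). g \<phi> = - h (pd i \<phi>))"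

definition dpd :: "nat \<Rightarrow> 'd \<Rightarrow> 'd::finite dist \<Rightarrow> 'd dist" where
  "dpd r i h = (THE g. is_dpd r i h g)"


section \<open>The scale of Banach spaces\<close>

text \<open>
  A Banach space between \<open>C\<^sup>r\<close> and \<open>(C\<^sup>r)'\<close> is a type of class \<open>banach\<close> together with a one-to-one
  embedding \<open>e\<close> into the distributions. The last two clauses say that \<open>C\<^sup>r\<close> is dense in the space
  and in its dual, where \<open>\<phi> \<in> C\<^sup>r\<close> acts on the space by \<open>h \<mapsto> h(\<phi>)\<close>. The clauses before them are the
  continuity of the embeddings of \<open>C\<^sup>r\<close> into the space and into its dual.
\<close>

definition banach_dist_space :: "nat \<Rightarrow> ('b::banach \<Rightarrow> 'd::finite dist) \<Rightarrow> bool" where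
  "banach_dist_space r e \<longleftrightarrow>
     inj e \<and> (\<forall>h. distribution r (e h)) \<and>
     (\<forall>a b h g. e (a *\<^sub>R h + b *\<^sub>R g) = (\<lambda>\<phi>. a * e h \<phi> + b * e g \<phi>)) \<and>
     (\<exists>C. \<forall>\<phi>\<in>CT r. \<exists>h. e h = fun_dist r \<phi> \<and> norm h \<le> C * CT_norm r \<phi>) \<and>
     (\<exists>C. \<forall>h. \<forall>\<phi>\<in>CT r. \<bar>e h \<phi>\<bar> \<le> C * norm h * CT_norm r \<phi>) \<and>
     closure {h. \<exists>\<phi>\<in>CT r. e h = fun_dist r \<phi>} = UNIV \<and>
     closure {l :: 'b \<Rightarrow>\<^sub>L real. \<exists>\<phi>\<in>CT r. \<forall>h. blinfun_apply l h = e h \<phi>} = UNIV"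

text \<open>The norm of the space embedded by \<open>e\<close>, for distributions in \<open>range e\<close>.\<close>

definition dnorm :: "('b::real_normed_vector \<Rightarrow> 'd::finite dist) \<Rightarrow> 'd dist \<Rightarrow> real" where
  "dnorm e u = norm (inv e u)"

definition nested :: "('c::banach \<Rightarrow> 'd::finite dist) \<Rightarrow> ('b::banach \<Rightarrow> 'd dist) \<Rightarrow> bool" where
  "nested e' e \<longleftrightarrow> range e' \<subseteq> range e \<and> (\<forall>u\<in>range e'. dnorm e u \<le> dnorm e' u)"

definition compactly_nested :: "('c::banach \<Rightarrow> 'd::finite dist) \<Rightarrow> ('b::banach \<Rightarrow> 'd dist) \<Rightarrow> bool" where
  "compactly_nested e' e \<longleftrightarrow> compact (closure ((\<lambda>h. inv e (e' h)) ` cball 0 1))"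

definition transfer_bounded ::
  "nat \<Rightarrow> (real ^ 'd \<Rightarrow> real ^ 'd) \<Rightarrow> ('b::banach \<Rightarrow> 'd::finite dist) \<Rightarrow> bool" where
  "transfer_bounded r S e \<longleftrightarrow>
     (\<exists>M. bounded_linear M \<and> (\<forall>h. e (M h) = transfer r S (e h)))"

definition pd_bounded ::
  "nat \<Rightarrow> 'd \<Rightarrow> ('c::banach \<Rightarrow> 'd::finite dist) \<Rightarrow> ('b::banach \<Rightarrow> 'd dist) \<Rightarrow> bool" where
  "pd_bounded r i e' e \<longleftrightarrow>
     (\<exists>M. bounded_linear M \<and> (\<forall>h. is_dpd r i (e' h) (e (M h))))"

text \<open>
  Multiplication by \<open>a \<in> C\<^sup>s\<close>. If \<open>s < r\<close> the product \<open>a h\<close> of \<open>a\<close> with a general distribution of order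
  \<open>r\<close> is not defined directly; on the Banach space it is the continuous extension of the pointwise
  product from the dense subspace \<open>C\<^sup>r\<close>.
\<close>

definition mult_bounded :: "nat \<Rightarrow> real \<Rightarrow> real \<Rightarrow> ('b::banach \<Rightarrow> 'd::finite dist) \<Rightarrow> bool" where
  "mult_bounded r s C e \<longleftrightarrow>
     (\<forall>a\<in>Cs s. \<exists>M. bounded_linear M \<and>
        (\<forall>\<phi>\<in>CT r. \<forall>h. e h = fun_dist r \<phi> \<longrightarrow> e (M h) = fun_dist r (\<lambda>x. a x * \<phi> x)) \<and>
        (a \<in> CT r \<longrightarrow> (\<forall>h. e (M h) = dmult r a (e h))) \<and>
        (\<forall>h. norm (M h) \<le> C * Cs_norm s a * norm h))"

text \<open>
  For \<open>Ss = [S\<^sub>1, \<dots>, S\<^sub>n]\<close>, \<open>fold (transfer r) Ss\<close> is the product of the transfer operators in which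
  that of \<open>S\<^sub>1\<close> is applied first.
\<close>

definition lasota_yorke ::
  "nat \<Rightarrow> (real ^ 'd \<Rightarrow> real ^ 'd) set \<Rightarrow> real \<Rightarrow> real \<Rightarrow> real \<Rightarrow>
   ('a::banach \<Rightarrow> 'd::finite dist) \<Rightarrow> ('c::banach \<Rightarrow> 'd dist) \<Rightarrow> ('b::banach \<Rightarrow> 'd dist) \<Rightarrow> bool" where
  "lasota_yorke r \<T> C K \<theta> e0 e' e \<longleftrightarrow>
     (\<forall>Ss. set Ss \<subseteq> \<T> \<longrightarrow> (\<forall>u\<in>range e'.
        dnorm e0 (fold (transfer r) Ss u) \<le> C * dnorm e0 u \<and>
        dnorm e' (fold (transfer r) Ss u) \<le> C * \<theta> ^ length Ss * dnorm e' u + K * dnorm e u))"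

text \<open>The operator norm of the product, restricted to mean zero elements, is smaller than \<open>\<theta>\<^sup>n\<close>.\<close>

definition mean_zero_contraction ::
  "nat \<Rightarrow> (real ^ 'd \<Rightarrow> real ^ 'd) list \<Rightarrow> real \<Rightarrow> ('b::banach \<Rightarrow> 'd::finite dist) \<Rightarrow> bool" where
  "mean_zero_contraction r Ss \<theta> e \<longleftrightarrow>
     (\<exists>c. 0 \<le> c \<and> c < \<theta> ^ length Ss \<and>
        (\<forall>u\<in>range e. u one_fun = 0 \<longrightarrow> dnorm e (fold (transfer r) Ss u) \<le> c * dnorm e u))"


section \<open>The self-consistent transfer operator and the function F\<close>

text \<open>Below, \<open>e\<close> is the embedding of \<open>\<B>\<^sub>1\<close>.\<close>

definition Tmap ::
  "(real ^ 'd \<Rightarrow> real ^ 'd) \<Rightarrow> (real ^ 'd \<Rightarrow> real) \<Rightarrow> (real ^ 'd \<Rightarrow> real ^ 'd) \<Rightarrow>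
   real \<Rightarrow> 'd::finite dist \<Rightarrow> real ^ 'd \<Rightarrow> real ^ 'd" where
  "Tmap T \<alpha> \<beta> \<nu> h x = T x + (\<nu> * h \<alpha>) *\<^sub>R \<beta> x"

definition Ltilde ::
  "nat \<Rightarrow> (real ^ 'd \<Rightarrow> real ^ 'd) \<Rightarrow> (real ^ 'd \<Rightarrow> real) \<Rightarrow> (real ^ 'd \<Rightarrow> real ^ 'd) \<Rightarrow>
   real \<Rightarrow> 'd::finite dist \<Rightarrow> 'd dist" where
  "Ltilde r T \<alpha> \<beta> \<nu> h = transfer r (Tmap T \<alpha> \<beta> \<nu> h) h"

definition W_set :: "nat \<Rightarrow> ('b::banach \<Rightarrow> 'd::finite dist) \<Rightarrow> real \<Rightarrow> 'b set" where
  "W_set r e Ks = {h. norm h \<le> Ks \<and> dist_nonneg r (e h) \<and> e h one_fun = 1}"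

definition V_set :: "('b::banach \<Rightarrow> 'd::finite dist) \<Rightarrow> 'b set" where
  "V_set e = {f. e f one_fun = 0}"

definition H_fun ::
  "nat \<Rightarrow> (real ^ 'd \<Rightarrow> real ^ 'd) \<Rightarrow> (real ^ 'd \<Rightarrow> real) \<Rightarrow> (real ^ 'd \<Rightarrow> real ^ 'd) \<Rightarrow>
   ('b::banach \<Rightarrow> 'd::finite dist) \<Rightarrow> real \<Rightarrow> real \<Rightarrow> 'b \<Rightarrow> 'b" where
  "H_fun r T \<alpha> \<beta> e Ks \<nu> h =
     (THE g. g \<in> W_set r e Ks \<and> transfer r (Tmap T \<alpha> \<beta> \<nu> (e h)) (e g) = e g)"

definition F_fun ::
  "nat \<Rightarrow> (real ^ 'd \<Rightarrow> real ^ 'd) \<Rightarrow> (real ^ 'd \<Rightarrow> real) \<Rightarrow> (real ^ 'd \<Rightarrow> real ^ 'd) \<Rightarrow>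
   ('b::banach \<Rightarrow> 'd::finite dist) \<Rightarrow> real \<Rightarrow> real \<Rightarrow> 'b \<Rightarrow> 'b" where
  "F_fun r T \<alpha> \<beta> e Ks \<nu> h = h - H_fun r T \<alpha> \<beta> e Ks \<nu> h"

text \<open>\<open>(Id - \<L>\<^sub>S)\<^bsup>-1\<^esup> g\<close>, the inverse being taken on the mean zero elements of \<open>\<B>\<^sub>1\<close>.\<close>

definition resolvent ::
  "nat \<Rightarrow> ('b::banach \<Rightarrow> 'd::finite dist) \<Rightarrow> (real ^ 'd \<Rightarrow> real ^ 'd) \<Rightarrow> 'd dist \<Rightarrow> 'b" where
  "resolvent r e S g =
     (THE f. f \<in> V_set e \<and> (\<lambda>\<phi>. e f \<phi> - transfer r S (e f) \<phi>) = g)"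

definition Theta ::
  "nat \<Rightarrow> (real ^ 'd \<Rightarrow> real ^ 'd) \<Rightarrow> (real ^ 'd \<Rightarrow> real) \<Rightarrow> (real ^ 'd \<Rightarrow> real ^ 'd) \<Rightarrow>
   ('b::banach \<Rightarrow> 'd::finite dist) \<Rightarrow> real \<Rightarrow> real \<Rightarrow> 'b \<Rightarrow> 'b" where
  "Theta r T \<alpha> \<beta> e Ks \<nu> h =
     (let S = Tmap T \<alpha> \<beta> \<nu> (e h); H = e (H_fun r T \<alpha> \<beta> e Ks \<nu> h) in
      - resolvent r e S
          (\<lambda>\<phi>. \<Sum>i\<in>UNIV. dpd r i (transfer r S (dmult r (\<lambda>x. \<beta> x $ i) H)) \<phi>))"

text \<open>
  The derivatives of \<open>F\<close>, given by their explicit formulas. The second derivative is an element of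
  \<open>\<B>\<^sub>0\<close>; since \<open>H\<close> belongs to \<open>\<B>\<^sub>3\<close> and only two derivatives are lost, it can be written as an element
  of \<open>\<B>\<^sub>1\<close>, where the inverses are defined.
\<close>

definition DhF ::
  "nat \<Rightarrow> (real ^ 'd \<Rightarrow> real ^ 'd) \<Rightarrow> (real ^ 'd \<Rightarrow> real) \<Rightarrow> (real ^ 'd \<Rightarrow> real ^ 'd) \<Rightarrow>
   ('b::banach \<Rightarrow> 'd::finite dist) \<Rightarrow> real \<Rightarrow> real \<Rightarrow> 'b \<Rightarrow> 'b \<Rightarrow> 'b" where
  "DhF r T \<alpha> \<beta> e Ks \<nu> h \<phi> = \<phi> - (\<nu> * e \<phi> \<alpha>) *\<^sub>R Theta r T \<alpha> \<beta> e Ks \<nu> h"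

definition DnuF ::
  "nat \<Rightarrow> (real ^ 'd \<Rightarrow> real ^ 'd) \<Rightarrow> (real ^ 'd \<Rightarrow> real) \<Rightarrow> (real ^ 'd \<Rightarrow> real ^ 'd) \<Rightarrow>
   ('b::banach \<Rightarrow> 'd::finite dist) \<Rightarrow> real \<Rightarrow> real \<Rightarrow> 'b \<Rightarrow> 'b" where
  "DnuF r T \<alpha> \<beta> e Ks \<nu> h = - (e h \<alpha> *\<^sub>R Theta r T \<alpha> \<beta> e Ks \<nu> h)"

definition D2hF ::
  "nat \<Rightarrow> (real ^ 'd \<Rightarrow> real ^ 'd) \<Rightarrow> (real ^ 'd \<Rightarrow> real) \<Rightarrow> (real ^ 'd \<Rightarrow> real ^ 'd) \<Rightarrow>
   ('b::banach \<Rightarrow> 'd::finite dist) \<Rightarrow> real \<Rightarrow> real \<Rightarrow> 'b \<Rightarrow> 'b \<Rightarrow> 'b \<Rightarrow> 'b" where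
  "D2hF r T \<alpha> \<beta> e Ks \<nu> h \<phi> \<psi> =
     (let S = Tmap T \<alpha> \<beta> \<nu> (e h); H = e (H_fun r T \<alpha> \<beta> e Ks \<nu> h);
          L = transfer r S; R = resolvent r e S; b = (\<lambda>i x. \<beta> x $ i) in
      - ((\<nu>\<^sup>2 * e \<phi> \<alpha> * e \<psi> \<alpha>) *\<^sub>R
         (2 *\<^sub>R (\<Sum>i\<in>UNIV. \<Sum>j\<in>UNIV.
              R (dpd r i (L (dmult r (b i) (e (R (dpd r j (L (dmult r (b j) H)))))))))
          + R (\<lambda>g. \<Sum>i\<in>UNIV. \<Sum>j\<in>UNIV.
              dpd r i (dpd r j (L (dmult r (\<lambda>x. b i x * b j x) H))) g))))"

definition invertible_on :: "'b::real_normed_vector set \<Rightarrow> ('b \<Rightarrow> 'b) \<Rightarrow> bool" where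
  "invertible_on V A \<longleftrightarrow>
     bij_betw A V V \<and> (\<exists>C. \<forall>v\<in>V. norm (inv_into V A v) \<le> C * norm v)"

definition is_direct_sum :: "'b::real_vector set \<Rightarrow> 'b set \<Rightarrow> 'b set \<Rightarrow> bool" where
  "is_direct_sum X Y V \<longleftrightarrow> {x + y | x y. x \<in> X \<and> y \<in> Y} = V \<and> X \<inter> Y = {0}"

text \<open>Fixed points are probability measures in \<open>\<B>\<^sub>1\<close> with \<open>h = H(\<nu>,h)\<close>.\<close>

definition fixed_pt ::
  "nat \<Rightarrow> (real ^ 'd \<Rightarrow> real ^ 'd) \<Rightarrow> (real ^ 'd \<Rightarrow> real) \<Rightarrow> (real ^ 'd \<Rightarrow> real ^ 'd) \<Rightarrow>
   ('b::banach \<Rightarrow> 'd::finite dist) \<Rightarrow> real \<Rightarrow> real \<Rightarrow> 'b \<Rightarrow> bool" where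
  "fixed_pt r T \<alpha> \<beta> e Ks \<nu> h \<longleftrightarrow>
     prob_dist r (e h) \<and> Ltilde r T \<alpha> \<beta> \<nu> (e h) = e h \<and> h = H_fun r T \<alpha> \<beta> e Ks \<nu> h"

end

theory Submission
  imports Defs
begin

text \<open>
  The maps \<open>T\<^bsub>\<nu>,h\<^esub>\<close> depend on \<open>(\<nu>, h)\<close> only through the number \<open>s = \<nu> h(\<alpha>)\<close>. Let \<open>h\<^sub>s\<close> be the invariant
  density of \<open>T + s \<beta>\<close> and \<open>g s = h\<^sub>s(\<alpha>)\<close>. Then \<open>h\<close> is a fixed point for \<open>\<nu>\<close> if and only if \<open>h = h\<^sub>s\<close> for a
  solution \<open>s\<close> of the scalar equation \<open>s = \<nu> g s\<close>. Here \<open>s\<close> ranges over the compact interval of all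
  values \<open>\<nu> \<alpha>(x)\<close>, which are realised by point masses.

  The operator \<open>D\<^sub>h F\<close> is a rank one perturbation of the identity, and it is invertible if and only
  if \<open>\<nu> g' s \<noteq> 1\<close> (lemma \<open>DhF_invertible_iff\<close>). At a point where it is not, the second condition of the
  theorem says that the second order coefficient of \<open>g\<close> does not vanish (lemma \<open>D2hF_eq\<close>), and the third
  that \<open>g s \<noteq> 0\<close>. Thus \<open>s - \<nu> g s\<close> vanishes to order one or two at each of its zeros. It follows that
  the zeros are isolated and that the set of \<open>s\<close> with \<open>s / g s \<in> [0, \<nu>\<^sub>*]\<close> is a finite union of
  intervals, over which the curves are \<open>s \<mapsto> (s / g s, h\<^sub>s)\<close>; if \<open>g 0 = 0\<close>, there is also the constant
  curve \<open>h\<^sub>0\<close>. At a fold, \<open>s - \<nu> g s\<close> has a strict local extremum with value \<open>0\<close>, and a small change of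
  \<open>\<nu>\<close> makes it change sign twice nearby. Because it is \<open>\<le> 0\<close> at the left end of the parameter interval
  and \<open>\<ge> 0\<close> at the right end, there is a third zero (lemma \<open>fold_three_solutions\<close>).

  The analytic part is the expansion of \<open>h\<^sub>s\<close> to second order (theorems \<open>density_derivative\<close> and
  \<open>density_second_order\<close>). The derivative of \<open>L\<^sub>s h\<close> in \<open>s\<close> is \<open>- div (L\<^sub>s (\<beta> h))\<close>, at first only weakly,
  for smooth \<open>h\<close> and against smooth test functions. Since these are dense in the spaces and in
  their duals, the Hahn-Banach theorem and the mean value inequality (lemma \<open>weak_mean_value\<close>) turn this
  into norm estimates, each derivative costing one step in the scale of spaces. The identity
  \<open>h\<^sub>t - h\<^sub>s = (Id - L\<^sub>t)\<^sup>-\<^sup>1 (L\<^sub>t - L\<^sub>s) h\<^sub>s\<close> transfers the expansions to \<open>h\<^sub>s\<close>. For the second order one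
  the convergence takes place in the largest space, where the assumptions provide no bounded inverse of
  \<open>Id - L\<^sub>t\<close>; but the error stays bounded in the next smaller space, and on such families the resolvent
  is continuous at zero for the weaker norm (lemma \<open>res_tendsto_zero_weak\<close>).
\<close>

section \<open>Smooth functions on the torus\<close>

lemma has_derivative_imp_pd:
  assumes "(f has_derivative D) (at x)"
  shows "pd i f x = D (axis i 1)"
  using frechet_derivative_at[OF assms] by (simp add: pd_def)

lemma has_derivative_pd_sum:
  assumes "f differentiable (at x)"
  shows "(f has_derivative (\<lambda>v. \<Sum>i\<in>UNIV. v $ i * pd i f x)) (at x)"
proof -
  define D where "D = frechet_derivative f (at x)"
  have D: "(f has_derivative D) (at x)"
    using assms by (simp add: D_def frechet_derivative_works)
  have "D v = (\<Sum>i\<in>UNIV. v $ i * pd i f x)" for v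
  proof -
    have lin: "linear D" using D by (rule has_derivative_linear)
    have "D v = D (\<Sum>i\<in>UNIV. v $ i *s axis i 1)" by (simp add: basis_expansion)
    also have "\<dots> = (\<Sum>i\<in>UNIV. D (v $ i *\<^sub>R axis i 1))"
      by (simp add: linear_sum[OF lin] scalar_mult_eq_scaleR)
    also have "\<dots> = (\<Sum>i\<in>UNIV. v $ i * pd i f x)"
      unfolding linear_cmul[OF lin] by (simp add: pd_def D_def)
    finally show ?thesis .
  qed
  then have "D = (\<lambda>v. \<Sum>i\<in>UNIV. v $ i * pd i f x)" by blast
  with D show ?thesis by simp
qed

lemma Ck_differentiable: "Ck (Suc k) f \<Longrightarrow> f differentiable (at x)"
  by (auto simp: differentiable_on_def)

lemma Ck_pd: "Ck (Suc k) f \<Longrightarrow> Ck k (pd i f)"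
  by simp

lemma Ck_SucI:
  assumes "\<And>x. f differentiable (at x)" "\<And>i. Ck k (pd i f)"
  shows "Ck (Suc k) f"
  using assms by (auto simp: differentiable_on_def)

lemma Ck_Suc_D: "Ck (Suc k) f \<Longrightarrow> Ck k f"
proof (induction k arbitrary: f)
  case 0
  then show ?case
    by (auto intro: differentiable_imp_continuous_on)
next
  case (Suc k)
  show ?case
    using Suc.prems Suc.IH by (metis Ck.simps(2))
qed

lemma Ck_mono: "Ck k f \<Longrightarrow> j \<le> k \<Longrightarrow> Ck j f"
  by (induction k) (auto simp: le_Suc_eq simp del: Ck.simps dest: Ck_Suc_D)

lemma Ck_continuous: "Ck k f \<Longrightarrow> continuous_on UNIV f"
  using Ck_mono[of k f 0] by simp

lemma pd_const: "pd i (\<lambda>x. c) = (\<lambda>x. 0)"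
  by (rule ext, rule has_derivative_imp_pd) (auto intro: derivative_eq_intros)

lemma Ck_const: "Ck k (\<lambda>x. c)"
proof (induction k arbitrary: c)
  case (Suc k)
  show ?case by (rule Ck_SucI) (auto simp: pd_const Suc)
qed simp

lemma pd_add:
  assumes "f differentiable (at x)" "g differentiable (at x)"
  shows "pd i (\<lambda>x. f x + g x) x = pd i f x + pd i g x"
proof -
  have "((\<lambda>x. f x + g x) has_derivative
      (\<lambda>v. frechet_derivative f (at x) v + frechet_derivative g (at x) v)) (at x)"
    using assms by (intro has_derivative_add) (simp_all add: frechet_derivative_works)
  from has_derivative_imp_pd[OF this] show ?thesis by (simp add: pd_def)
qed

lemma pd_mult:
  assumes "f differentiable (at x)" "g differentiable (at x)"
  shows "pd i (\<lambda>x. f x * g x) x = f x * pd i g x + pd i f x * g x"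
proof -
  have "((\<lambda>x. f x * g x) has_derivative
      (\<lambda>v. f x * frechet_derivative g (at x) v + frechet_derivative f (at x) v * g x)) (at x)"
    using assms by (intro has_derivative_mult) (simp_all add: frechet_derivative_works)
  from has_derivative_imp_pd[OF this] show ?thesis by (simp add: pd_def)
qed

lemma Ck_add: "Ck k f \<Longrightarrow> Ck k g \<Longrightarrow> Ck k (\<lambda>x. f x + g x)"
proof (induction k arbitrary: f g)
  case (Suc k)
  note d = Ck_differentiable[OF Suc.prems(1)] Ck_differentiable[OF Suc.prems(2)]
  show ?case
  proof (rule Ck_SucI)
    show "Ck k (pd i (\<lambda>x. f x + g x))" for i
      using Suc.IH[OF Ck_pd[OF Suc.prems(1)] Ck_pd[OF Suc.prems(2)]]
      by (simp add: pd_add[OF d, abs_def])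
  qed (use d in auto)
qed (auto intro: continuous_intros)

lemma Ck_mult: "Ck k f \<Longrightarrow> Ck k g \<Longrightarrow> Ck k (\<lambda>x. f x * g x)"
proof (induction k arbitrary: f g)
  case (Suc k)
  note d = Ck_differentiable[OF Suc.prems(1)] Ck_differentiable[OF Suc.prems(2)]
  show ?case
  proof (rule Ck_SucI)
    show "Ck k (pd i (\<lambda>x. f x * g x))" for i
      using Ck_add[OF Suc.IH[OF Ck_Suc_D[OF Suc.prems(1)] Ck_pd[OF Suc.prems(2), of i]]
          Suc.IH[OF Ck_pd[OF Suc.prems(1), of i] Ck_Suc_D[OF Suc.prems(2)]]]
      by (simp add: pd_mult[OF d, abs_def])
  qed (use d in auto)
qed (auto intro: continuous_intros)

lemma Ck_sum: "(\<And>j. j \<in> A \<Longrightarrow> Ck k (f j)) \<Longrightarrow> Ck k (\<lambda>x. \<Sum>j\<in>A. f j x)"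
  by (induction A rule: infinite_finite_induct) (auto intro: Ck_add Ck_const)

lemma differentiable_vec_nth:
  fixes S :: "real ^ 'n \<Rightarrow> real ^ 'd"
  assumes "\<And>j. (\<lambda>x. S x $ j) differentiable (at x)"
  shows "(S has_derivative (\<lambda>v. \<chi> j. frechet_derivative (\<lambda>x. S x $ j) (at x) v)) (at x)"
proof -
  have "((\<lambda>x. S x \<bullet> b) has_derivative
      (\<lambda>v. (\<chi> j. frechet_derivative (\<lambda>x. S x $ j) (at x) v) \<bullet> b)) (at x)"
    if b: "b \<in> Basis" for b :: "real ^ 'd"
  proof -
    obtain j where j: "b = axis j 1" using b by (auto simp: Basis_vec_def)
    show ?thesis
      using assms[of j] by (simp add: j inner_axis frechet_derivative_works)
  qed
  then show ?thesis by (subst has_derivative_componentwise_within) auto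
qed

lemma pd_compose:
  fixes S :: "real ^ 'n \<Rightarrow> real ^ 'd"
  assumes S: "\<And>j. (\<lambda>x. S x $ j) differentiable (at x)" and f: "f differentiable (at (S x))"
  shows "pd i (\<lambda>x. f (S x)) x = (\<Sum>j\<in>UNIV. pd j f (S x) * pd i (\<lambda>x. S x $ j) x)"
  using has_derivative_imp_pd[OF has_derivative_compose[OF differentiable_vec_nth[OF S]
        has_derivative_pd_sum[OF f]], of i]
  by (simp add: pd_def mult.commute)

lemma differentiable_compose_vec:
  fixes S :: "real ^ 'n \<Rightarrow> real ^ 'd" and f :: "real ^ 'd \<Rightarrow> real"
  assumes S: "\<And>j. (\<lambda>x. S x $ j) differentiable (at x)" and f: "f differentiable (at (S x))"
  shows "(\<lambda>x. f (S x)) differentiable (at x)"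
  using has_derivative_compose[OF differentiable_vec_nth[OF S] has_derivative_pd_sum[OF f]]
  by (auto simp: differentiable_def)

lemma Ck_compose:
  fixes S :: "real ^ 'n \<Rightarrow> real ^ 'd"
  shows "Ck k f \<Longrightarrow> (\<And>j. Ck k (\<lambda>x. S x $ j)) \<Longrightarrow> Ck k (\<lambda>x. f (S x))"
proof (induction k arbitrary: f)
  case 0
  then have "continuous_on UNIV f" "continuous_on UNIV S"
    by (auto simp: continuous_on_componentwise[of UNIV S] Basis_vec_def inner_axis)
  then show ?case
    using continuous_on_compose2[of UNIV f UNIV S] by simp
next
  case (Suc k)
  note d = Ck_differentiable[OF Suc.prems(2)] Ck_differentiable[OF Suc.prems(1)]
  show ?case
  proof (rule Ck_SucI)
    show "Ck k (pd i (\<lambda>x. f (S x)))" for i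
    proof -
      have "Ck k (\<lambda>x. \<Sum>j\<in>UNIV. pd j f (S x) * pd i (\<lambda>x. S x $ j) x)"
        by (rule Ck_sum, rule Ck_mult)
           (rule Suc.IH[OF Ck_pd[OF Suc.prems(1)] Ck_Suc_D[OF Suc.prems(2)]] Ck_pd[OF Suc.prems(2)])+
      then show ?thesis by (simp add: pd_compose[OF d, abs_def])
    qed
  qed (rule differentiable_compose_vec[OF d])
qed

lemma periodicD: "periodic f \<Longrightarrow> v \<in> lattice \<Longrightarrow> f (x + v) = f x"
  by (simp add: periodic_def)

lemma periodic_pd:
  assumes "periodic f" "\<And>x. f differentiable (at x)"
  shows "periodic (pd i f)"
  unfolding periodic_def
proof (intro allI ballI)
  fix x v :: "real ^ 'a" assume v: "v \<in> lattice"
  have eq: "(\<lambda>y. f (y + v)) = f" using periodicD[OF assms(1) v] by auto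
  have "(f has_derivative frechet_derivative f (at (x + v))) (at (x + v))"
    using assms(2) by (simp add: frechet_derivative_works)
  then have "((\<lambda>y. f (y + v)) has_derivative frechet_derivative f (at (x + v))) (at x)"
    using has_derivative_compose[of "\<lambda>y. y + v" "\<lambda>h. h" x UNIV f]
      has_derivative_add_const[OF has_derivative_ident] by auto
  then show "pd i f (x + v) = pd i f x"
    using has_derivative_imp_pd[of f "frechet_derivative f (at (x + v))" x i]
    by (simp add: eq pd_def)
qed

lemma CT_pd: "f \<in> CT (Suc k) \<Longrightarrow> pd i f \<in> CT k"
  using periodic_pd[of f] Ck_pd[of k f] Ck_differentiable[of k f] unfolding CT_def by blast

lemma CT_mono: "f \<in> CT k \<Longrightarrow> j \<le> k \<Longrightarrow> f \<in> CT j"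
  by (auto simp: CT_def intro: Ck_mono)

lemma CT_const [simp]: "(\<lambda>x. c) \<in> CT k"
  by (simp add: CT_def periodic_def Ck_const)

lemma CT_add: "f \<in> CT k \<Longrightarrow> g \<in> CT k \<Longrightarrow> (\<lambda>x. f x + g x) \<in> CT k"
  by (auto simp: CT_def periodic_def intro: Ck_add)

lemma CT_mult: "f \<in> CT k \<Longrightarrow> g \<in> CT k \<Longrightarrow> (\<lambda>x. f x * g x) \<in> CT k"
  by (auto simp: CT_def periodic_def intro: Ck_mult)

lemma CT_lincomb: "f \<in> CT k \<Longrightarrow> g \<in> CT k \<Longrightarrow> (\<lambda>x. a * f x + b * g x) \<in> CT k"
  by (intro CT_add CT_mult CT_const)

lemma CT_diff: "f \<in> CT k \<Longrightarrow> g \<in> CT k \<Longrightarrow> (\<lambda>x. f x - g x) \<in> CT k"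
  using CT_lincomb[of f k g 1 "-1"] by simp

lemma CT_compose:
  assumes "f \<in> CT k" "torus_map k S"
  shows "(\<lambda>x. f (S x)) \<in> CT k"
proof -
  have "f (S (x + v)) = f (S x)" if "v \<in> lattice" for x v
    using periodicD[of f "S (x + v) - S x" "S x"] assms that by (auto simp: torus_map_def CT_def)
  moreover have "Ck k (\<lambda>x. f (S x))"
    by (rule Ck_compose) (use assms in \<open>simp_all add: torus_map_def CT_def\<close>)
  ultimately show ?thesis by (auto simp: CT_def periodic_def)
qed

lemma CT_continuous: "f \<in> CT k \<Longrightarrow> continuous_on A f"
  by (auto simp: CT_def intro: continuous_on_subset[OF Ck_continuous])

lemma CT_periodic: "f \<in> CT k \<Longrightarrow> periodic f"
  by (simp add: CT_def)

lemma lattice_translate_to_cube: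
  fixes x :: "real ^ 'd"
  obtains v where "v \<in> lattice" "x + v \<in> cbox 0 1"
proof
  show "(\<chi> i. - of_int \<lfloor>x $ i\<rfloor>) \<in> lattice" by (simp add: lattice_def)
  show "x + (\<chi> i. - of_int \<lfloor>x $ i\<rfloor>) \<in> cbox 0 1"
    by (auto simp: mem_box_cart) linarith
qed

text \<open>
  Compactness of the torus, the source of the uniform bounds and of the uniform continuity below:
  every point can be translated into the unit cube by a lattice vector.
\<close>

lemma periodic_range: "periodic f \<Longrightarrow> range f = f ` cbox 0 1"
proof safe
  fix x :: "real ^ 'a" assume f: "periodic f"
  obtain v :: "real ^ 'a" where "v \<in> lattice" "x + v \<in> cbox 0 1" by (rule lattice_translate_to_cube)
  then show "f x \<in> f ` cbox 0 1" using periodicD[OF f, of v x] by (metis image_eqI)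
qed auto

lemma CT_compact_range: "f \<in> CT k \<Longrightarrow> compact (range f)"
  by (simp add: periodic_range[OF CT_periodic] compact_continuous_image CT_continuous)

lemma CT_bounded: "f \<in> CT k \<Longrightarrow> \<exists>B. \<forall>x. \<bar>f x\<bar> \<le> B"
  using compact_imp_bounded[OF CT_compact_range] by (auto simp: bounded_iff)

lemma CT_uniformly_continuous:
  fixes f :: "real ^ 'd \<Rightarrow> real"
  assumes f: "f \<in> CT k" and e: "e > 0"
  shows "\<exists>d>0. \<forall>x z. norm z < d \<longrightarrow> \<bar>f (x + z) - f x\<bar> < e"
proof -
  have "uniformly_continuous_on (cbox (\<chi> i. -1) (\<chi> i. 2)) f"
    by (rule compact_uniformly_continuous[OF CT_continuous[OF f] compact_cbox])
  then obtain d where d: "d > 0" and uc: "\<And>x y. x \<in> cbox (\<chi> i. -1) (\<chi> i. 2) \<Longrightarrow>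
      y \<in> cbox (\<chi> i. -1) (\<chi> i. 2) \<Longrightarrow> dist y x < d \<Longrightarrow> dist (f y) (f x) < e"
    by (rule uniformly_continuous_onE[OF _ e]) blast
  show ?thesis
  proof (intro exI[of _ "min d 1"] conjI allI impI)
    fix x z :: "real ^ 'd" assume z: "norm z < min d 1"
    obtain v where v: "v \<in> lattice" "x + v \<in> cbox 0 1" by (rule lattice_translate_to_cube)
    have zi: "\<bar>z $ i\<bar> < 1" for i
      using component_le_norm_cart[of z i] z by linarith
    have 1: "x + v \<in> cbox (\<chi> i. -1) (\<chi> i. 2)"
      unfolding mem_box_cart
    proof
      fix i
      have "0 \<le> (x + v) $ i" "(x + v) $ i \<le> 1" using v(2) by (auto simp: mem_box_cart)
      then show "(\<chi> i. -1) $ i \<le> (x + v) $ i \<and> (x + v) $ i \<le> (\<chi> i. 2) $ i" by auto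
    qed
    have 2: "x + v + z \<in> cbox (\<chi> i. -1) (\<chi> i. 2)"
      unfolding mem_box_cart
    proof
      fix i
      have "0 \<le> (x + v) $ i" "(x + v) $ i \<le> 1" using v(2) by (auto simp: mem_box_cart)
      then show "(\<chi> i. -1) $ i \<le> (x + v + z) $ i \<and> (x + v + z) $ i \<le> (\<chi> i. 2) $ i"
        using zi[of i] by auto
    qed
    have "dist (f (x + v + z)) (f (x + v)) < e"
      by (rule uc[OF 1 2]) (use z in \<open>simp add: dist_norm\<close>)
    moreover have "f (x + v) = f x" "f (x + v + z) = f (x + z)"
      using periodicD[OF CT_periodic[OF f] v(1), of x] periodicD[OF CT_periodic[OF f] v(1), of "x + z"]
      by (simp_all add: ac_simps)
    ultimately show "\<bar>f (x + z) - f x\<bar> < e" by (simp add: dist_real_def)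
  qed (use d in auto)
qed

lemma pds_Nil [simp]: "pds [] f = f" by (simp add: pds_def)
lemma pds_Cons [simp]: "pds (i # is) f = pds is (pd i f)" by (simp add: pds_def)

lemma CT_pds: "f \<in> CT (length is + k) \<Longrightarrow> pds is f \<in> CT k"
  by (induction "is" arbitrary: f) (auto dest: CT_pd)

lemma pds_diff:
  "f \<in> CT (length is) \<Longrightarrow> g \<in> CT (length is) \<Longrightarrow>
    pds is (\<lambda>x. f x - g x) = (\<lambda>x. pds is f x - pds is g x)"
proof (induction "is" arbitrary: f g)
  case (Cons i "is")
  then have d: "f differentiable (at x)" "g differentiable (at x)" for x
    by (auto simp: CT_def differentiable_on_def)
  have "pd i (\<lambda>x. f x - g x) x = pd i f x - pd i g x" for x
  proof -
    have "((\<lambda>x. f x - g x) has_derivative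
        (\<lambda>v. frechet_derivative f (at x) v - frechet_derivative g (at x) v)) (at x)"
      using d by (intro has_derivative_diff) (simp_all add: frechet_derivative_works)
    from has_derivative_imp_pd[OF this] show ?thesis by (simp add: pd_def)
  qed
  then have "pd i (\<lambda>x. f x - g x) = (\<lambda>x. pd i f x - pd i g x)" by auto
  then show ?case
    using Cons.IH[of "pd i f" "pd i g"] Cons.prems by (auto intro: CT_pd)
qed simp

lemma finite_lists_length_le_UNIV: "finite {is :: 'd::finite list. length is \<le> k}"
  using finite_lists_length_le[of "UNIV :: 'd set" k] by simp

lemma CT_norm_less:
  assumes "\<And>is x. length is \<le> k \<Longrightarrow> \<bar>pds is f x\<bar> \<le> e" "e < e'"
  shows "CT_norm k f < e'"
proof -
  let ?A = "(\<lambda>is. SUP x. \<bar>pds is f x\<bar>) ` {is. length is \<le> k}"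
  have "finite ?A" using finite_lists_length_le_UNIV by auto
  moreover have "[] \<in> {is :: 'a list. length is \<le> k}" by simp
  then have "?A \<noteq> {}" by blast
  moreover have "(SUP x. \<bar>pds is f x\<bar>) < e'" if "length is \<le> k" for "is"
    using cSUP_least[of UNIV "\<lambda>x. \<bar>pds is f x\<bar>" e] assms that by force
  ultimately show ?thesis unfolding CT_norm_def by (subst Max_less_iff) auto
qed

section \<open>Mollification: density of smoother test functions\<close>



lemma has_derivative_integral_gradient:
  fixes F :: "real ^ 'd \<Rightarrow> real ^ 'd \<Rightarrow> real" and F' :: "real ^ 'd \<Rightarrow> real ^ 'd \<Rightarrow> real ^ 'd"
  assumes der: "\<And>x t. ((\<lambda>x. F x t) has_derivative (\<lambda>v. F' x t \<bullet> v)) (at x)"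
    and cont: "\<And>x. continuous_on (cbox a b) (F x)"
    and cont': "continuous_on (UNIV \<times> cbox a b) (\<lambda>(x, t). F' x t)"
  shows "((\<lambda>x. integral (cbox a b) (F x)) has_derivative
           (\<lambda>v. integral (cbox a b) (\<lambda>t. F' x t \<bullet> v))) (at x)"
proof -
  have c: "continuous_on (UNIV \<times> cbox a b) (\<lambda>(x, t). blinfun_inner_right (F' x t))"
    using bounded_linear.continuous_on[OF bounded_linear_blinfun_inner_right cont']
    by (simp add: case_prod_unfold)
  have "((\<lambda>x. integral (cbox a b) (F x)) has_derivative
      integral (cbox a b) (\<lambda>t. blinfun_inner_right (F' x t))) (at x within UNIV)"
    by (rule leibniz_rule[OF _ _ c]) (auto intro: der integrable_continuous cont)
  moreover have "continuous_on (cbox a b) (\<lambda>t. blinfun_inner_right (F' x t))"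
  proof -
    have "continuous_on (cbox a b) (\<lambda>t. (x, t))" by (intro continuous_intros)
    from continuous_on_compose2[OF c this] show ?thesis by auto
  qed
  then have "blinfun_apply (integral (cbox a b) (\<lambda>t. blinfun_inner_right (F' x t))) =
      (\<lambda>v. integral (cbox a b) (\<lambda>t. F' x t \<bullet> v))"
    by (auto simp: blinfun_apply_integral[OF integrable_continuous])
  ultimately show ?thesis by simp
qed

text \<open>
  The averages are to gain one derivative, so the kernel has to be continuously differentiable. The
  square of a truncated paraboloid is a simple kernel of this kind with compact support.
\<close>

definition bump :: "real ^ 'd \<Rightarrow> real" where
  "bump z = (max 0 (1 - z \<bullet> z))\<^sup>2"

text \<open>
  The convolution of \<open>f\<close> with the kernel \<open>\<kappa>\<close> rescaled to size \<open>e\<close>, not normalised. It is written as an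
  average over a fixed cube so that it makes sense for periodic \<open>f\<close> without any integrability issue.
\<close>

definition smear :: "(real ^ 'd \<Rightarrow> real) \<Rightarrow> real \<Rightarrow> (real ^ 'd \<Rightarrow> real) \<Rightarrow> real ^ 'd \<Rightarrow> real" where
  "smear \<kappa> e f x = integral (cbox (-1) 1) (\<lambda>z. f (x + e *\<^sub>R z) * \<kappa> z)"

lemma has_derivative_bump:
  "(bump has_derivative (\<lambda>v. (- 4 * max 0 (1 - z \<bullet> z)) *\<^sub>R z \<bullet> v)) (at z)"
proof -
  have "((\<lambda>s::real. (max 0 s)\<^sup>2) has_field_derivative 2 * max 0 s) (at s)" for s
  proof (cases "s = 0")
    case True
    have "((\<lambda>h::real. max 0 h) \<longlongrightarrow> max 0 0) (at 0)" by (intro tendsto_intros)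
    moreover have "((max 0 h)\<^sup>2 - (max 0 0)\<^sup>2) / (h - 0) = max 0 h" if "h \<noteq> 0" for h :: real
      using that by (auto simp: max_def power2_eq_square)
    ultimately show ?thesis
      unfolding True has_field_derivative_iff
      by (subst tendsto_cong[of _ "max 0"]) (auto simp: eventually_at_filter)
  next
    case False
    show ?thesis
    proof (cases "s > 0")
      case True
      have "((\<lambda>s::real. s\<^sup>2) has_field_derivative 2 * s) (at s)"
        by (auto intro!: derivative_eq_intros)
      then have "((\<lambda>s::real. (max 0 s)\<^sup>2) has_field_derivative 2 * s) (at s)"
        by (rule has_field_derivative_transform_within_open[of _ _ _ "{0<..}"]) (use True in auto)
      then show ?thesis using True by simp
    next
      assume "\<not> s > 0"
      with False have s: "s < 0" by simp
      have "((\<lambda>s::real. 0) has_field_derivative 0) (at s)" by simp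
      then have "((\<lambda>s::real. (max 0 s)\<^sup>2) has_field_derivative 0) (at s)"
        by (rule has_field_derivative_transform_within_open[of _ _ _ "{..<0}"]) (use s in auto)
      then show ?thesis using s by simp
    qed
  qed
  from has_derivative_compose[OF _ this[unfolded has_field_derivative_def], of "\<lambda>z. 1 - z \<bullet> z" _ z UNIV]
  have "((\<lambda>z. (max 0 (1 - z \<bullet> z))\<^sup>2) has_derivative
      (\<lambda>v. 2 * max 0 (1 - z \<bullet> z) * (- (z \<bullet> v + v \<bullet> z)))) (at z)"
    by (rule meta_mp) (auto intro!: derivative_eq_intros)
  then show ?thesis
    by (simp add: bump_def[abs_def] inner_commute algebra_simps)
qed

lemma continuous_bump [continuous_intros]: "continuous_on A bump"
  by (auto simp: bump_def[abs_def] intro!: continuous_intros)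

lemma bump_nonneg: "bump z \<ge> 0" by (simp add: bump_def)

lemma not_in_cube_imp_norm: "z \<notin> cbox (-1) (1 :: real ^ 'd) \<Longrightarrow> max 0 (1 - z \<bullet> z) = 0"
proof -
  assume "z \<notin> cbox (-1) (1 :: real ^ 'd)"
  then obtain i where "\<bar>z $ i\<bar> > 1" by (auto simp: mem_box_cart abs_if not_le) (smt (verit))+
  then have "norm z > 1" using component_le_norm_cart[of z i] by linarith
  then show ?thesis by (auto simp: dot_square_norm)
qed

lemma bump_integral_pos: "integral (cbox (-1) (1 :: real ^ 'd)) bump > 0"
proof -
  have 1: "(0 :: real ^ 'd) \<in> box (-1) 1" by (auto simp: mem_box_cart)
  have 0: "(0 :: real ^ 'd) \<in> cbox (-1) 1" by (auto simp: mem_box_cart)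
  have "integral (cbox (-1) (1 :: real ^ 'd)) bump \<noteq> 0"
    using 0 1 by (subst integral_cbox_eq_0_iff)
      (auto intro!: continuous_intros bump_nonneg bexI[OF _ 0] simp: bump_def)
  moreover have "integral (cbox (-1) (1 :: real ^ 'd)) bump \<ge> 0"
    by (intro integral_nonneg integrable_continuous continuous_intros bump_nonneg)
  ultimately show ?thesis by linarith
qed

lemma continuous_smear_integrand:
  fixes f \<kappa> :: "real ^ 'd \<Rightarrow> real"
  assumes "continuous_on UNIV f" "continuous_on UNIV \<kappa>"
  shows "continuous_on A (\<lambda>(x, z). f (x + e *\<^sub>R z) * \<kappa> z)"
  unfolding case_prod_unfold
  by (intro continuous_intros continuous_on_compose2[OF assms(1)] continuous_on_compose2[OF assms(2)]) auto

lemma continuous_smear_integrand1: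
  fixes f \<kappa> :: "real ^ 'd \<Rightarrow> real"
  assumes "continuous_on UNIV f" "continuous_on UNIV \<kappa>"
  shows "continuous_on A (\<lambda>z. f (x + e *\<^sub>R z) * \<kappa> z)"
  by (intro continuous_intros continuous_on_compose2[OF assms(1)] continuous_on_compose2[OF assms(2)]) auto

lemma continuous_smear:
  assumes "continuous_on UNIV f" "continuous_on UNIV \<kappa>"
  shows "continuous_on UNIV (smear \<kappa> e f)"
  unfolding smear_def[abs_def]
  by (rule integral_continuous_on_param[OF continuous_smear_integrand[OF assms]])

text \<open>
  The derivative can be moved onto the averaged function, so that averaging commutes with all the
  derivatives that \<open>f\<close> possesses.
\<close>

lemma smear_pd:
  assumes f: "Ck (Suc k) f" and \<kappa>: "continuous_on UNIV \<kappa>"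
  shows "smear \<kappa> e f differentiable (at x)" "pd i (smear \<kappa> e f) = smear \<kappa> e (pd i f)"
proof -
  let ?F' = "\<lambda>x z. \<kappa> z *\<^sub>R (\<chi> i. pd i f (x + e *\<^sub>R z))"
  have pdc: "continuous_on UNIV (pd i f)" for i using Ck_continuous[OF Ck_pd[OF f]] .
  have 1: "((\<lambda>x. f (x + e *\<^sub>R z) * \<kappa> z) has_derivative (\<lambda>v. ?F' x z \<bullet> v)) (at x)" for x z
  proof -
    have "((\<lambda>x. f (x + e *\<^sub>R z)) has_derivative (\<lambda>v. \<Sum>i\<in>UNIV. v $ i * pd i f (x + e *\<^sub>R z))) (at x)"
      using has_derivative_compose[OF has_derivative_add_const[OF has_derivative_ident]
          has_derivative_pd_sum[OF Ck_differentiable[OF f]], of "e *\<^sub>R z" x UNIV] .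
    from has_derivative_mult_left[OF this, of "\<kappa> z"]
    show ?thesis by (simp add: inner_vec_def sum_distrib_left sum_distrib_right ac_simps)
  qed
  have 2: "continuous_on (UNIV \<times> cbox (-1) 1) (\<lambda>(x, z). ?F' x z)"
    unfolding case_prod_unfold
    by (intro continuous_intros continuous_on_compose2[OF \<kappa>] continuous_on_compose2[OF pdc]) auto
  have D: "(smear \<kappa> e f has_derivative
      (\<lambda>v. integral (cbox (-1) 1) (\<lambda>z. ?F' x z \<bullet> v))) (at x)" for x
    unfolding smear_def[abs_def]
    by (rule has_derivative_integral_gradient[OF 1 _ 2])
       (rule continuous_smear_integrand1[OF Ck_continuous[OF f] \<kappa>])
  show "smear \<kappa> e f differentiable (at x)" using D by (auto simp: differentiable_def)
  show "pd i (smear \<kappa> e f) = smear \<kappa> e (pd i f)"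
    using has_derivative_imp_pd[OF D, of i]
    by (auto simp: smear_def inner_axis mult.commute)
qed

text \<open>
  After the substitution \<open>y = x + e z\<close> the variable \<open>x\<close> only occurs in the kernel, so that the
  averages may also differentiate the kernel. As the kernel vanishes outside the cube, the domain
  of integration can be kept fixed for nearby \<open>x\<close>.
\<close>

lemma smear_substitution:
  fixes f :: "real ^ 'd \<Rightarrow> real"
  assumes f: "continuous_on UNIV f" and \<kappa>: "continuous_on UNIV \<kappa>"
    and supp: "\<And>z. z \<notin> cbox (-1) 1 \<Longrightarrow> \<kappa> z = 0"
    and e: "0 < e" "e \<le> 1" and x: "dist x0 x < 1"
  shows "smear \<kappa> e f x = (1 / e) ^ CARD('d) *
    integral (cbox (x0 - 2) (x0 + 2)) (\<lambda>y. f y * \<kappa> ((1 / e) *\<^sub>R (y - x)))"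
proof -
  let ?F = "\<lambda>z. f (x + e *\<^sub>R z) * \<kappa> z"
  let ?G = "\<lambda>y. f y * \<kappa> ((1 / e) *\<^sub>R (y - x))"
  have "(?F has_integral smear \<kappa> e f x) (cbox (-1) 1)"
    unfolding smear_def
    by (intro integrable_integral integrable_continuous continuous_smear_integrand1 f \<kappa>)
  from has_integral_affinity[OF this, of "1 / e" "- ((1 / e) *\<^sub>R x)"] e
  have "(?G has_integral (1 / (1 / e) ^ CARD('d)) * smear \<kappa> e f x)
      ((\<lambda>z. e *\<^sub>R z + x) ` cbox (-1) 1)"
    by (simp add: algebra_simps)
  then have "(?G has_integral (1 / (1 / e) ^ CARD('d)) * smear \<kappa> e f x) (cbox (x0 - 2) (x0 + 2))"
  proof (rule has_integral_on_superset)
    fix y assume y: "y \<notin> (\<lambda>z. e *\<^sub>R z + x) ` cbox (-1) 1"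
    have "y = e *\<^sub>R ((1 / e) *\<^sub>R (y - x)) + x" using e by simp
    with y have "(1 / e) *\<^sub>R (y - x) \<notin> cbox (-1) 1" by blast
    then show "?G y = 0" using supp by simp
  next
    show "(\<lambda>z. e *\<^sub>R z + x) ` cbox (-1) 1 \<subseteq> cbox (x0 - 2) (x0 + 2)"
    proof safe
      fix z :: "real ^ 'd" assume z: "z \<in> cbox (-1) 1"
      have "\<bar>(e *\<^sub>R z + x) $ i - x0 $ i\<bar> \<le> 2" for i
      proof -
        have "\<bar>z $ i\<bar> \<le> 1" using z by (auto simp: mem_box_cart abs_le_iff)
        then have "e * \<bar>z $ i\<bar> \<le> 1 * 1" using e by (intro mult_mono) auto
        then have "\<bar>e * z $ i\<bar> \<le> 1" using e by (simp add: abs_mult)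
        moreover have "\<bar>(x - x0) $ i\<bar> < 1"
          using component_le_norm_cart[of "x - x0" i] x by (simp add: dist_norm norm_minus_commute)
        ultimately show ?thesis by simp
      qed
      then have "\<forall>i. \<bar>(e *\<^sub>R z + x) $ i - x0 $ i\<bar> \<le> 2" by blast
      then show "e *\<^sub>R z + x \<in> cbox (x0 - 2) (x0 + 2)"
        unfolding mem_box_cart by (simp add: abs_le_iff) (smt (verit))
    qed
  qed
  then have "integral (cbox (x0 - 2) (x0 + 2)) ?G = (1 / (1 / e) ^ CARD('d)) * smear \<kappa> e f x"
    by (rule integral_unique)
  then show ?thesis using e by simp
qed

lemma smear_continuous_C1:
  fixes f :: "real ^ 'd \<Rightarrow> real"
  assumes f: "continuous_on UNIV f" and e: "0 < e" "e \<le> 1"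
  shows "Ck 1 (smear bump e f)"
proof -
  define \<kappa> where "\<kappa> i z = (4 / e) * (max 0 (1 - z \<bullet> z) * z $ i)" for i and z :: "real ^ 'd"
  have \<kappa>c: "continuous_on UNIV (\<kappa> i)" for i
    unfolding \<kappa>_def by (intro continuous_intros)
  have \<kappa>0: "\<kappa> i z = 0" if "z \<notin> cbox (-1) 1" for i z
    using not_in_cube_imp_norm[OF that] by (simp add: \<kappa>_def)
  have bump0: "bump z = 0" if "z \<notin> cbox (-1) 1" for z :: "real ^ 'd"
    using not_in_cube_imp_norm[OF that] by (simp add: bump_def)
  have D: "(smear bump e f has_derivative (\<lambda>v. \<Sum>i\<in>UNIV. v $ i * smear (\<kappa> i) e f x0)) (at x0)" for x0
  proof -
    let ?B = "cbox (x0 - 2) (x0 + 2)" and ?c = "(1 / e) ^ CARD('d)"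
    let ?w = "\<lambda>x y. (1 / e) *\<^sub>R (y - x)"
    let ?F' = "\<lambda>x y. f y *\<^sub>R (\<chi> i. \<kappa> i (?w x y))"
    have 1: "((\<lambda>x. f y * bump (?w x y)) has_derivative (\<lambda>v. ?F' x y \<bullet> v)) (at x)" for x y
    proof -
      have "((\<lambda>x. ?w x y) has_derivative (\<lambda>v. - ((1 / e) *\<^sub>R v))) (at x)"
        by (auto intro!: derivative_eq_intros)
      from has_derivative_mult_right[OF has_derivative_compose[OF this has_derivative_bump], of "f y"]
      show ?thesis
        by (rule has_derivative_eq_rhs)
           (auto simp: \<kappa>_def inner_vec_def sum_distrib_left algebra_simps sum_negf[symmetric] fun_eq_iff
             sum_divide_distrib divide_simps intro!: sum.cong)
    qed
    have 2: "continuous_on (UNIV \<times> ?B) (\<lambda>(x, y). ?F' x y)"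
      unfolding case_prod_unfold
      by (intro continuous_intros continuous_on_compose2[OF f] continuous_on_compose2[OF \<kappa>c]) auto
    have 3: "continuous_on ?B (\<lambda>y. f y * bump (?w x y))" for x
      by (intro continuous_intros continuous_on_compose2[OF f] continuous_on_compose2[OF continuous_bump]) auto
    have "((\<lambda>x. ?c * integral ?B (\<lambda>y. f y * bump (?w x y))) has_derivative
        (\<lambda>v. ?c * integral ?B (\<lambda>y. ?F' x0 y \<bullet> v))) (at x0)"
      by (rule has_derivative_mult_right[OF has_derivative_integral_gradient[OF 1 3 2]])
    then have "(smear bump e f has_derivative (\<lambda>v. ?c * integral ?B (\<lambda>y. ?F' x0 y \<bullet> v))) (at x0)"
      by (rule has_derivative_transform_within_open[of _ _ _ _ "ball x0 1"])
         (auto simp: smear_substitution[OF f continuous_bump bump0 e])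
    moreover have "?c * integral ?B (\<lambda>y. ?F' x0 y \<bullet> v) = (\<Sum>i\<in>UNIV. v $ i * smear (\<kappa> i) e f x0)" for v
    proof -
      have int: "(\<lambda>y. f y * \<kappa> i (?w x0 y)) integrable_on ?B" for i
        by (intro integrable_continuous continuous_intros continuous_on_compose2[OF f]
            continuous_on_compose2[OF \<kappa>c]) auto
      have "integral ?B (\<lambda>y. ?F' x0 y \<bullet> v) =
          integral ?B (\<lambda>y. \<Sum>i\<in>UNIV. v $ i * (f y * \<kappa> i (?w x0 y)))"
        by (simp add: inner_vec_def sum_distrib_left algebra_simps)
      also have "\<dots> = (\<Sum>i\<in>UNIV. v $ i * integral ?B (\<lambda>y. f y * \<kappa> i (?w x0 y)))"
        by (subst integral_sum) (auto intro!: integrable_on_mult_right int)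
      finally show ?thesis
        by (simp add: sum_distrib_left smear_substitution[OF f \<kappa>c \<kappa>0 e, of x0 x0] algebra_simps)
    qed
    ultimately show ?thesis by (simp add: has_derivative_eq_rhs)
  qed
  have "pd i (smear bump e f) = smear (\<kappa> i) e f" for i
  proof
    fix x
    have "pd i (smear bump e f) x = (\<Sum>j\<in>UNIV. if j = i then smear (\<kappa> j) e f x else 0)"
      unfolding has_derivative_imp_pd[OF D] by (intro sum.cong) (auto simp: axis_def)
    then show "pd i (smear bump e f) x = smear (\<kappa> i) e f x" by simp
  qed
  moreover have "smear bump e f differentiable (at x)" for x
    using D by (auto simp: differentiable_def)
  ultimately show ?thesis
    unfolding One_nat_def by (intro Ck_SucI) (simp_all add: continuous_smear[OF f \<kappa>c])
qed

text \<open>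
  All but one of the derivatives fall on \<open>f\<close> and the last one falls on the kernel.
\<close>

lemma smear_gains_derivative:
  "Ck k f \<Longrightarrow> 0 < e \<Longrightarrow> e \<le> 1 \<Longrightarrow> Ck (Suc k) (smear bump e f)"
proof (induction k arbitrary: f)
  case 0
  then show ?case using smear_continuous_C1[of f e] by simp
next
  case (Suc k)
  show ?case
    by (rule Ck_SucI[OF smear_pd(1)[OF Suc.prems(1) continuous_bump]])
       (simp only: smear_pd(2)[OF Suc.prems(1) continuous_bump] Suc.IH[OF Ck_pd[OF Suc.prems(1)] Suc.prems(2,3)])
qed

lemma smear_CT:
  assumes "f \<in> CT k" "0 < e" "e \<le> 1"
  shows "smear bump e f \<in> CT (Suc k)"
proof -
  have "smear bump e f (x + v) = smear bump e f x" if "v \<in> lattice" for x v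
  proof -
    have "x + v + e *\<^sub>R z = x + e *\<^sub>R z + v" for z by (simp add: ac_simps)
    then show ?thesis
      using periodicD[OF CT_periodic[OF assms(1)] that] by (simp only: smear_def)
  qed
  then show ?thesis
    using assms smear_gains_derivative[of k f e] by (auto simp: CT_def periodic_def simp del: Ck.simps)
qed

lemma pds_smear:
  "f \<in> CT (length is) \<Longrightarrow> pds is (smear bump e f) = smear bump e (pds is f)"
proof (induction "is" arbitrary: f)
  case (Cons i "is")
  have "pd i (smear bump e f) = smear bump e (pd i f)"
    by (rule smear_pd(2)[OF _ continuous_bump, of "length is"]) (use Cons.prems in \<open>simp add: CT_def\<close>)
  then show ?case using Cons.IH[of "pd i f"] Cons.prems CT_pd by auto
qed simp

lemma smear_approx:
  fixes f :: "real ^ 'd \<Rightarrow> real"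
  assumes f: "f \<in> CT k" and \<epsilon>: "\<epsilon> > 0"
  defines "c \<equiv> integral (cbox (-1) (1 :: real ^ 'd)) bump"
  shows "\<exists>d>0. \<forall>e x. 0 < e \<and> e < d \<longrightarrow> \<bar>smear bump e f x / c - f x\<bar> \<le> \<epsilon>"
proof -
  have c: "c > 0" unfolding c_def by (rule bump_integral_pos)
  obtain d where d: "d > 0" and uc: "\<And>x z. norm z < d \<Longrightarrow> \<bar>f (x + z) - f x\<bar> < \<epsilon>"
    using CT_uniformly_continuous[OF f \<epsilon>] by blast
  obtain R where R: "R > 0" "\<And>z :: real ^ 'd. z \<in> cbox (-1) 1 \<Longrightarrow> norm z \<le> R"
    using bounded_cbox[of "-1" "1 :: real ^ 'd"] by (auto simp: bounded_pos)
  show ?thesis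
  proof (intro exI[of _ "d / R"] conjI allI impI)
    fix e x assume e: "0 < e \<and> e < d / R"
    let ?I = "\<lambda>h. integral (cbox (-1) (1 :: real ^ 'd)) h"
    have i1: "(\<lambda>z. f (x + e *\<^sub>R z) * bump z) integrable_on cbox (-1) 1"
      by (intro integrable_continuous continuous_smear_integrand1 CT_continuous[OF f] continuous_bump)
    have i2: "(\<lambda>z. f x * bump z) integrable_on cbox (-1) (1 :: real ^ 'd)"
      by (intro integrable_continuous continuous_intros)
    have i3: "(\<lambda>z. \<epsilon> * bump z) integrable_on cbox (-1) (1 :: real ^ 'd)"
      by (intro integrable_continuous continuous_intros)
    have "norm (?I (\<lambda>z. f (x + e *\<^sub>R z) * bump z - f x * bump z)) \<le> ?I (\<lambda>z. \<epsilon> * bump z)"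
    proof (rule integral_norm_bound_integral[OF integrable_diff[OF i1 i2] i3])
      fix z :: "real ^ 'd" assume z: "z \<in> cbox (-1) 1"
      have "norm (e *\<^sub>R z) \<le> e * R" using e R(2)[OF z] by (simp add: mult_left_mono)
      also have "\<dots> < d" using e R(1) by (simp add: pos_less_divide_eq)
      finally have "\<bar>f (x + e *\<^sub>R z) - f x\<bar> \<le> \<epsilon>" using uc by (meson less_imp_le)
      then have "\<bar>f (x + e *\<^sub>R z) - f x\<bar> * bump z \<le> \<epsilon> * bump z"
        by (intro mult_right_mono bump_nonneg)
      then show "norm (f (x + e *\<^sub>R z) * bump z - f x * bump z) \<le> \<epsilon> * bump z"
        by (simp add: bump_nonneg abs_mult left_diff_distrib[symmetric])
    qed
    moreover have "?I (\<lambda>z. f (x + e *\<^sub>R z) * bump z - f x * bump z) = smear bump e f x - f x * c"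
      by (simp add: integral_diff[OF i1 i2] smear_def c_def)
    moreover have "?I (\<lambda>z. \<epsilon> * bump z) = \<epsilon> * c" by (simp add: c_def)
    ultimately have "\<bar>smear bump e f x - f x * c\<bar> \<le> \<epsilon> * c" by (simp only: real_norm_def)
    moreover have "smear bump e f x / c - f x = (smear bump e f x - f x * c) / c"
      using c by (simp add: field_simps)
    ultimately show "\<bar>smear bump e f x / c - f x\<bar> \<le> \<epsilon>"
      using c by (simp add: abs_divide pos_divide_le_eq)
  qed (use d R in auto)
qed

text \<open>
  Averaging commutes with the derivatives of order \<open>\<le> r\<close>, each of which is uniformly continuous, and
  there are finitely many of them; so one scale \<open>e\<close> serves for all.
\<close>

theorem CT_Suc_dense:
  fixes f :: "real ^ 'd \<Rightarrow> real"
  assumes f: "f \<in> CT r" and \<epsilon>: "\<epsilon> > 0"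
  obtains g where "g \<in> CT (Suc r)" "CT_norm r (\<lambda>x. f x - g x) < \<epsilon>"
proof -
  define c where "c = integral (cbox (-1) (1 :: real ^ 'd)) bump"
  have c: "c > 0" unfolding c_def by (rule bump_integral_pos)
  have "\<forall>is\<in>{is. length is \<le> r}. \<exists>d>0. \<forall>e x. 0 < e \<and> e < d \<longrightarrow>
      \<bar>smear bump e (pds is f) x / c - pds is f x\<bar> \<le> \<epsilon> / 2"
  proof safe
    fix "is" :: "'d list" assume "length is \<le> r"
    then have "pds is f \<in> CT 0" using CT_pds[of f "is" 0] f CT_mono by fastforce
    from smear_approx[OF this, of "\<epsilon> / 2"] \<epsilon>
    show "\<exists>d>0. \<forall>e x. 0 < e \<and> e < d \<longrightarrow> \<bar>smear bump e (pds is f) x / c - pds is f x\<bar> \<le> \<epsilon> / 2"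
      by (simp add: c_def)
  qed
  then obtain d where d: "\<And>is. length is \<le> r \<Longrightarrow> d is > 0"
    "\<And>is e x. length is \<le> r \<Longrightarrow> 0 < e \<Longrightarrow> e < d is \<Longrightarrow>
      \<bar>smear bump e (pds is f) x / c - pds is f x\<bar> \<le> \<epsilon> / 2"
    unfolding bchoice_iff by auto
  have fin: "finite {is :: 'd list. length is \<le> r}" by (rule finite_lists_length_le_UNIV)
  define e where "e = min 1 (Min (d ` {is. length is \<le> r}) / 2)"
  have ne: "{is :: 'd list. length is \<le> r} \<noteq> {}" by (auto intro: exI[of _ "[]"])
  have "Min (d ` {is. length is \<le> r}) > 0"
    using fin ne d(1) by (subst Min_gr_iff) auto
  then have e: "0 < e" "e \<le> 1" by (auto simp: e_def)
  have ed: "e < d is" if "length is \<le> r" for "is"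
  proof -
    have "Min (d ` {is. length is \<le> r}) \<le> d is" using fin that by (intro Min_le) auto
    then show ?thesis using d(1)[OF that] by (auto simp: e_def min_def)
  qed
  define g where "g x = 1 / c * smear bump e f x" for x
  have gs: "smear bump e f \<in> CT (Suc r)" by (rule smear_CT[OF f e])
  have g: "g \<in> CT (Suc r)" unfolding g_def[abs_def] by (intro CT_mult CT_const gs)
  have "CT_norm r (\<lambda>x. f x - g x) < \<epsilon>"
  proof (rule CT_norm_less)
    fix "is" :: "'d list" and x assume "is": "length is \<le> r"
    have gi: "g \<in> CT (length is)" "f \<in> CT (length is)" "smear bump e f \<in> CT (length is)"
      using g gs f "is" by (auto intro: CT_mono)
    have "pds is g x = 1 / c * smear bump e (pds is f) x"
    proof -
      have "h \<in> CT (length is) \<Longrightarrow> pds is (\<lambda>x. a * h x) = (\<lambda>x. a * pds is h x)" for a h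
      proof (induction "is" arbitrary: h)
        case (Cons i "is")
        have "pd i (\<lambda>x. a * h x) x = a * pd i h x" for x
          using pd_mult[of "\<lambda>x. a" x h i] Cons.prems by (auto simp: pd_const CT_def differentiable_on_def)
        then have "pd i (\<lambda>x. a * h x) = (\<lambda>x. a * pd i h x)" by blast
        then show ?case using Cons.IH[OF CT_pd] Cons.prems by simp
      qed simp
      from this[OF gi(3), of "1 / c"] show ?thesis
        using pds_smear[OF gi(2), of e] by (simp add: g_def[abs_def])
    qed
    then show "\<bar>pds is (\<lambda>x. f x - g x) x\<bar> \<le> \<epsilon> / 2"
      using d(2)[OF "is" e(1) ed[OF "is"], of x] by (simp add: pds_diff[OF gi(2,1)] abs_minus_commute)
  qed (use \<epsilon> in simp)
  with g show thesis by (rule that)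
qed

lemma CT_norm_nonneg:
  assumes "f \<in> CT r" shows "CT_norm r f \<ge> 0"
proof -
  obtain B where "\<And>x. \<bar>f x\<bar> \<le> B" using CT_bounded[OF assms] by blast
  then have "\<bar>f 0\<bar> \<le> (SUP x. \<bar>f x\<bar>)" by (intro cSUP_upper bdd_aboveI2) auto
  then have "0 \<le> (SUP x. \<bar>pds [] f x\<bar>)" by simp
  also have "\<dots> \<le> CT_norm r f"
    unfolding CT_norm_def using finite_lists_length_le_UNIV[where ?'d='a]
    by (intro Max_ge) (auto intro!: image_eqI[of _ _ "[]"])
  finally show ?thesis .
qed

text \<open>
  The distributional derivative is prescribed on \<open>C\<^bsup>r+1\<^esup>\<close> only. Density makes it unique as a
  distribution of order \<open>r\<close>, which gives a meaning to its definite description.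
\<close>

lemma distribution_eqI:
  assumes u: "distribution r u" and v: "distribution r v"
    and eq: "\<And>\<phi>. \<phi> \<in> CT (Suc r) \<Longrightarrow> u \<phi> = v \<phi>"
  shows "u = v"
proof
  fix \<phi>
  show "u \<phi> = v \<phi>"
  proof (cases "\<phi> \<in> CT r")
    case False
    then show ?thesis using u v by (simp add: distribution_def)
  next
    case \<phi>: True
    obtain C where C: "\<And>\<psi>. \<psi> \<in> CT r \<Longrightarrow> \<bar>u \<psi>\<bar> \<le> C * CT_norm r \<psi>"
      using u unfolding distribution_def by blast
    obtain D where D: "\<And>\<psi>. \<psi> \<in> CT r \<Longrightarrow> \<bar>v \<psi>\<bar> \<le> D * CT_norm r \<psi>"
      using v unfolding distribution_def by blast
    have "\<bar>u \<phi> - v \<phi>\<bar> \<le> e" if e: "e > 0" for e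
    proof -
      define M where "M = \<bar>C\<bar> + \<bar>D\<bar> + 1"
      have "e / M > 0" using e by (simp add: M_def)
      then obtain g where g: "g \<in> CT (Suc r)" "CT_norm r (\<lambda>x. \<phi> x - g x) < e / M"
        by (rule CT_Suc_dense[OF \<phi>])
      have gr: "g \<in> CT r" using g(1) by (rule CT_mono) simp
      have lin: "w (\<lambda>x. \<phi> x - g x) = w \<phi> - w g" if "distribution r w" for w
      proof -
        have "w (\<lambda>x. 1 * \<phi> x + (- 1) * g x) = 1 * w \<phi> + (- 1) * w g"
          using that \<phi> gr unfolding distribution_def by blast
        then show ?thesis by simp
      qed
      have d: "(\<lambda>x. \<phi> x - g x) \<in> CT r" by (rule CT_diff[OF \<phi> gr])
      have N: "CT_norm r (\<lambda>x. \<phi> x - g x) \<ge> 0" by (rule CT_norm_nonneg[OF d])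
      have "u \<phi> - v \<phi> = u (\<lambda>x. \<phi> x - g x) - v (\<lambda>x. \<phi> x - g x)"
        using lin[OF u] lin[OF v] eq[OF g(1)] by simp
      also have "\<bar>\<dots>\<bar> \<le> C * CT_norm r (\<lambda>x. \<phi> x - g x) + D * CT_norm r (\<lambda>x. \<phi> x - g x)"
        using C[OF d] D[OF d] by linarith
      also have "\<dots> = (C + D) * CT_norm r (\<lambda>x. \<phi> x - g x)" by (simp add: algebra_simps)
      also have "\<dots> \<le> M * CT_norm r (\<lambda>x. \<phi> x - g x)"
        using N by (intro mult_right_mono) (auto simp: M_def)
      also have "\<dots> \<le> M * (e / M)"
        using g(2) by (intro mult_left_mono) (auto simp: M_def)
      also have "\<dots> = e" by (simp add: M_def)
      finally show ?thesis .
    qed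
    then have "\<bar>u \<phi> - v \<phi>\<bar> \<le> 0" by (rule field_le_epsilon[of _ 0, simplified])
    then show ?thesis by simp
  qed
qed

lemma dpd_eqI: "is_dpd r i h g \<Longrightarrow> dpd r i h = g"
  unfolding dpd_def by (rule the_equality) (auto simp: is_dpd_def intro: distribution_eqI)

section \<open>Norming functionals and a weak mean value inequality\<close>

definition sublinear :: "('a::real_vector \<Rightarrow> real) \<Rightarrow> bool" where
  "sublinear q \<longleftrightarrow> (\<forall>x y. q (x + y) \<le> q x + q y) \<and> (\<forall>c x. c \<ge> 0 \<longrightarrow> q (c *\<^sub>R x) = c * q x)"

lemma sublinear_add: "sublinear q \<Longrightarrow> q (x + y) \<le> q x + q y"
  and sublinear_scale: "sublinear q \<Longrightarrow> c \<ge> 0 \<Longrightarrow> q (c *\<^sub>R x) = c * q x"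
  by (auto simp: sublinear_def)

lemma sublinear_0: "sublinear q \<Longrightarrow> q 0 = 0"
  using sublinear_scale[of q 0 0] by simp

lemma sublinear_minus: "sublinear q \<Longrightarrow> - q (- x) \<le> q x"
  using sublinear_add[of q x "- x"] sublinear_0[of q] by simp

text \<open>
  Lowering a sublinear functional so that it becomes linear on the line through \<open>y\<close>. A sublinear
  functional that cannot be lowered any more is therefore linear.
\<close>

definition lowered :: "('a::real_vector \<Rightarrow> real) \<Rightarrow> 'a \<Rightarrow> 'a \<Rightarrow> real" where
  "lowered q y x = (INF t\<in>{0..}. q (x + t *\<^sub>R y) - t * q y)"

lemma
  assumes q: "sublinear q"
  shows sublinear_lowered: "sublinear (lowered q y)"
    and lowered_le: "lowered q y x \<le> q x"
    and lowered_minus: "lowered q y (- y) \<le> - q y"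
proof -
  let ?A = "\<lambda>x t. q (x + t *\<^sub>R y) - t * q y"
  have bdd: "bdd_below (?A x ` {0..})" for x
  proof (rule bdd_belowI2)
    fix t :: real assume "t \<in> {0..}"
    then have "t * q y = q ((x + t *\<^sub>R y) + - x)" by (simp add: sublinear_scale[OF q])
    also have "\<dots> \<le> q (x + t *\<^sub>R y) + q (- x)" by (rule sublinear_add[OF q])
    finally show "- q (- x) \<le> ?A x t" by simp
  qed
  have lo: "lowered q y x \<le> ?A x t" if "t \<ge> 0" for x t
    unfolding lowered_def using that by (intro cINF_lower[OF bdd]) auto
  have gr: "m \<le> lowered q y x" if "\<And>t. t \<ge> 0 \<Longrightarrow> m \<le> ?A x t" for x m
    unfolding lowered_def using that by (intro cINF_greatest) auto
  show "lowered q y x \<le> q x" using lo[of 0 x] by simp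
  show "lowered q y (- y) \<le> - q y" using lo[of 1 "- y"] by (simp add: sublinear_0[OF q])
  have sub: "lowered q y (x + z) \<le> lowered q y x + lowered q y z" for x z
  proof -
    have "lowered q y (x + z) - lowered q y z \<le> lowered q y x"
    proof (rule gr)
      fix s :: real assume s: "s \<ge> 0"
      have "lowered q y (x + z) - ?A x s \<le> lowered q y z"
      proof (rule gr)
        fix t :: real assume t: "t \<ge> 0"
        have "lowered q y (x + z) \<le> ?A (x + z) (s + t)" using s t by (intro lo) auto
        also have "q ((x + z) + (s + t) *\<^sub>R y) = q ((x + s *\<^sub>R y) + (z + t *\<^sub>R y))"
          by (simp add: algebra_simps)
        also have "\<dots> \<le> q (x + s *\<^sub>R y) + q (z + t *\<^sub>R y)" by (rule sublinear_add[OF q])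
        finally show "lowered q y (x + z) - ?A x s \<le> ?A z t" by (simp add: algebra_simps)
      qed
      then show "lowered q y (x + z) - lowered q y z \<le> ?A x s" by simp
    qed
    then show ?thesis by simp
  qed
  have hom_le: "lowered q y (c *\<^sub>R x) \<le> c * lowered q y x" if c: "c > 0" for c x
  proof -
    have "lowered q y (c *\<^sub>R x) / c \<le> lowered q y x"
    proof (rule gr)
      fix t :: real assume t: "t \<ge> 0"
      have "lowered q y (c *\<^sub>R x) \<le> ?A (c *\<^sub>R x) (c * t)" using c t by (intro lo) auto
      also have "\<dots> = c * ?A x t"
        using sublinear_scale[OF q, of c "x + t *\<^sub>R y"] c by (simp add: algebra_simps)
      finally show "lowered q y (c *\<^sub>R x) / c \<le> ?A x t" using c by (simp add: field_simps)
    qed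
    then show ?thesis using c by (simp add: field_simps)
  qed
  have hom: "lowered q y (c *\<^sub>R x) = c * lowered q y x" if c: "c \<ge> 0" for c x
  proof (cases "c = 0")
    case True
    have "0 \<le> lowered q y 0"
      by (rule gr) (simp add: sublinear_scale[OF q])
    then show ?thesis using True lo[of 0 0] by (simp add: sublinear_0[OF q])
  next
    case False
    then have c: "c > 0" using that by simp
    have "lowered q y (inverse c *\<^sub>R (c *\<^sub>R x)) \<le> inverse c * lowered q y (c *\<^sub>R x)"
      using c by (intro hom_le) auto
    then have "c * lowered q y x \<le> lowered q y (c *\<^sub>R x)" using c by (simp add: field_simps)
    with hom_le[OF c, of x] show ?thesis by simp
  qed
  show "sublinear (lowered q y)" using sub hom by (simp add: sublinear_def)
qed

text \<open>
  Zorn's lemma applies because the pointwise infimum of a chain of sublinear functionals is again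
  sublinear: to estimate it at a sum, use the smaller of two members of the chain. The infimum is
  finite since every sublinear \<open>q \<le> p\<close> satisfies \<open>q x \<ge> - p (- x)\<close>.
\<close>

lemma exists_minimal_sublinear:
  fixes p :: "'a::real_vector \<Rightarrow> real"
  assumes p: "sublinear p"
  obtains q where "sublinear q" "\<And>x. q x \<le> p x"
    "\<And>q'. sublinear q' \<Longrightarrow> (\<And>x. q' x \<le> q x) \<Longrightarrow> q' = q"
proof -
  define A where "A = {q. sublinear q \<and> (\<forall>x. q x \<le> p x)}"
  define P where "P q q' \<longleftrightarrow> (\<forall>x. q' x \<le> q x)" for q q' :: "'a \<Rightarrow> real"
  have "\<exists>m\<in>A. \<forall>a\<in>A. P m a \<longrightarrow> a = m"
  proof (rule predicate_Zorn)
    show "partial_order_on A (relation_of P A)"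
      by (rule partial_order_on_relation_ofI) (auto simp: P_def intro: order_trans intro!: ext antisym)
    fix C assume C: "C \<in> Chains (relation_of P A)"
    then have CA: "C \<subseteq> A" and ch: "\<And>a b. a \<in> C \<Longrightarrow> b \<in> C \<Longrightarrow> P a b \<or> P b a"
      by (auto simp: Chains_def relation_of_def)
    show "\<exists>u\<in>A. \<forall>a\<in>C. P a u"
    proof (cases "C = {}")
      case True
      then show ?thesis using p by (auto simp: A_def)
    next
      case False
      define u where "u x = (INF q\<in>C. q x)" for x
      have bdd: "bdd_below ((\<lambda>q. q x) ` C)" for x
      proof (rule bdd_belowI2)
        fix q assume "q \<in> C"
        then have "- q (- x) \<le> q x" "q (- x) \<le> p (- x)"
          using CA by (auto simp: A_def intro: sublinear_minus)
        then show "- p (- x) \<le> q x" by simp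
      qed
      have lo: "u x \<le> q x" if "q \<in> C" for q x
        unfolding u_def using that by (intro cINF_lower[OF bdd])
      have gr: "m \<le> u x" if "\<And>q. q \<in> C \<Longrightarrow> m \<le> q x" for m x
        unfolding u_def using that False by (intro cINF_greatest)
      have sl: "sublinear q" if "q \<in> C" for q using that CA by (auto simp: A_def)
      have "u (x + y) \<le> u x + u y" for x y
      proof -
        have "u (x + y) - u y \<le> u x"
        proof (rule gr)
          fix q assume q: "q \<in> C"
          have "u (x + y) - q x \<le> u y"
          proof (rule gr)
            fix q' assume q': "q' \<in> C"
            have "u (x + y) \<le> q x + q' y"
              using ch[OF q q'] lo[OF q, of "x + y"] lo[OF q', of "x + y"]
                sublinear_add[OF sl[OF q], of x y] sublinear_add[OF sl[OF q'], of x y]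
              unfolding P_def by (smt (verit))
            then show "u (x + y) - q x \<le> q' y" by simp
          qed
          then show "u (x + y) - u y \<le> q x" by simp
        qed
        then show ?thesis by simp
      qed
      moreover have "u (c *\<^sub>R x) = c * u x" if c: "c \<ge> 0" for c x
      proof (cases "c = 0")
        case True
        have "(INF q\<in>C. q (0::'a)) = (INF q\<in>C. (0::real))"
          using sublinear_0[OF sl] by (intro INF_cong) auto
        then show ?thesis using True False by (simp add: u_def)
      next
        case False
        then have c: "c > 0" using that by simp
        show ?thesis
        proof (rule antisym)
          have "u (c *\<^sub>R x) / c \<le> u x"
          proof (rule gr)
            fix q assume q: "q \<in> C"
            show "u (c *\<^sub>R x) / c \<le> q x"
              using lo[OF q, of "c *\<^sub>R x"] sublinear_scale[OF sl[OF q], of c x] c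
              by (simp add: field_simps)
          qed
          then show "u (c *\<^sub>R x) \<le> c * u x" using c by (simp add: field_simps)
          show "c * u x \<le> u (c *\<^sub>R x)"
          proof (rule gr)
            fix q assume q: "q \<in> C"
            show "c * u x \<le> q (c *\<^sub>R x)"
              using lo[OF q, of x] sublinear_scale[OF sl[OF q], of c x] c by simp
          qed
        qed
      qed
      ultimately have "sublinear u" by (simp add: sublinear_def)
      moreover have "u x \<le> p x" for x
        using False lo CA unfolding A_def by (metis (mono_tags, lifting) all_not_in_conv mem_Collect_eq order_trans subsetD)
      ultimately show ?thesis using lo by (intro bexI[of _ u]) (auto simp: A_def P_def)
    qed
  qed
  then obtain q where q: "q \<in> A" and min: "\<And>a. a \<in> A \<Longrightarrow> P q a \<Longrightarrow> a = q" by blast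
  show thesis
  proof (rule that[of q])
    show "sublinear q" "q x \<le> p x" for x using q by (auto simp: A_def)
    fix q' assume "sublinear q'" "\<And>x. q' x \<le> q x"
    moreover have "q' x \<le> p x" for x
      using \<open>q' x \<le> q x\<close> q by (auto simp: A_def intro: order_trans)
    ultimately show "q' = q" using q by (intro min) (auto simp: A_def P_def)
  qed
qed

text \<open>
  A consequence of the Hahn-Banach theorem. The minimal functional is taken below the norm lowered
  along \<open>x0\<close>, whose value at \<open>- x0\<close> is \<open>- norm x0\<close>; this forces the value \<open>norm x0\<close> at \<open>x0\<close>.
\<close>

theorem norming_functional:
  fixes x0 :: "'a::real_normed_vector"
  obtains l :: "'a \<Rightarrow>\<^sub>L real" where "norm l \<le> 1" "blinfun_apply l x0 = norm x0"
proof -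
  have n: "sublinear (norm :: 'a \<Rightarrow> real)" by (auto simp: sublinear_def norm_triangle_ineq)
  obtain q where q: "sublinear q" and le: "\<And>x. q x \<le> lowered norm x0 x"
    and min: "\<And>q'. sublinear q' \<Longrightarrow> (\<And>x. q' x \<le> q x) \<Longrightarrow> q' = q"
    using exists_minimal_sublinear[OF sublinear_lowered[OF n, of x0]] by blast
  have neg: "q (- y) = - q y" for y
  proof -
    have "lowered q y = q"
      by (rule min[OF sublinear_lowered[OF q]]) (rule lowered_le[OF q])
    then have "q (- y) \<le> - q y" using lowered_minus[OF q, of y] by simp
    with sublinear_minus[OF q, of y] show ?thesis by linarith
  qed
  have add: "q (x + y) = q x + q y" for x y
    using sublinear_add[OF q, of x y] sublinear_add[OF q, of "- x" "- y"] neg[of "x + y"]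
    by (simp add: neg algebra_simps)
  have scale: "q (c *\<^sub>R x) = c * q x" for c x
  proof (cases "c \<ge> 0")
    case False
    then show ?thesis using sublinear_scale[OF q, of "- c" x] neg[of "c *\<^sub>R x"] by simp
  qed (rule sublinear_scale[OF q])
  have qn: "q x \<le> norm x" for x using le[of x] lowered_le[OF n, of x0 x] by linarith
  have abs: "\<bar>q x\<bar> \<le> norm x" for x
    using qn[of x] qn[of "- x"] by (simp add: neg abs_le_iff)
  have bl: "bounded_linear q"
    by (rule bounded_linear_intro[of _ 1]) (auto simp: add scale abs)
  show thesis
  proof (rule that[of "Blinfun q"])
    show "norm (Blinfun q) \<le> 1"
      by (rule norm_blinfun_bound) (auto simp: bounded_linear_Blinfun_apply[OF bl] abs)
    have "q (- x0) \<le> - norm x0" using le[of "- x0"] lowered_minus[OF n, of x0] by linarith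
    then show "blinfun_apply (Blinfun q) x0 = norm x0"
      using qn[of x0] by (simp add: bounded_linear_Blinfun_apply[OF bl] neg)
  qed
qed

text \<open>
  Test the increment with a norming functional and apply the mean value inequality for real
  functions; functionals in the dense set suffice, since the resulting bound is continuous in the
  functional. The curves \<open>u \<mapsto> L u h\<close> to which this is applied are differentiable in norm only after
  passing to a larger space, but the estimate does not pass to a larger space.
\<close>

lemma weak_mean_value:
  fixes w w' :: "real \<Rightarrow> 'b::real_normed_vector" and P :: "('b \<Rightarrow>\<^sub>L real) set"
  assumes dense: "closure P = UNIV"
    and der: "\<And>l u. l \<in> P \<Longrightarrow> u \<in> closed_segment s t \<Longrightarrow>
      ((\<lambda>u. blinfun_apply l (w u)) has_real_derivative blinfun_apply l (w' u))
        (at u within closed_segment s t)"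
    and bound: "\<And>u. u \<in> closed_segment s t \<Longrightarrow> norm (w' u) \<le> B"
  shows "norm (w t - w s) \<le> B * \<bar>t - s\<bar>"
proof -
  have P: "\<bar>blinfun_apply l (w t - w s)\<bar> \<le> norm l * (B * \<bar>t - s\<bar>)" if l: "l \<in> P" for l
  proof -
    have "norm (blinfun_apply l (w t) - blinfun_apply l (w s)) \<le> (norm l * B) * norm (t - s)"
    proof (rule field_differentiable_bound[where S="closed_segment s t"])
      fix u assume u: "u \<in> closed_segment s t"
      show "((\<lambda>u. blinfun_apply l (w u)) has_real_derivative blinfun_apply l (w' u))
          (at u within closed_segment s t)" by (rule der[OF l u])
      show "norm (blinfun_apply l (w' u)) \<le> norm l * B"
        using norm_blinfun[of l "w' u"] mult_left_mono[OF bound[OF u], of "norm l"] by simp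
    qed auto
    then show ?thesis by (simp add: blinfun.diff_right mult.assoc)
  qed
  have "closed {l :: 'b \<Rightarrow>\<^sub>L real. \<bar>blinfun_apply l (w t - w s)\<bar> \<le> norm l * (B * \<bar>t - s\<bar>)}"
    by (intro closed_Collect_le continuous_intros)
  then have "closure P \<subseteq> {l. \<bar>blinfun_apply l (w t - w s)\<bar> \<le> norm l * (B * \<bar>t - s\<bar>)}"
    using P by (intro closure_minimal) auto
  then have all: "\<bar>blinfun_apply l (w t - w s)\<bar> \<le> norm l * (B * \<bar>t - s\<bar>)" for l
    using dense by auto
  obtain l :: "'b \<Rightarrow>\<^sub>L real" where l: "norm l \<le> 1" "blinfun_apply l (w t - w s) = norm (w t - w s)"
    by (rule norming_functional)
  have B: "B * \<bar>t - s\<bar> \<ge> 0"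
    using order_trans[OF norm_ge_zero bound[of s]] by simp
  have "norm (w t - w s) \<le> norm l * (B * \<bar>t - s\<bar>)" using all[of l] l(2) by simp
  also have "\<dots> \<le> 1 * (B * \<bar>t - s\<bar>)" using l(1) B by (intro mult_right_mono)
  finally show ?thesis by simp
qed

section \<open>Mixing families of operators: invariant densities and resolvents\<close>

text \<open>
  The abstract form of the spectral gap: powers are bounded, and on the kernel of \<open>mean\<close> they
  eventually contract, uniformly in the parameter \<open>u \<in> J\<close>. The vector \<open>one\<close> is the initial density
  whose iterates converge to the invariant one.
\<close>

locale mixing_family =
  fixes J :: "real set" and L :: "real \<Rightarrow> 'b::banach \<Rightarrow> 'b" and mean :: "'b \<Rightarrow> real"
    and one :: 'b and M \<theta> :: real and N :: nat
  assumes L: "\<And>u. u \<in> J \<Longrightarrow> bounded_linear (L u)"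
    and mean: "bounded_linear mean"
    and mean_L: "\<And>u x. u \<in> J \<Longrightarrow> mean (L u x) = mean x"
    and bound: "\<And>u n x. u \<in> J \<Longrightarrow> norm ((L u ^^ n) x) \<le> M * norm x"
    and contract: "\<And>u n x. u \<in> J \<Longrightarrow> mean x = 0 \<Longrightarrow> n \<ge> N \<Longrightarrow> norm ((L u ^^ n) x) \<le> \<theta> ^ n * norm x"
    and \<theta>: "0 < \<theta>" "\<theta> < 1"
    and mean_one: "mean one = 1"
    and M: "M \<ge> 0"
begin

text \<open>The inverse of \<open>Id - L u\<close> on the kernel of \<open>mean\<close>, as a Neumann series.\<close>

definition res :: "real \<Rightarrow> 'b \<Rightarrow> 'b" where
  "res u f = (\<Sum>n. (L u ^^ n) f)"

definition res_bound :: real where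
  "res_bound = of_nat N * M + 1 / (1 - \<theta>)"

lemma res_bound_nonneg: "res_bound \<ge> 0"
  using M \<theta> by (simp add: res_bound_def)

lemma mean_pow: "u \<in> J \<Longrightarrow> mean ((L u ^^ n) x) = mean x"
  by (induction n) (auto simp: mean_L)

lemma norm_pow_le:
  assumes "u \<in> J" "mean f = 0"
  shows "norm ((L u ^^ n) f) \<le> ((if n < N then M else 0) + \<theta> ^ n) * norm f"
proof (cases "n < N")
  case True
  have "M * norm f \<le> (M + \<theta> ^ n) * norm f" using \<theta> by (intro mult_right_mono) auto
  then show ?thesis using bound[OF assms(1), of n f] True by simp
qed (use contract[OF assms, of n] in simp)

lemma majorant_sums: "(\<lambda>n. ((if n < N then M else 0) + \<theta> ^ n) * c) sums (res_bound * c)"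
proof -
  have "(\<lambda>n. if n < N then M else 0) sums (\<Sum>n\<in>{..<N}. if n < N then M else 0)"
    by (rule sums_finite) auto
  then have "(\<lambda>n. if n < N then M else 0) sums (of_nat N * M)" by simp
  moreover have "(\<lambda>n. \<theta> ^ n) sums (1 / (1 - \<theta>))" using \<theta> by (intro geometric_sums) auto
  ultimately show ?thesis unfolding res_bound_def by (intro sums_mult2 sums_add)
qed

lemma summable_pow:
  assumes "u \<in> J" "mean f = 0"
  shows "summable (\<lambda>n. (L u ^^ n) f)"
  by (rule summable_comparison_test'[OF sums_summable[OF majorant_sums[of "norm f"]]])
     (rule norm_pow_le[OF assms])

lemma norm_res_le:
  assumes "u \<in> J" "mean f = 0"
  shows "norm (res u f) \<le> res_bound * norm f"
  unfolding res_def sums_unique[OF majorant_sums[of "norm f"]]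
  by (rule norm_suminf_le[OF norm_pow_le[OF assms] sums_summable[OF majorant_sums]])

lemma mean_res:
  assumes "u \<in> J" "mean f = 0"
  shows "mean (res u f) = 0"
  unfolding res_def bounded_linear.suminf[OF mean summable_pow[OF assms]]
  by (simp add: mean_pow assms)

lemma res_eq:
  assumes "u \<in> J" "mean f = 0"
  shows "res u f - L u (res u f) = f"
proof -
  have "L u (res u f) = (\<Sum>n. (L u ^^ Suc n) f)"
    unfolding res_def bounded_linear.suminf[OF L[OF assms(1)] summable_pow[OF assms]] by simp
  moreover have "(\<Sum>n. (L u ^^ Suc n) f) = res u f - f"
    using suminf_split_head[OF summable_pow[OF assms]] by (simp add: res_def)
  ultimately show ?thesis by simp
qed

lemma fixed_mean_zero:
  assumes u: "u \<in> J" and x: "mean x = 0" "L u x = x"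
  shows "x = 0"
proof -
  have "(L u ^^ n) x = x" for n by (induction n) (auto simp: x)
  then have "norm x \<le> \<theta> ^ Suc N * norm x"
    using contract[OF u x(1), of "Suc N"] by (simp del: funpow.simps power_Suc)
  moreover have "\<theta> ^ Suc N < 1" using \<theta> by (intro power_Suc_less_one) auto
  ultimately have "\<not> 0 < norm x"
    using mult_strict_right_mono[of "\<theta> ^ Suc N" 1 "norm x"] by linarith
  then show ?thesis by simp
qed

lemma res_unique:
  assumes u: "u \<in> J" and y: "mean y = 0" "y - L u y = f"
  shows "res u f = y"
proof -
  interpret l: bounded_linear mean by (rule mean)
  interpret Lu: bounded_linear "L u" by (rule L[OF u])
  have f: "mean f = 0" using y mean_L[OF u, of y] l.diff[of y "L u y"] by simp
  have "res u f - y = 0"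
  proof (rule fixed_mean_zero[OF u])
    show "mean (res u f - y) = 0" by (simp add: l.diff mean_res[OF u f] y)
    show "L u (res u f - y) = res u f - y"
    proof -
      have "L u (res u f) = res u f - f" "L u y = y - f" using res_eq[OF u f] y(2) by (auto simp: algebra_simps)
      then show ?thesis by (simp add: Lu.diff)
    qed
  qed
  then show ?thesis by simp
qed

lemma res_lincomb:
  assumes u: "u \<in> J" and f: "mean f = 0" "mean g = 0"
  shows "res u (a *\<^sub>R f + b *\<^sub>R g) = a *\<^sub>R res u f + b *\<^sub>R res u g"
proof (rule res_unique[OF u])
  interpret l: bounded_linear mean by (rule mean)
  interpret Lu: bounded_linear "L u" by (rule L[OF u])
  show "mean (a *\<^sub>R res u f + b *\<^sub>R res u g) = 0"
    by (simp add: l.add l.scaleR mean_res u f)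
  have "a *\<^sub>R res u f + b *\<^sub>R res u g - L u (a *\<^sub>R res u f + b *\<^sub>R res u g)
      = a *\<^sub>R (res u f - L u (res u f)) + b *\<^sub>R (res u g - L u (res u g))"
    by (simp add: Lu.add Lu.scaleR algebra_simps)
  then show "a *\<^sub>R res u f + b *\<^sub>R res u g - L u (a *\<^sub>R res u f + b *\<^sub>R res u g) = a *\<^sub>R f + b *\<^sub>R g"
    by (simp add: res_eq u f)
qed

lemma res_scale: "u \<in> J \<Longrightarrow> mean f = 0 \<Longrightarrow> res u (a *\<^sub>R f) = a *\<^sub>R res u f"
  using res_lincomb[of u f f a 0] by simp

lemma res_zero: "u \<in> J \<Longrightarrow> res u 0 = 0"
  using res_unique[of u 0 0] bounded_linear.linear[OF L, of u] linear_0[of "L u"]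
    linear_0[OF bounded_linear.linear[OF mean]] by simp

lemma res_sum:
  assumes u: "u \<in> J" and f: "\<And>i. i \<in> A \<Longrightarrow> mean (f i) = 0"
  shows "res u (\<Sum>i\<in>A. f i) = (\<Sum>i\<in>A. res u (f i))"
  using f
proof (induction A rule: infinite_finite_induct)
  case (insert i A)
  have "mean (\<Sum>i\<in>A. f i) = 0"
    using insert.prems by (simp add: linear_sum[OF bounded_linear.linear[OF mean]])
  then show ?case
    using res_lincomb[OF u, of "f i" "\<Sum>i\<in>A. f i" 1 1] insert by simp
qed (auto simp: res_zero u)

lemma res_partial_sum:
  assumes u: "u \<in> J" and f: "mean f = 0"
  shows "res u f = (\<Sum>n<k. (L u ^^ n) f) + (L u ^^ k) (res u f)"
proof (induction k)
  case (Suc k)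
  interpret Lu: bounded_linear "L u" by (rule L[OF u])
  have lin: "(L u ^^ k) (x + y) = (L u ^^ k) x + (L u ^^ k) y" for x y
    by (induction k) (auto simp: Lu.add)
  have "res u f = f + L u (res u f)" using res_eq[OF u f] by (simp add: algebra_simps)
  then have "(L u ^^ k) (res u f) = (L u ^^ k) (f + L u (res u f))" by (rule arg_cong)
  also have "\<dots> = (L u ^^ k) f + (L u ^^ Suc k) (res u f)" by (simp add: lin funpow_swap1)
  finally have "(L u ^^ k) (res u f) = (L u ^^ k) f + (L u ^^ Suc k) (res u f)" .
  with Suc.IH have "res u f = (\<Sum>n<k. (L u ^^ n) f) + ((L u ^^ k) f + (L u ^^ Suc k) (res u f))"
    by (metis (no_types))
  then show ?case by (simp only: sum.lessThan_Suc add.assoc)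
qed simp

text \<open>
  With \<open>y = (Id - L s)\<^sup>-\<^sup>1 f0\<close> the difference \<open>(Id - L t)\<^sup>-\<^sup>1 (f t) - y\<close> is the resolvent at \<open>t\<close> of
  \<open>f t - f0 + L t y - L s y\<close>. As the resolvents are uniformly bounded, strong continuity of \<open>L\<close> gives
  strong continuity of the resolvent.
\<close>

lemma res_tendsto:
  assumes s: "s \<in> J" and cont: "\<And>x. ((\<lambda>t. L t x) \<longlongrightarrow> L s x) (at s within J)"
    and f: "(f \<longlongrightarrow> f0) (at s within J)" "\<And>t. t \<in> J \<Longrightarrow> mean (f t) = 0" "mean f0 = 0"
  shows "((\<lambda>t. res t (f t)) \<longlongrightarrow> res s f0) (at s within J)"
proof -
  interpret l: bounded_linear mean by (rule mean)
  define y where "y = res s f0"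
  define g where "g t = f t - f0 + (L t y - L s y)" for t
  have y0: "mean y = 0" "y - L s y = f0" using mean_res[OF s f(3)] res_eq[OF s f(3)] by (auto simp: y_def)
  have g: "((\<lambda>t. res_bound * norm (g t)) \<longlongrightarrow> 0) (at s within J)"
    unfolding g_def by (rule tendsto_eq_intros f cont refl | simp)+
  have "((\<lambda>t. res t (f t) - y) \<longlongrightarrow> 0) (at s within J)"
  proof (rule Lim_null_comparison[OF _ g])
    show "\<forall>\<^sub>F t in at s within J. norm (res t (f t) - y) \<le> res_bound * norm (g t)"
      unfolding eventually_at_filter
    proof (intro always_eventually allI impI)
      fix t assume t: "t \<in> J"
      interpret Lt: bounded_linear "L t" by (rule L[OF t])
      have g0: "mean (g t) = 0"
        by (simp add: g_def l.add l.diff mean_L t s f)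
      have "res t (g t) = res t (f t) - y"
      proof (rule res_unique[OF t])
        show "mean (res t (f t) - y) = 0" by (simp add: l.diff mean_res f t y0)
        have "res t (f t) - y - L t (res t (f t) - y) = f t - y + L t y"
          using res_eq[OF t f(2)[OF t]] by (simp add: Lt.diff algebra_simps)
        also have "\<dots> = g t" using y0(2) by (simp add: g_def algebra_simps)
        finally show "res t (f t) - y - L t (res t (f t) - y) = g t" .
      qed
      then show "norm (res t (f t) - y) \<le> res_bound * norm (g t)"
        using norm_res_le[OF t g0] by simp
    qed
  qed
  then show ?thesis by (simp add: y_def LIM_zero_iff)
qed

text \<open>
  Summing the increments \<open>L\<^sup>n\<^sup>+\<^sup>1 one - L\<^sup>n one\<close>, this is the limit of \<open>L\<^sup>n one\<close>.
\<close>

definition dens :: "real \<Rightarrow> 'b" where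
  "dens u = one + res u (L u one - one)"

lemma mean_defect: "u \<in> J \<Longrightarrow> mean (L u x - x) = 0"
  by (simp add: bounded_linear.linear[OF mean] linear_diff mean_L)

lemma dens_mean: "u \<in> J \<Longrightarrow> mean (dens u) = 1"
  by (simp add: dens_def bounded_linear.linear[OF mean] linear_add mean_one mean_res mean_defect)

lemma dens_fixed: "u \<in> J \<Longrightarrow> L u (dens u) = dens u"
proof -
  assume u: "u \<in> J"
  have "L u (res u (L u one - one)) = res u (L u one - one) - (L u one - one)"
    using res_eq[OF u mean_defect[OF u], of one] by (simp add: algebra_simps)
  then show ?thesis by (simp add: dens_def bounded_linear.linear[OF L[OF u]] linear_add)
qed

lemma dens_unique:
  assumes "u \<in> J" "mean x = 1" "L u x = x" shows "x = dens u"
proof -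
  have "x - dens u = 0"
    using assms by (intro fixed_mean_zero[of u])
      (simp_all add: dens_mean dens_fixed linear_diff bounded_linear.linear[OF mean] bounded_linear.linear[OF L])
  then show ?thesis by simp
qed

lemma pow_tendsto_dens:
  assumes u: "u \<in> J"
  shows "(\<lambda>n. (L u ^^ n) one) \<longlonglongrightarrow> dens u"
proof -
  interpret Lu: bounded_linear "L u" by (rule L[OF u])
  have diff: "(L u ^^ n) (x - y) = (L u ^^ n) x - (L u ^^ n) y" for x y n
    by (induction n) (auto simp: Lu.diff)
  have fixed: "(L u ^^ n) (dens u) = dens u" for n by (induction n) (auto simp: dens_fixed u)
  have m: "mean (one - dens u) = 0"
    by (simp add: bounded_linear.linear[OF mean] linear_diff mean_one dens_mean u)
  have "(\<lambda>n. (L u ^^ n) (one - dens u)) \<longlonglongrightarrow> 0"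
    by (rule summable_LIMSEQ_zero[OF summable_pow[OF u m]])
  then show ?thesis by (simp add: diff fixed LIM_zero_iff)
qed

lemma norm_dens_le: "u \<in> J \<Longrightarrow> norm (dens u) \<le> M * norm one"
  by (rule Lim_norm_ubound[OF _ pow_tendsto_dens]) (auto simp: bound)

text \<open>Subtract the two fixed point equations: \<open>h\<^sub>t - h\<^sub>s = L\<^sub>t (h\<^sub>t - h\<^sub>s) + (L\<^sub>t - L\<^sub>s) h\<^sub>s\<close>.\<close>

lemma dens_increment:
  assumes s: "s \<in> J" and t: "t \<in> J"
  shows "dens t - dens s = res t (L t (dens s) - L s (dens s))"
proof (rule res_unique[OF t, symmetric])
  show "mean (dens t - dens s) = 0"
    by (simp add: bounded_linear.linear[OF mean] linear_diff dens_mean s t)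
  show "dens t - dens s - L t (dens t - dens s) = L t (dens s) - L s (dens s)"
    by (simp add: bounded_linear.linear[OF L] linear_diff dens_fixed s t)
qed

lemma dens_derivative:
  assumes s: "s \<in> J" and cont: "\<And>x. ((\<lambda>t. L t x) \<longlongrightarrow> L s x) (at s within J)"
    and der: "((\<lambda>t. (1 / (t - s)) *\<^sub>R (L t (dens s) - L s (dens s))) \<longlongrightarrow> a) (at s within J)"
    and a: "mean a = 0"
  shows "((\<lambda>t. (1 / (t - s)) *\<^sub>R (dens t - dens s)) \<longlongrightarrow> res s a) (at s within J)"
proof -
  interpret l: bounded_linear mean by (rule mean)
  have m: "mean (L t (dens s) - L s (dens s)) = 0" if "t \<in> J" for t
    by (simp add: l.diff mean_L s that)
  have "((\<lambda>t. res t ((1 / (t - s)) *\<^sub>R (L t (dens s) - L s (dens s)))) \<longlongrightarrow> res s a) (at s within J)"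
    by (rule res_tendsto[OF s cont der _ a]) (simp add: l.scaleR m)
  then show ?thesis
    by (rule Lim_transform_eventually)
       (simp add: eventually_at_filter res_scale m dens_increment s)
qed

text \<open>
  The resolvent is only known to be bounded on the smaller space. Still it is continuous at zero for
  the weaker norm along bounded families: a long partial sum is controlled in the weak norm and the
  remaining tail in the strong norm.
\<close>

lemma res_tendsto_zero_weak:
  fixes L0 :: "real \<Rightarrow> 'c::real_normed_vector \<Rightarrow> 'c"
  assumes i: "bounded_linear i" and iL: "\<And>t x. t \<in> J \<Longrightarrow> i (L t x) = L0 t (i x)"
    and L0: "\<And>t n y. t \<in> J \<Longrightarrow> norm ((L0 t ^^ n) y) \<le> M0 * norm y"
    and F: "\<forall>\<^sub>F t in F. t \<in> J"
    and Z: "\<forall>\<^sub>F t in F. mean (Z t) = 0 \<and> norm (Z t) \<le> B" "((\<lambda>t. i (Z t)) \<longlongrightarrow> 0) F"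
  shows "((\<lambda>t. i (res t (Z t))) \<longlongrightarrow> 0) F"
proof (rule tendstoI)
  fix e :: real assume e: "e > 0"
  interpret i: bounded_linear i by (rule i)
  obtain K where K: "K > 0" "\<And>x. norm (i x) \<le> norm x * K" using i.pos_bounded by blast
  have "(\<lambda>k. (\<theta> ^ k * (res_bound * \<bar>B\<bar>)) * K) \<longlonglongrightarrow> (0 * (res_bound * \<bar>B\<bar>)) * K"
    using \<theta> by (intro tendsto_intros) auto
  then have "\<forall>\<^sub>F k in sequentially. (\<theta> ^ k * (res_bound * \<bar>B\<bar>)) * K < e / 2 \<and> k \<ge> N"
    using e by (intro eventually_conj eventually_ge_at_top order_tendstoD(2)[of _ 0]) auto
  then obtain k where k: "(\<theta> ^ k * (res_bound * \<bar>B\<bar>)) * K < e / 2" "k \<ge> N"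
    by (auto simp: eventually_sequentially)
  have ipow: "i ((L t ^^ n) x) = (L0 t ^^ n) (i x)" if "t \<in> J" for t n x
    by (induction n) (auto simp: iL that)
  have "((\<lambda>t. of_nat k * (M0 * norm (i (Z t)))) \<longlongrightarrow> of_nat k * (M0 * norm (0::'c))) F"
    by (intro tendsto_intros Z)
  then have "\<forall>\<^sub>F t in F. of_nat k * (M0 * norm (i (Z t))) < e / 2"
    using e by (intro order_tendstoD(2)[of _ 0]) auto
  with F Z(1) show "\<forall>\<^sub>F t in F. dist (i (res t (Z t))) 0 < e"
  proof eventually_elim
    case (elim t)
    have "i (res t (Z t)) = (\<Sum>n<k. (L0 t ^^ n) (i (Z t))) + i ((L t ^^ k) (res t (Z t)))"
      using elim by (subst res_partial_sum[of _ _ k]) (simp_all add: i.add i.sum ipow)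
    also have "norm \<dots> \<le> (\<Sum>n<k. norm ((L0 t ^^ n) (i (Z t)))) + norm ((L t ^^ k) (res t (Z t))) * K"
      by (intro norm_triangle_le add_mono norm_sum K)
    also have "(\<Sum>n<k. norm ((L0 t ^^ n) (i (Z t)))) \<le> (\<Sum>n<k. M0 * norm (i (Z t)))"
      using elim by (intro sum_mono L0) auto
    also have "norm ((L t ^^ k) (res t (Z t))) \<le> \<theta> ^ k * (res_bound * \<bar>B\<bar>)"
    proof -
      have "norm ((L t ^^ k) (res t (Z t))) \<le> \<theta> ^ k * norm (res t (Z t))"
        using elim k by (intro contract mean_res) auto
      also have "norm (res t (Z t)) \<le> res_bound * norm (Z t)" using elim by (intro norm_res_le) auto
      also have "norm (Z t) \<le> \<bar>B\<bar>" using elim by auto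
      finally show ?thesis using \<theta> res_bound_nonneg by (simp add: mult_left_mono)
    qed
    finally have "norm (i (res t (Z t))) \<le> of_nat k * (M0 * norm (i (Z t))) + (\<theta> ^ k * (res_bound * \<bar>B\<bar>)) * K"
      using K by simp
    with elim k show ?case by simp
  qed
qed

end

section \<open>Families that are weakly differentiable with a loss of regularity\<close>

lemma tendsto_zero_on_dense:
  fixes D :: "'t \<Rightarrow> 'c::real_normed_vector \<Rightarrow> 'b::real_normed_vector"
  assumes S: "closure S = UNIV"
    and lip: "\<forall>\<^sub>F t in F. \<forall>x y. norm (D t x - D t y) \<le> B * norm (x - y)"
    and lim: "\<And>x. x \<in> S \<Longrightarrow> ((\<lambda>t. D t x) \<longlongrightarrow> 0) F"
  shows "((\<lambda>t. D t x) \<longlongrightarrow> 0) F"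
proof (rule tendstoI)
  fix e :: real assume e: "e > 0"
  have "e / (2 * (\<bar>B\<bar> + 1)) > 0" using e by simp
  then obtain y where y: "y \<in> S" "dist y x < e / (2 * (\<bar>B\<bar> + 1))"
    using S closure_approachable[of x S] by auto
  have "\<forall>\<^sub>F t in F. dist (D t y) 0 < e / 2"
    using tendstoD[OF lim[OF y(1)], of "e / 2"] e by simp
  with lip show "\<forall>\<^sub>F t in F. dist (D t x) 0 < e"
  proof eventually_elim
    case (elim t)
    have "norm (D t x - D t y) \<le> B * norm (x - y)" using elim by blast
    also have "\<dots> \<le> (\<bar>B\<bar> + 1) * norm (x - y)" by (intro mult_right_mono) auto
    also have "\<dots> < (\<bar>B\<bar> + 1) * (e / (2 * (\<bar>B\<bar> + 1)))"
      using y(2) by (intro mult_strict_left_mono) (auto simp: dist_norm norm_minus_commute)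
    also have "\<dots> = e / 2" by (simp add: field_simps)
    finally have "norm (D t x - D t y) < e / 2" .
    moreover have "norm (D t x) \<le> norm (D t x - D t y) + norm (D t y)"
      using norm_triangle_ineq[of "D t x - D t y" "D t y"] by simp
    ultimately show ?case using elim by simp
  qed
qed

text \<open>
  Operators \<open>L u\<close> on \<open>'b\<close> whose derivative in \<open>u\<close> is \<open>- A u\<close>, where \<open>A u\<close> is only defined on the smaller
  space \<open>'c\<close>, embedded by \<open>j\<close>. The derivative is known in the weakest sense: for vectors in the dense
  set \<open>S\<close> and tested on the dense set \<open>P\<close> of functionals. Everything else is deduced from the uniform
  bounds.
\<close>

locale weakly_differentiable =
  fixes J :: "real set" and L :: "real \<Rightarrow> 'b::banach \<Rightarrow> 'b"
    and A :: "real \<Rightarrow> 'c::banach \<Rightarrow> 'b" and j :: "'c \<Rightarrow> 'b"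
    and S :: "'c set" and P :: "('b \<Rightarrow>\<^sub>L real) set" and M :: real
  assumes J: "convex J"
    and j: "bounded_linear j"
    and L: "\<And>u. u \<in> J \<Longrightarrow> bounded_linear (L u)" "\<And>u y. u \<in> J \<Longrightarrow> norm (L u y) \<le> M * norm y"
    and A: "\<And>u. u \<in> J \<Longrightarrow> bounded_linear (A u)" "\<And>u x. u \<in> J \<Longrightarrow> norm (A u x) \<le> M * norm x"
    and dense: "closure S = UNIV" "closure (j ` S) = UNIV" "closure P = UNIV"
    and weak: "\<And>f l u. f \<in> S \<Longrightarrow> l \<in> P \<Longrightarrow> u \<in> J \<Longrightarrow>
      ((\<lambda>u. blinfun_apply l (L u (j f))) has_real_derivative - blinfun_apply l (A u f)) (at u within J)"
begin

lemma closed_segment_J: "s \<in> J \<Longrightarrow> t \<in> J \<Longrightarrow> closed_segment s t \<subseteq> J"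
  by (intro closed_segment_subset J)

text \<open>
  All estimates come from one application of the mean value inequality to the curve of Taylor
  remainders. With \<open>a = q = 0\<close> it gives the Lipschitz bound, with \<open>a = A s f\<close> and \<open>q = 0\<close> the strong
  derivative, and with \<open>q\<close> the derivative of \<open>- A u f\<close> the expansion to second order.
\<close>

lemma taylor_remainder:
  assumes f: "f \<in> S" and st: "s \<in> J" "t \<in> J"
    and B: "\<And>u. u \<in> closed_segment s t \<Longrightarrow> norm (A u f - a + (u - s) *\<^sub>R q) \<le> B"
  shows "norm (L t (j f) - L s (j f) + (t - s) *\<^sub>R a - ((t - s)\<^sup>2 / 2) *\<^sub>R q) \<le> B * \<bar>t - s\<bar>"
proof -
  define w where "w u = L u (j f) + (u - s) *\<^sub>R a - ((u - s)\<^sup>2 / 2) *\<^sub>R q" for u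
  have "norm (w t - w s) \<le> B * \<bar>t - s\<bar>"
  proof (rule weak_mean_value[OF dense(3)])
    fix l u assume l: "l \<in> P" and u: "u \<in> closed_segment s t"
    have uJ: "u \<in> J" using closed_segment_J[OF st] u by auto
    have "((\<lambda>u. blinfun_apply l (L u (j f))) has_real_derivative - blinfun_apply l (A u f))
        (at u within closed_segment s t)"
      by (rule DERIV_subset[OF weak[OF f l uJ] closed_segment_J[OF st]])
    then show "((\<lambda>u. blinfun_apply l (w u)) has_real_derivative
        blinfun_apply l (- (A u f - a + (u - s) *\<^sub>R q))) (at u within closed_segment s t)"
      unfolding w_def blinfun.add_right blinfun.diff_right blinfun.scaleR_right blinfun.minus_right
      by (auto intro!: derivative_eq_intros simp: algebra_simps diff_divide_distrib)
  next
    fix u assume "u \<in> closed_segment s t"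
    then show "norm (- (A u f - a + (u - s) *\<^sub>R q)) \<le> B" using B by (simp only: norm_minus_cancel)
  qed
  then show ?thesis by (simp add: w_def algebra_simps)
qed

lemma lipschitz:
  assumes st: "s \<in> J" "t \<in> J"
  shows "norm (L t (j x) - L s (j x)) \<le> M * \<bar>t - s\<bar> * norm x"
proof -
  interpret j: bounded_linear j by (rule j)
  have cj: "continuous_on UNIV (\<lambda>x. L u (j x))" if "u \<in> J" for u
    by (intro linear_continuous_on bounded_linear_compose[OF L(1)[OF that] j])
  have "closed {x. norm (L t (j x) - L s (j x)) \<le> M * \<bar>t - s\<bar> * norm x}"
    by (intro closed_Collect_le continuous_intros cj st)
  moreover have "norm (L t (j x) - L s (j x)) \<le> M * \<bar>t - s\<bar> * norm x" if x: "x \<in> S" for x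
  proof -
    have "norm (L t (j x) - L s (j x) + (t - s) *\<^sub>R 0 - ((t - s)\<^sup>2 / 2) *\<^sub>R 0)
        \<le> (M * norm x) * \<bar>t - s\<bar>"
      by (rule taylor_remainder[OF x st]) (use A(2)[of _ x] closed_segment_J[OF st] in auto)
    then show ?thesis by (simp add: ac_simps)
  qed
  ultimately have "closure S \<subseteq> {x. norm (L t (j x) - L s (j x)) \<le> M * \<bar>t - s\<bar> * norm x}"
    by (intro closure_minimal) auto
  then show ?thesis using dense(1) by auto
qed

text \<open>Lipschitz continuity on the dense image of \<open>j\<close>, extended by uniform boundedness.\<close>

lemma strong_continuity:
  assumes s: "s \<in> J"
  shows "((\<lambda>t. L t y) \<longlongrightarrow> L s y) (at s within J)"
proof -
  have "((\<lambda>t. L t y - L s y) \<longlongrightarrow> 0) (at s within J)"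
  proof (rule tendsto_zero_on_dense[OF dense(2), where D="\<lambda>t y. L t y - L s y" and B="2 * M"])
    show "\<forall>\<^sub>F t in at s within J. \<forall>x y. norm ((L t x - L s x) - (L t y - L s y)) \<le> 2 * M * norm (x - y)"
      unfolding eventually_at_filter
    proof (intro always_eventually allI impI)
      fix t x y assume t: "t \<in> J"
      have "(L t x - L s x) - (L t y - L s y) = L t (x - y) - L s (x - y)"
        by (simp add: bounded_linear.linear[OF L(1)] linear_diff s t)
      then show "norm ((L t x - L s x) - (L t y - L s y)) \<le> 2 * M * norm (x - y)"
        using norm_triangle_ineq4[of "L t (x - y)" "L s (x - y)"] L(2)[OF t, of "x - y"] L(2)[OF s, of "x - y"]
        by simp
    qed
    fix y assume "y \<in> j ` S"
    then obtain x where y: "y = j x" by blast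
    have "((\<lambda>t. M * \<bar>t - s\<bar> * norm x) \<longlongrightarrow> M * \<bar>s - s\<bar> * norm x) (at s within J)"
      by (intro tendsto_intros)
    then have "((\<lambda>t. M * \<bar>t - s\<bar> * norm x) \<longlongrightarrow> 0) (at s within J)" by simp
    then show "((\<lambda>t. L t y - L s y) \<longlongrightarrow> 0) (at s within J)"
      by (rule Lim_null_comparison[rotated])
         (auto simp: eventually_at_filter y intro!: always_eventually lipschitz s)
  qed
  then show ?thesis by (simp add: LIM_zero_iff)
qed

lemma eventually_closed_segment:
  assumes s: "s \<in> J" and ev: "\<forall>\<^sub>F u in at s within J. R u" and Rs: "R s"
  shows "\<forall>\<^sub>F t in at s within J. \<forall>u\<in>closed_segment s t. R u"
proof -
  obtain d where d: "d > 0" "\<And>u. u \<in> J \<Longrightarrow> u \<noteq> s \<Longrightarrow> dist u s < d \<Longrightarrow> R u"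
    using ev unfolding eventually_at by blast
  show ?thesis
    unfolding eventually_at
  proof (intro exI[of _ d] conjI ballI impI)
    fix t u assume t: "t \<in> J" "t \<noteq> s \<and> dist t s < d" and u: "u \<in> closed_segment s t"
    have "dist u s \<le> dist t s" using segment_bound1[OF u] by (simp add: dist_norm)
    then show "R u" using d(2)[of u] t Rs closed_segment_J[OF s t(1)] u by (cases "u = s") auto
  qed (rule d)
qed

lemma strong_derivative:
  assumes s: "s \<in> J" and cont: "\<And>x. x \<in> S \<Longrightarrow> ((\<lambda>u. A u x) \<longlongrightarrow> A s x) (at s within J)"
  shows "((\<lambda>t. (1 / (t - s)) *\<^sub>R (L t (j x) - L s (j x))) \<longlongrightarrow> - A s x) (at s within J)"
proof -
  interpret j: bounded_linear j by (rule j)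
  define D where "D t x = (1 / (t - s)) *\<^sub>R (L t (j x) - L s (j x)) + A s x" for t x
  have "((\<lambda>t. D t x) \<longlongrightarrow> 0) (at s within J)"
  proof (rule tendsto_zero_on_dense[OF dense(1), where B="2 * M"])
    show "\<forall>\<^sub>F t in at s within J. \<forall>x y. norm (D t x - D t y) \<le> 2 * M * norm (x - y)"
      unfolding eventually_at_filter
    proof (intro always_eventually allI impI)
      fix t x y assume ts: "t \<noteq> s" and t: "t \<in> J"
      have "D t x - D t y = (1 / (t - s)) *\<^sub>R (L t (j (x - y)) - L s (j (x - y))) + A s (x - y)"
        by (simp add: D_def bounded_linear.linear[OF L(1)] bounded_linear.linear[OF A(1)] linear_diff
            j.diff s t algebra_simps)
      also have "norm \<dots> \<le> (1 / \<bar>t - s\<bar>) * (M * \<bar>t - s\<bar> * norm (x - y)) + M * norm (x - y)"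
        using mult_left_mono[OF lipschitz[OF s t, of "x - y"], of "1 / \<bar>t - s\<bar>"] A(2)[OF s, of "x - y"]
        by (intro norm_triangle_le add_mono) (simp_all add: divide_inverse)
      finally show "norm (D t x - D t y) \<le> 2 * M * norm (x - y)" using ts by simp
    qed
    fix x assume x: "x \<in> S"
    show "((\<lambda>t. D t x) \<longlongrightarrow> 0) (at s within J)"
    proof (rule tendstoI)
      fix e :: real assume e: "e > 0"
      have "\<forall>\<^sub>F u in at s within J. norm (A u x - A s x) \<le> e / 2"
        using tendstoD[OF cont[OF x], of "e / 2"] e by (auto simp: dist_norm elim: eventually_mono)
      from eventually_closed_segment[OF s this] e
      have "\<forall>\<^sub>F t in at s within J. \<forall>u\<in>closed_segment s t. norm (A u x - A s x) \<le> e / 2" by simp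
      moreover have "\<forall>\<^sub>F t in at s within J. t \<in> J \<and> t \<noteq> s" by (simp add: eventually_at_filter)
      ultimately show "\<forall>\<^sub>F t in at s within J. dist (D t x) 0 < e"
      proof eventually_elim
        case (elim t)
        have "norm (L t (j x) - L s (j x) + (t - s) *\<^sub>R A s x - ((t - s)\<^sup>2 / 2) *\<^sub>R 0) \<le> (e / 2) * \<bar>t - s\<bar>"
          by (rule taylor_remainder[OF x s]) (use elim in auto)
        moreover have "D t x = (1 / (t - s)) *\<^sub>R (L t (j x) - L s (j x) + (t - s) *\<^sub>R A s x)"
          using elim by (simp add: D_def scaleR_add_right)
        ultimately have "norm (D t x) \<le> e / 2"
          using elim by (simp add: pos_divide_le_eq)
        then show ?case using elim e by simp
      qed
    qed
  qed
  from tendsto_add[OF this tendsto_const[of "- A s x"]] show ?thesis by (simp add: D_def)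
qed

end

text \<open>
  Along a scale \<open>'b3 \<rightarrow> 'b2 \<rightarrow> 'b1 \<rightarrow> 'b0\<close> the second order expansion of \<open>L u x\<close>, \<open>x \<in> 'b3\<close>, loses two
  derivatives for the coefficient \<open>Q\<close> and a third one for convergence. The remainder divided by the
  square of the increment is therefore bounded in \<open>'b1\<close> but tends to zero only in \<open>'b0\<close>; both facts
  are needed later.
\<close>

locale twice_weakly_differentiable =
  W1: weakly_differentiable J L1 A1 i1 S2 P1 M1 + W0: weakly_differentiable J L0 A0 i0 S1 P0 M0
  for J :: "real set"
    and L1 :: "real \<Rightarrow> 'b1::banach \<Rightarrow> 'b1" and A1 :: "real \<Rightarrow> 'b2::banach \<Rightarrow> 'b1" and i1 S2 P1 M1
    and L0 :: "real \<Rightarrow> 'b0::banach \<Rightarrow> 'b0" and A0 :: "real \<Rightarrow> 'b1 \<Rightarrow> 'b0" and i0 S1 P0 M0 +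
  fixes i2 :: "'b3::banach \<Rightarrow> 'b2" and S3 :: "'b3 set" and s :: real and Q :: "'b3 \<Rightarrow> 'b1" and B :: real
  assumes i2: "bounded_linear i2" and Q: "bounded_linear Q" "\<And>x. norm (Q x) \<le> B * norm x"
    and S3: "closure S3 = UNIV" "i2 ` S3 \<subseteq> S2" "i1 ` i2 ` S3 \<subseteq> S1"
    and s: "s \<in> J"
    and i0_L: "\<And>u x. u \<in> J \<Longrightarrow> i0 (L1 u x) = L0 u (i0 x)"
    and i0_A: "\<And>u x. u \<in> J \<Longrightarrow> i0 (A1 u x) = A0 u (i1 x)"
    and A1_lip: "\<And>u x. u \<in> J \<Longrightarrow> norm (A1 u (i2 x) - A1 s (i2 x)) \<le> B * \<bar>u - s\<bar> * norm x"
    and A0_der: "\<And>x. x \<in> S3 \<Longrightarrow>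
      ((\<lambda>u. (1 / (u - s)) *\<^sub>R (A0 u (i1 (i2 x)) - A0 s (i1 (i2 x)))) \<longlongrightarrow> - i0 (Q x)) (at s within J)"
begin

definition remainder :: "real \<Rightarrow> 'b3 \<Rightarrow> 'b1" where
  "remainder t x = L1 t (i1 (i2 x)) - L1 s (i1 (i2 x)) + (t - s) *\<^sub>R A1 s (i2 x) - ((t - s)\<^sup>2 / 2) *\<^sub>R Q x"



lemma bounded_linear_remainder:
  assumes t: "t \<in> J" shows "bounded_linear (remainder t)"
proof -
  have i12: "bounded_linear (\<lambda>x. i1 (i2 x))" by (rule bounded_linear_compose[OF W1.j i2])
  show ?thesis
    unfolding remainder_def[abs_def]
    by (intro bounded_linear_add bounded_linear_sub bounded_linear_const_scaleR Q
        bounded_linear_compose[OF W1.L(1) i12] bounded_linear_compose[OF W1.A(1) i2] s t)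
qed

lemma norm_remainder_le:
  assumes t: "t \<in> J"
  shows "norm (remainder t x) \<le> 2 * B * (t - s)\<^sup>2 * norm x"
proof -
  have "closed {x. norm (remainder t x) \<le> 2 * B * (t - s)\<^sup>2 * norm x}"
    by (intro closed_Collect_le continuous_intros linear_continuous_on bounded_linear_remainder t)
  moreover have "norm (remainder t x) \<le> 2 * B * (t - s)\<^sup>2 * norm x" if x: "x \<in> S3" for x
  proof -
    have B: "0 \<le> B * norm x" using order_trans[OF norm_ge_zero Q(2)] .
    have "norm (L1 t (i1 (i2 x)) - L1 s (i1 (i2 x)) + (t - s) *\<^sub>R A1 s (i2 x) - ((t - s)\<^sup>2 / 2) *\<^sub>R 0)
        \<le> (B * \<bar>t - s\<bar> * norm x) * \<bar>t - s\<bar>"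
    proof (rule W1.taylor_remainder[OF _ s t])
      show "i2 x \<in> S2" using x S3 by auto
      fix u assume u: "u \<in> closed_segment s t"
      have "norm (A1 u (i2 x) - A1 s (i2 x)) \<le> B * \<bar>u - s\<bar> * norm x"
        using u W1.closed_segment_J[OF s t] by (intro A1_lip) auto
      also have "\<dots> = (B * norm x) * \<bar>u - s\<bar>" by simp
      also have "\<dots> \<le> (B * norm x) * \<bar>t - s\<bar>"
        using segment_bound1[OF u] B by (intro mult_left_mono) auto
      finally show "norm (A1 u (i2 x) - A1 s (i2 x) + (u - s) *\<^sub>R 0) \<le> B * \<bar>t - s\<bar> * norm x"
        by (simp add: ac_simps)
    qed
    moreover have "norm (((t - s)\<^sup>2 / 2) *\<^sub>R Q x) \<le> ((t - s)\<^sup>2 / 2) * (B * norm x)"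
      using Q(2)[of x] by (simp add: mult_left_mono)
    moreover have "norm (remainder t x) \<le>
        norm (L1 t (i1 (i2 x)) - L1 s (i1 (i2 x)) + (t - s) *\<^sub>R A1 s (i2 x)) + norm (((t - s)\<^sup>2 / 2) *\<^sub>R Q x)"
      unfolding remainder_def by (rule norm_triangle_ineq4)
    moreover have "(B * \<bar>t - s\<bar> * norm x) * \<bar>t - s\<bar> = (B * norm x) * (t - s)\<^sup>2"
      by (simp add: power2_eq_square ac_simps flip: abs_mult)
    ultimately have "norm (remainder t x) \<le> (B * norm x) * (t - s)\<^sup>2 + ((t - s)\<^sup>2 / 2) * (B * norm x)"
      by (simp only: scaleR_zero_right diff_zero)
    also have "\<dots> \<le> 2 * (B * norm x) * (t - s)\<^sup>2"
      using mult_nonneg_nonneg[OF B zero_le_power2[of "t - s"]] by (simp add: algebra_simps)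
    finally show ?thesis by (simp add: ac_simps)
  qed
  ultimately have "closure S3 \<subseteq> {x. norm (remainder t x) \<le> 2 * B * (t - s)\<^sup>2 * norm x}"
    by (intro closure_minimal) auto
  then show ?thesis using S3 by auto
qed

lemma remainder_tendsto:
  "((\<lambda>t. (1 / (t - s)\<^sup>2) *\<^sub>R i0 (remainder t x)) \<longlongrightarrow> 0) (at s within J)"
proof -
  interpret i0: bounded_linear i0 by (rule W0.j)
  obtain K where K: "K > 0" "\<And>x. norm (i0 x) \<le> norm x * K" using i0.pos_bounded by blast
  define D where "D t x = (1 / (t - s)\<^sup>2) *\<^sub>R i0 (remainder t x)" for t x
  have "((\<lambda>t. D t x) \<longlongrightarrow> 0) (at s within J)"
  proof (rule tendsto_zero_on_dense[OF S3(1), where B="2 * B * K"])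
    show "\<forall>\<^sub>F t in at s within J. \<forall>x y. norm (D t x - D t y) \<le> 2 * B * K * norm (x - y)"
      unfolding eventually_at_filter
    proof (intro always_eventually allI impI)
      fix t x y assume ts: "t \<noteq> s" and t: "t \<in> J"
      interpret r: bounded_linear "remainder t" by (rule bounded_linear_remainder[OF t])
      have "D t x - D t y = (1 / (t - s)\<^sup>2) *\<^sub>R i0 (remainder t (x - y))"
        by (simp add: D_def r.diff i0.diff algebra_simps)
      also have "norm \<dots> \<le> (1 / (t - s)\<^sup>2) * ((2 * B * (t - s)\<^sup>2 * norm (x - y)) * K)"
      proof -
        have "norm (i0 (remainder t (x - y))) \<le> (2 * B * (t - s)\<^sup>2 * norm (x - y)) * K"
          using order_trans[OF K(2) mult_right_mono[OF norm_remainder_le[OF t]]] K(1) by simp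
        from mult_left_mono[OF this, of "1 / (t - s)\<^sup>2"] show ?thesis by simp
      qed
      finally show "norm (D t x - D t y) \<le> 2 * B * K * norm (x - y)" using ts by (simp add: ac_simps)
    qed
    fix x assume x: "x \<in> S3"
    let ?y = "i1 (i2 x)"
    show "((\<lambda>t. D t x) \<longlongrightarrow> 0) (at s within J)"
    proof (rule tendstoI)
      fix e :: real assume e: "e > 0"
      have "((\<lambda>u. (1 / (u - s)) *\<^sub>R (A0 u ?y - A0 s ?y) + i0 (Q x)) \<longlongrightarrow> - i0 (Q x) + i0 (Q x)) (at s within J)"
        by (intro tendsto_intros A0_der x)
      then have "\<forall>\<^sub>F u in at s within J. norm ((1 / (u - s)) *\<^sub>R (A0 u ?y - A0 s ?y) + i0 (Q x)) < e / 2"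
        using e by (simp only: tendsto_iff dist_norm diff_0_right left_minus)
      then have "\<forall>\<^sub>F u in at s within J. norm (A0 u ?y - A0 s ?y + (u - s) *\<^sub>R i0 (Q x)) \<le> (e / 2) * \<bar>u - s\<bar>"
        unfolding eventually_at_filter
      proof (rule eventually_mono, intro impI)
        fix u assume *: "u \<noteq> s \<longrightarrow> u \<in> J \<longrightarrow>
            norm ((1 / (u - s)) *\<^sub>R (A0 u ?y - A0 s ?y) + i0 (Q x)) < e / 2" "u \<noteq> s" "u \<in> J"
        have "A0 u ?y - A0 s ?y + (u - s) *\<^sub>R i0 (Q x) =
            (u - s) *\<^sub>R ((1 / (u - s)) *\<^sub>R (A0 u ?y - A0 s ?y) + i0 (Q x))"
          using * by (simp add: scaleR_add_right)
        also have "norm \<dots> \<le> \<bar>u - s\<bar> * (e / 2)"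
          unfolding norm_scaleR real_norm_def using * by (intro mult_left_mono) auto
        finally show "norm (A0 u ?y - A0 s ?y + (u - s) *\<^sub>R i0 (Q x)) \<le> (e / 2) * \<bar>u - s\<bar>"
          by (simp add: ac_simps)
      qed
      from W0.eventually_closed_segment[OF s this]
      have "\<forall>\<^sub>F t in at s within J. \<forall>u\<in>closed_segment s t.
          norm (A0 u ?y - A0 s ?y + (u - s) *\<^sub>R i0 (Q x)) \<le> (e / 2) * \<bar>u - s\<bar>" by simp
      moreover have "\<forall>\<^sub>F t in at s within J. t \<in> J \<and> t \<noteq> s" by (simp add: eventually_at_filter)
      ultimately show "\<forall>\<^sub>F t in at s within J. dist (D t x) 0 < e"
      proof eventually_elim
        case (elim t)
        have i0r: "i0 (remainder t x) =
            L0 t (i0 ?y) - L0 s (i0 ?y) + (t - s) *\<^sub>R A0 s ?y - ((t - s)\<^sup>2 / 2) *\<^sub>R i0 (Q x)"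
          using elim s by (simp add: remainder_def i0.add i0.diff i0.scaleR i0_L i0_A)
        have "norm (i0 (remainder t x)) \<le> ((e / 2) * \<bar>t - s\<bar>) * \<bar>t - s\<bar>"
          unfolding i0r
        proof (rule W0.taylor_remainder)
          show "?y \<in> S1" using x S3 by auto
          fix u assume u: "u \<in> closed_segment s t"
          then have "norm (A0 u ?y - A0 s ?y + (u - s) *\<^sub>R i0 (Q x)) \<le> (e / 2) * \<bar>u - s\<bar>"
            using elim by blast
          also have "\<dots> \<le> (e / 2) * \<bar>t - s\<bar>"
            using segment_bound1[OF u] e by (intro mult_left_mono) auto
          finally show "norm (A0 u ?y - A0 s ?y + (u - s) *\<^sub>R i0 (Q x)) \<le> (e / 2) * \<bar>t - s\<bar>" .
        qed (use elim s in auto)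
        also have "\<dots> = (e / 2) * (t - s)\<^sup>2" by (simp add: power2_eq_square flip: abs_mult)
        finally have "norm (D t x) \<le> e / 2"
          using elim by (simp add: D_def pos_divide_le_eq)
        then show ?case using elim e by simp
      qed
    qed
  qed
  then show ?thesis by (simp add: D_def)
qed

end

section \<open>The scalar bifurcation problem\<close>

text \<open>If \<open>P\<close> is membership in a set, this says that boundary points of the set do not accumulate at \<open>s\<close>.\<close>

definition one_sided_germs :: "real set \<Rightarrow> real \<Rightarrow> (real \<Rightarrow> bool) \<Rightarrow> bool" where
  "one_sided_germs J s P \<longleftrightarrow>
     ((\<forall>\<^sub>F t in at s within (J \<inter> {s<..}). P t) \<or> (\<forall>\<^sub>F t in at s within (J \<inter> {s<..}). \<not> P t)) \<and>
     ((\<forall>\<^sub>F t in at s within (J \<inter> {..<s}). P t) \<or> (\<forall>\<^sub>F t in at s within (J \<inter> {..<s}). \<not> P t))"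

lemma eventually_right_left:
  assumes "\<forall>\<^sub>F t in at s within J. P t"
  shows "\<forall>\<^sub>F t in at s within (J \<inter> {s<..}). P t" "\<forall>\<^sub>F t in at s within (J \<inter> {..<s}). P t"
  using assms by (auto intro: filter_leD[OF at_le])

lemma one_sided_germs_const:
  "\<forall>\<^sub>F t in at s within J. P t \<Longrightarrow> one_sided_germs J s P"
  "\<forall>\<^sub>F t in at s within J. \<not> P t \<Longrightarrow> one_sided_germs J s P"
  by (auto simp: one_sided_germs_def dest: eventually_right_left)

lemma one_sided_germs_conj:
  assumes "one_sided_germs J s P" "one_sided_germs J s Q"
  shows "one_sided_germs J s (\<lambda>t. P t \<and> Q t)"
proof -
  have *: "(\<forall>\<^sub>F t in F. P t \<and> Q t) \<or> (\<forall>\<^sub>F t in F. \<not> (P t \<and> Q t))"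
    if "(\<forall>\<^sub>F t in F. P t) \<or> (\<forall>\<^sub>F t in F. \<not> P t)" "(\<forall>\<^sub>F t in F. Q t) \<or> (\<forall>\<^sub>F t in F. \<not> Q t)"
    for F :: "real filter"
  proof (cases "(\<forall>\<^sub>F t in F. P t) \<and> (\<forall>\<^sub>F t in F. Q t)")
    case True
    then show ?thesis by (intro disjI1 eventually_conj) auto
  next
    case False
    then have "(\<forall>\<^sub>F t in F. \<not> P t) \<or> (\<forall>\<^sub>F t in F. \<not> Q t)" using that by blast
    then show ?thesis by (intro disjI2) (elim disjE, (erule eventually_mono, blast)+)
  qed
  show ?thesis
    using assms unfolding one_sided_germs_def by (intro conjI *) auto
qed

lemma one_sided_germs_cong:
  assumes "\<forall>\<^sub>F t in at s within J. P t = Q t" "one_sided_germs J s P"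
  shows "one_sided_germs J s Q"
proof -
  have *: "(\<forall>\<^sub>F t in F. Q t) \<or> (\<forall>\<^sub>F t in F. \<not> Q t)"
    if "\<forall>\<^sub>F t in F. P t = Q t" "(\<forall>\<^sub>F t in F. P t) \<or> (\<forall>\<^sub>F t in F. \<not> P t)" for F :: "real filter"
    using that(2)
  proof
    assume "\<forall>\<^sub>F t in F. P t"
    with that(1) have "\<forall>\<^sub>F t in F. Q t" by eventually_elim auto
    then show ?thesis ..
  next
    assume "\<forall>\<^sub>F t in F. \<not> P t"
    with that(1) have "\<forall>\<^sub>F t in F. \<not> Q t" by eventually_elim auto
    then show ?thesis ..
  qed
  show ?thesis
    using assms(2) eventually_right_left[OF assms(1)] * unfolding one_sided_germs_def by blast
qed

text \<open>The quotient by the leading power keeps the sign of \<open>c\<close>.\<close>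

lemma eventually_sign:
  assumes lim: "((\<lambda>t. h t / (t - s) ^ k) \<longlongrightarrow> c) (at s within J)" and c: "c \<noteq> (0::real)"
  shows "\<forall>\<^sub>F t in at s within J. sgn c * h t * sgn ((t - s) ^ k) > 0"
proof -
  have "((\<lambda>t. sgn c * (h t / (t - s) ^ k)) \<longlongrightarrow> sgn c * c) (at s within J)"
    by (intro tendsto_intros lim)
  moreover have "sgn c * c > 0" using c by (auto simp: sgn_if)
  ultimately have "\<forall>\<^sub>F t in at s within J. sgn c * (h t / (t - s) ^ k) > 0"
    by (rule order_tendstoD(1))
  moreover have "\<forall>\<^sub>F t in at s within J. t \<noteq> s" by (simp add: eventually_at_filter)
  ultimately show ?thesis
  proof eventually_elim
    case (elim t)
    let ?p = "(t - s) ^ k"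
    have p: "?p \<noteq> 0" using elim by simp
    have "y * sgn q = y / q * \<bar>q\<bar>" if "q \<noteq> 0" for y q :: real
      using that by (cases "q > 0") auto
    from this[OF p, of "sgn c * h t"]
    have "sgn c * h t * sgn ?p = (sgn c * (h t / ?p)) * \<bar>?p\<bar>" by simp
    then show ?case using elim p by (simp only: zero_less_mult_iff zero_less_abs_iff) simp
  qed
qed

lemma one_sided_germs_sign:
  assumes lim: "((\<lambda>t. h t / (t - s) ^ k) \<longlongrightarrow> c) (at s within J)" and c: "c \<noteq> (0::real)"
  shows "one_sided_germs J s (\<lambda>t. h t \<ge> 0)"
proof -
  note ev = eventually_right_left[OF eventually_sign[OF lim c]]
  have *: "(\<forall>\<^sub>F t in F. h t \<ge> 0) \<or> (\<forall>\<^sub>F t in F. \<not> h t \<ge> 0)"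
    if "\<forall>\<^sub>F t in F. sgn c * h t * sgn ((t - s) ^ k) > 0" "\<forall>\<^sub>F t in F. sgn ((t - s) ^ k) = d"
    for F d
  proof -
    have 1: "\<forall>\<^sub>F t in F. sgn c * d * h t > 0"
      using that by eventually_elim (auto simp: ac_simps)
    show ?thesis
    proof (cases "sgn c * d > 0")
      case True
      with 1 have "\<forall>\<^sub>F t in F. h t \<ge> 0"
        by (auto simp: zero_less_mult_iff elim: eventually_mono)
      then show ?thesis ..
    next
      case False
      with 1 have "\<forall>\<^sub>F t in F. \<not> h t \<ge> 0"
        by (auto simp: zero_less_mult_iff elim: eventually_mono)
      then show ?thesis ..
    qed
  qed
  have r: "\<forall>\<^sub>F t in at s within (J \<inter> {s<..}). sgn ((t - s) ^ k) = 1"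
    by (auto simp: eventually_at_filter intro!: always_eventually)
  have l: "\<forall>\<^sub>F t in at s within (J \<inter> {..<s}). sgn ((t - s) ^ k) = (-1) ^ k"
  proof -
    have "sgn ((t - s) ^ k) = (-1) ^ k" if "t < s" for t
    proof -
      have "sgn ((t - s) ^ k) = sgn (t - s) ^ k" by (simp add: power_sgn)
      then show ?thesis using that by simp
    qed
    then show ?thesis by (auto simp: eventually_at_filter intro!: always_eventually)
  qed
  show ?thesis
    unfolding one_sided_germs_def using *[OF ev(1) r] *[OF ev(2) l] by blast
qed

lemma one_sided_germs_sign_continuous:
  assumes "(h \<longlongrightarrow> h s) (at s within J)" "h s \<noteq> (0::real)"
  shows "one_sided_germs J s (\<lambda>t. h t \<ge> 0)"
  using one_sided_germs_sign[of h s 0 "h s" J] assms by simp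

text \<open>
  Around each point there is a neighbourhood in which \<open>E\<close> consists of entire sides and possibly the
  point itself. Finitely many such neighbourhoods cover the compact interval. The intervals that
  result may overlap and need not be closed.
\<close>

lemma finite_union_of_intervals:
  fixes a b :: real
  assumes E: "E \<subseteq> {a..b}" and germs: "\<And>s. s \<in> {a..b} \<Longrightarrow> one_sided_germs {a..b} s (\<lambda>t. t \<in> E)"
  obtains \<I> where "finite \<I>" "\<Union>\<I> = E" "\<And>I. I \<in> \<I> \<Longrightarrow> is_interval I \<and> I \<noteq> {}"
proof -
  let ?J = "{a..b}"
  define G where "G s d \<longleftrightarrow>
      ((\<forall>t\<in>?J. s < t \<and> t < s + d \<longrightarrow> t \<in> E) \<or> (\<forall>t\<in>?J. s < t \<and> t < s + d \<longrightarrow> t \<notin> E)) \<and>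
      ((\<forall>t\<in>?J. s - d < t \<and> t < s \<longrightarrow> t \<in> E) \<or> (\<forall>t\<in>?J. s - d < t \<and> t < s \<longrightarrow> t \<notin> E))" for s d
  have "\<exists>d>0. G s d" if s: "s \<in> ?J" for s
  proof -
    have R: "\<exists>d>0. \<forall>t\<in>?J. s < t \<and> t < s + d \<longrightarrow> P t"
      if ev: "\<forall>\<^sub>F t in at s within (?J \<inter> {s<..}). P t" for P
    proof -
      obtain d where d: "d > 0" "\<And>t. t \<in> ?J \<inter> {s<..} \<Longrightarrow> t \<noteq> s \<and> dist t s < d \<Longrightarrow> P t"
        using ev unfolding eventually_at by blast
      have "P t" if "t \<in> ?J" "s < t \<and> t < s + d" for t
        using that by (intro d(2)) (simp_all add: dist_real_def)
      with d(1) show ?thesis by blast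
    qed
    have L: "\<exists>d>0. \<forall>t\<in>?J. s - d < t \<and> t < s \<longrightarrow> P t"
      if ev: "\<forall>\<^sub>F t in at s within (?J \<inter> {..<s}). P t" for P
    proof -
      obtain d where d: "d > 0" "\<And>t. t \<in> ?J \<inter> {..<s} \<Longrightarrow> t \<noteq> s \<and> dist t s < d \<Longrightarrow> P t"
        using ev unfolding eventually_at by blast
      have "P t" if "t \<in> ?J" "s - d < t \<and> t < s" for t
        using that by (intro d(2)) (simp_all add: dist_real_def)
      with d(1) show ?thesis by blast
    qed
    obtain d1 where d1: "d1 > 0" "(\<forall>t\<in>?J. s < t \<and> t < s + d1 \<longrightarrow> t \<in> E) \<or> (\<forall>t\<in>?J. s < t \<and> t < s + d1 \<longrightarrow> t \<notin> E)"
      using germs[OF s] R unfolding one_sided_germs_def by meson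
    obtain d2 where d2: "d2 > 0" "(\<forall>t\<in>?J. s - d2 < t \<and> t < s \<longrightarrow> t \<in> E) \<or> (\<forall>t\<in>?J. s - d2 < t \<and> t < s \<longrightarrow> t \<notin> E)"
      using germs[OF s] L unfolding one_sided_germs_def by meson
    show ?thesis
      unfolding G_def using d1 d2 by (intro exI[of _ "min d1 d2"] conjI) auto
  qed
  then obtain d where dG: "\<And>s. s \<in> ?J \<Longrightarrow> d s > 0" "\<And>s. s \<in> ?J \<Longrightarrow> G s (d s)" by metis
  have d: "\<And>s. s \<in> ?J \<Longrightarrow> d s > 0"
    "\<And>s. s \<in> ?J \<Longrightarrow> (\<forall>t\<in>?J. s < t \<and> t < s + d s \<longrightarrow> t \<in> E) \<or> (\<forall>t\<in>?J. s < t \<and> t < s + d s \<longrightarrow> t \<notin> E)"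
    "\<And>s. s \<in> ?J \<Longrightarrow> (\<forall>t\<in>?J. s - d s < t \<and> t < s \<longrightarrow> t \<in> E) \<or> (\<forall>t\<in>?J. s - d s < t \<and> t < s \<longrightarrow> t \<notin> E)"
    using dG unfolding G_def by blast+
  have "?J \<subseteq> (\<Union>s\<in>?J. ball s (d s))" using d(1) by force
  then obtain D where D: "D \<subseteq> ?J" "finite D" "?J \<subseteq> (\<Union>s\<in>D. ball s (d s))"
    using compactE_image[OF compact_Icc, of ?J "\<lambda>s. ball s (d s)" a b] by (metis open_ball)
  define R where "R s = ?J \<inter> {s<..<s + d s}" for s
  define L where "L s = ?J \<inter> {s - d s<..<s}" for s
  define \<I> where "\<I> = {I \<in> (\<lambda>s. {s}) ` D \<union> R ` D \<union> L ` D. I \<noteq> {} \<and> I \<subseteq> E}"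
  show thesis
  proof (rule that[of \<I>])
    show "finite \<I>" using D by (auto simp: \<I>_def)
    show "is_interval I \<and> I \<noteq> {}" if "I \<in> \<I>" for I
      using that by (auto simp: \<I>_def R_def L_def is_interval_1)
    have "x \<in> \<Union>\<I>" if x: "x \<in> E" for x
    proof -
      obtain s where s: "s \<in> D" "x \<in> ball s (d s)" using D x E by blast
      have sJ: "s \<in> ?J" using s D by auto
      have xJ: "x \<in> ?J" using x E by auto
      consider "x = s" | "x \<in> R s" | "x \<in> L s"
        using s xJ by (auto simp: R_def L_def dist_real_def) linarith
      then show ?thesis
      proof cases
        case 1
        then show ?thesis using x s by (auto simp: \<I>_def)
      next
        case 2
        then have "R s \<subseteq> E" using d(2)[OF sJ] x by (auto simp: R_def)
        then show ?thesis using 2 s by (auto simp: \<I>_def)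
      next
        case 3
        then have "L s \<subseteq> E" using d(3)[OF sJ] x by (auto simp: L_def)
        then show ?thesis using 3 s by (auto simp: \<I>_def)
      qed
    qed
    then show "\<Union>\<I> = E" by (auto simp: \<I>_def)
  qed
qed

text \<open>
  The equation \<open>s = \<nu> g s\<close> on an interval that \<open>\<nu> g\<close> maps into itself. The second order expansion
  \<open>taylor\<close> is of Peano type, at a single point: arguments about folds use the expansion itself and not
  the sign of \<open>g'\<close> nearby.
\<close>

locale scalar_bifurcation =
  fixes a b \<nu>s :: real and g g' g2 :: "real \<Rightarrow> real"
  assumes ab: "a \<le> 0" "0 \<le> b" and \<nu>s: "\<nu>s > 0"
    and range: "\<And>s \<nu>. s \<in> {a..b} \<Longrightarrow> \<nu> \<in> {0..\<nu>s} \<Longrightarrow> \<nu> * g s \<in> {a..b}"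
    and der: "\<And>s. s \<in> {a..b} \<Longrightarrow> (g has_real_derivative g' s) (at s within {a..b})"
    and taylor: "\<And>s. s \<in> {a..b} \<Longrightarrow>
      ((\<lambda>t. (g t - g s - (t - s) * g' s) / (t - s)\<^sup>2) \<longlongrightarrow> g2 s) (at s within {a..b})"
    and nondegenerate: "\<And>s \<nu>. s \<in> {a..b} \<Longrightarrow> \<nu> \<in> {0..\<nu>s} \<Longrightarrow> s = \<nu> * g s \<Longrightarrow> \<nu> * g' s = 1 \<Longrightarrow>
      g s \<noteq> 0 \<and> g2 s \<noteq> 0"
begin

lemma continuous_g: "continuous_on {a..b} g"
  by (rule DERIV_continuous_on[OF der])

lemma tendsto_g: "s \<in> {a..b} \<Longrightarrow> (g \<longlongrightarrow> g s) (at s within {a..b})"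
  using continuous_g by (simp add: continuous_on_def)

text \<open>
  At a solution, \<open>s - \<nu> g s\<close> vanishes to first order unless \<open>\<nu> g' s = 1\<close>, and then exactly to second
  order by nondegeneracy. In both cases the solution is isolated.
\<close>

lemma leading_term:
  assumes s: "s \<in> {a..b}" and \<nu>: "\<nu> \<in> {0..\<nu>s}" and eq: "s = \<nu> * g s"
  obtains k c where "c \<noteq> 0" "((\<lambda>t. (t - \<nu> * g t) / (t - s) ^ k) \<longlongrightarrow> c) (at s within {a..b})"
    "\<nu> * g' s = 1 \<Longrightarrow> even k"
proof (cases "\<nu> * g' s = 1")
  case False
  have "((\<lambda>t. (g t - g s) / (t - s)) \<longlongrightarrow> g' s) (at s within {a..b})"
    using der[OF s] by (simp add: has_field_derivative_iff)
  then have "((\<lambda>t. 1 - \<nu> * ((g t - g s) / (t - s))) \<longlongrightarrow> 1 - \<nu> * g' s) (at s within {a..b})"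
    by (intro tendsto_intros)
  then have "((\<lambda>t. (t - \<nu> * g t) / (t - s) ^ 1) \<longlongrightarrow> 1 - \<nu> * g' s) (at s within {a..b})"
  proof (rule Lim_transform_eventually)
    have "1 - \<nu> * ((g t - g s) / (t - s)) = (t - \<nu> * g t) / (t - s) ^ 1" if "t \<noteq> s" for t
    proof -
      have "t - \<nu> * g t = (t - s) - \<nu> * (g t - g s)" using eq by (simp add: algebra_simps)
      then have "(t - \<nu> * g t) / (t - s) = (t - s) / (t - s) - \<nu> * (g t - g s) / (t - s)"
        by (simp only: diff_divide_distrib)
      then show ?thesis using that by simp
    qed
    then show "\<forall>\<^sub>F t in at s within {a..b}.
        1 - \<nu> * ((g t - g s) / (t - s)) = (t - \<nu> * g t) / (t - s) ^ 1"
      by (simp add: eventually_at_filter)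
  qed
  then show thesis by (rule that[of "1 - \<nu> * g' s" 1, rotated]) (use False in auto)
next
  case True
  have "((\<lambda>t. - \<nu> * ((g t - g s - (t - s) * g' s) / (t - s)\<^sup>2)) \<longlongrightarrow> - \<nu> * g2 s) (at s within {a..b})"
    by (intro tendsto_intros taylor s)
  then have "((\<lambda>t. (t - \<nu> * g t) / (t - s) ^ 2) \<longlongrightarrow> - \<nu> * g2 s) (at s within {a..b})"
  proof (rule Lim_transform_eventually)
    have "- \<nu> * (g t - g s - (t - s) * g' s) = t - \<nu> * g t" for t
    proof -
      have "- \<nu> * (g t - g s - (t - s) * g' s) = - \<nu> * g t + \<nu> * g s + (t - s) * (\<nu> * g' s)"
        by (simp add: algebra_simps)
      also have "\<dots> = t - \<nu> * g t" unfolding True eq[symmetric] by simp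
      finally show ?thesis .
    qed
    then have *: "- \<nu> * ((g t - g s - (t - s) * g' s) / (t - s)\<^sup>2) = (t - \<nu> * g t) / (t - s) ^ 2" for t
      by (metis times_divide_eq_right)
    show "\<forall>\<^sub>F t in at s within {a..b}.
        - \<nu> * ((g t - g s - (t - s) * g' s) / (t - s)\<^sup>2) = (t - \<nu> * g t) / (t - s) ^ 2"
      by (rule always_eventually) (use * in blast)
  qed
  moreover have "- \<nu> * g2 s \<noteq> 0" using nondegenerate[OF s \<nu> eq True] True by auto
  ultimately show thesis by (intro that[of "- \<nu> * g2 s" 2]) simp_all
qed

lemma finite_solutions:
  assumes \<nu>: "\<nu> \<in> {0..\<nu>s}"
  shows "finite {s \<in> {a..b}. s = \<nu> * g s}"
proof (rule ccontr)
  let ?Z = "{s \<in> {a..b}. s = \<nu> * g s}"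
  assume "infinite ?Z"
  then have "\<exists>s\<in>{a..b}. s islimpt ?Z"
    by (rule Heine_Borel_imp_Bolzano_Weierstrass[OF compact_Icc]) auto
  then obtain s where s: "s \<in> {a..b}" "s islimpt ?Z" by blast
  have "closed ?Z"
  proof -
    have "closed ({a..b} \<inter> (\<lambda>s. s - \<nu> * g s) -` {0})"
      by (intro continuous_closed_preimage continuous_on_diff continuous_on_mult continuous_on_id
          continuous_on_const continuous_g closed_atLeastAtMost closed_singleton)
    moreover have "{a..b} \<inter> (\<lambda>s. s - \<nu> * g s) -` {0} = ?Z" by auto
    ultimately show ?thesis by simp
  qed
  then have "s \<in> ?Z" using s(2) unfolding closed_limpt by blast
  then have eq: "s = \<nu> * g s" by blast
  obtain k c where c: "c \<noteq> 0" "((\<lambda>t. (t - \<nu> * g t) / (t - s) ^ k) \<longlongrightarrow> c) (at s within {a..b})"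
    by (rule leading_term[OF s(1) \<nu> eq])
  obtain d where d: "d > 0" "\<And>t. t \<in> {a..b} \<Longrightarrow> t \<noteq> s \<Longrightarrow> dist t s < d \<Longrightarrow>
      sgn c * (t - \<nu> * g t) * sgn ((t - s) ^ k) > 0"
    using eventually_sign[OF c(2,1)] unfolding eventually_at by blast
  obtain t where "t \<in> ?Z" "t \<noteq> s" "dist t s < d" using s(2) d(1) unfolding islimpt_approachable by blast
  then show False using d(2)[of t] by auto
qed

text \<open>
  If \<open>g s \<noteq> 0\<close>, then \<open>s\<close> solves the equation for \<open>\<nu> = s / g s\<close> and for no other \<open>\<nu>\<close>. The remaining
  solutions are \<open>s = 0\<close> with arbitrary \<open>\<nu>\<close>, in case \<open>g 0 = 0\<close>.
\<close>

definition branch :: "real set" where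
  "branch = {s \<in> {a..b}. g s \<noteq> 0 \<and> s / g s \<in> {0..\<nu>s}}"

text \<open>
  Where \<open>g s \<noteq> 0\<close>, the branch is cut out by the two inequalities \<open>s / g s \<ge> 0\<close> and \<open>s / g s \<le> \<nu>s\<close>, and the
  leading terms of \<open>s\<close> and of \<open>s - \<nu>s g s\<close> decide each of them on either side. Zeros of \<open>g\<close> are at
  positive distance from the branch: if \<open>s \<noteq> 0\<close> because \<open>s / g s\<close> is unbounded there, and if \<open>s = 0\<close>
  because \<open>s / g s\<close> then tends to \<open>1 / g' 0\<close> (to infinity in modulus if \<open>g' 0 = 0\<close>), which
  nondegeneracy keeps out of \<open>[0, \<nu>s]\<close>.
\<close>

lemma branch_germs:
  assumes s: "s \<in> {a..b}"
  shows "one_sided_germs {a..b} s (\<lambda>t. t \<in> branch)"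
proof (cases "g s = 0")
  case 0: True
  have "\<forall>\<^sub>F t in at s within {a..b}. t \<notin> branch"
  proof (cases "s = 0")
    case False
    have "((\<lambda>t. \<bar>t\<bar> - \<nu>s * \<bar>g t\<bar>) \<longlongrightarrow> \<bar>s\<bar> - \<nu>s * \<bar>g s\<bar>) (at s within {a..b})"
      by (intro tendsto_intros tendsto_g s)
    then have "\<forall>\<^sub>F t in at s within {a..b}. \<bar>t\<bar> - \<nu>s * \<bar>g t\<bar> > 0"
      using 0 False by (intro order_tendstoD(1)) auto
    then show ?thesis
    proof eventually_elim
      case (elim t)
      show ?case
      proof
        assume "t \<in> branch"
        then have t: "g t \<noteq> 0" "0 \<le> t / g t" "t / g t \<le> \<nu>s" by (auto simp: branch_def)
        have "\<bar>t\<bar> = \<bar>t / g t\<bar> * \<bar>g t\<bar>" using t by simp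
        also have "\<dots> \<le> \<nu>s * \<bar>g t\<bar>" using t by (intro mult_right_mono) auto
        finally show False using elim by simp
      qed
    qed
  next
    case s0: True
    have g'0: "g' 0 < 1 / \<nu>s"
    proof (rule ccontr)
      assume "\<not> g' 0 < 1 / \<nu>s"
      then have "1 / \<nu>s \<le> g' 0" by simp
      moreover have "1 / \<nu>s > 0" using \<nu>s by simp
      ultimately have pos: "g' 0 > 0" by linarith
      then have "1 / g' 0 \<le> \<nu>s" using \<open>1 / \<nu>s \<le> g' 0\<close> \<nu>s by (simp add: field_simps)

      then show False
        using nondegenerate[of 0 "1 / g' 0"] 0 s0 s pos by auto
    qed
    have "((\<lambda>t. g t / t) \<longlongrightarrow> g' 0) (at s within {a..b})"
      using der[OF s] 0 s0 by (simp add: has_field_derivative_iff)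
    then have "\<forall>\<^sub>F t in at s within {a..b}. g t / t < 1 / \<nu>s"
      by (rule order_tendstoD(2)[OF _ g'0])
    moreover have "\<forall>\<^sub>F t in at s within {a..b}. t \<noteq> 0" using s0 by (simp add: eventually_at_filter)
    ultimately show ?thesis
    proof eventually_elim
      case (elim t)
      show ?case
      proof
        assume "t \<in> branch"
        then have t: "g t \<noteq> 0" "0 \<le> t / g t" "t / g t \<le> \<nu>s" by (auto simp: branch_def)
        then have "0 < t / g t" using elim(2) by (simp add: order_less_le)
        then have "1 / \<nu>s \<le> 1 / (t / g t)" using t(3) \<nu>s by (intro divide_left_mono mult_pos_pos) auto
        then show False using elim by simp
      qed
    qed
  qed
  then show ?thesis by (rule one_sided_germs_const(2))
next
  case g0: False
  let ?\<sigma> = "sgn (g s)"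
  have "((\<lambda>t. ?\<sigma> * g t) \<longlongrightarrow> ?\<sigma> * g s) (at s within {a..b})" by (intro tendsto_intros tendsto_g s)
  moreover have "?\<sigma> * g s > 0" using g0 by (auto simp: sgn_if)
  ultimately have same_sign: "\<forall>\<^sub>F t in at s within {a..b}. ?\<sigma> * g t > 0" by (rule order_tendstoD(1))
  have 1: "one_sided_germs {a..b} s (\<lambda>t. ?\<sigma> * t \<ge> 0)"
  proof (cases "s = 0")
    case True
    have "((\<lambda>t. (?\<sigma> * t) / (t - s) ^ 1) \<longlongrightarrow> ?\<sigma>) (at s within {a..b})"
      by (rule Lim_transform_eventually[OF tendsto_const])
         (auto simp: True eventually_at_filter intro!: always_eventually)
    then show ?thesis by (rule one_sided_germs_sign) (use g0 in \<open>auto simp: sgn_if\<close>)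
  next
    case False
    show ?thesis
      by (rule one_sided_germs_sign_continuous) (use False g0 in \<open>auto intro!: tendsto_intros simp: sgn_if\<close>)
  qed
  have 2: "one_sided_germs {a..b} s (\<lambda>t. - ?\<sigma> * (t - \<nu>s * g t) \<ge> 0)"
  proof (cases "s = \<nu>s * g s")
    case True
    obtain k c where c: "c \<noteq> 0" "((\<lambda>t. (t - \<nu>s * g t) / (t - s) ^ k) \<longlongrightarrow> c) (at s within {a..b})"
      by (rule leading_term[OF s _ True]) (use \<nu>s in auto)
    have "((\<lambda>t. - ?\<sigma> * ((t - \<nu>s * g t) / (t - s) ^ k)) \<longlongrightarrow> - ?\<sigma> * c) (at s within {a..b})"
      by (intro tendsto_intros c)
    then have "((\<lambda>t. (- ?\<sigma> * (t - \<nu>s * g t)) / (t - s) ^ k) \<longlongrightarrow> - ?\<sigma> * c) (at s within {a..b})"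
      by simp
    then show ?thesis by (rule one_sided_germs_sign) (use g0 c in \<open>auto simp: sgn_if\<close>)
  next
    case False
    show ?thesis
      by (rule one_sided_germs_sign_continuous)
         (use False g0 in \<open>auto intro!: tendsto_intros tendsto_g s simp: sgn_if\<close>)
  qed
  show ?thesis
  proof (rule one_sided_germs_cong[OF _ one_sided_germs_conj[OF 1 2]])
    have J: "\<forall>\<^sub>F t in at s within {a..b}. t \<in> {a..b}" by (simp add: eventually_at_filter)
    show "\<forall>\<^sub>F t in at s within {a..b}. (0 \<le> ?\<sigma> * t \<and> 0 \<le> - ?\<sigma> * (t - \<nu>s * g t)) = (t \<in> branch)"
      using same_sign J
    proof eventually_elim
      case (elim t)
      show ?case
      proof (cases "g s > 0")
        case True
        then have "g t > 0" using elim by simp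
        then show ?thesis using True elim by (auto simp: branch_def divide_le_eq zero_le_divide_iff)
      next
        case False
        then have s: "?\<sigma> = -1" using g0 by simp
        then have "g t < 0" using elim by simp
        then show ?thesis using elim s by (auto simp: branch_def divide_le_eq zero_le_divide_iff)
      qed
    qed
  qed
qed

lemma branch_intervals:
  obtains \<I> where "finite \<I>" "\<Union>\<I> = branch" "\<And>I. I \<in> \<I> \<Longrightarrow> is_interval I \<and> I \<noteq> {}"
proof -
  have "branch \<subseteq> {a..b}" by (auto simp: branch_def)
  then show thesis
  proof (rule finite_union_of_intervals)
    fix s assume "s \<in> {a..b}"
    then show "one_sided_germs {a..b} s (\<lambda>t. t \<in> branch)" by (rule branch_germs)
  qed (rule that)
qed

text \<open>
  At a fold the function \<open>s - \<nu> g s\<close> has a strict extremum with value zero. Moving \<open>\<nu>\<close> in the right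
  direction makes it change sign twice nearby, and since it is \<open>\<le> 0\<close> at \<open>a\<close> and \<open>\<ge> 0\<close> at \<open>b\<close> it must
  change sign a third time.
\<close>

lemma fold_three_solutions:
  assumes s: "s \<in> {a..b}" and \<nu>: "\<nu> \<in> {0<..<\<nu>s}" and eq: "s = \<nu> * g s" and fold: "\<nu> * g' s = 1"
  obtains \<nu>1 z1 z2 z3 where "\<nu>1 \<in> {0<..<\<nu>s}" "{z1, z2, z3} \<subseteq> {a..b}" "z1 < z2" "z2 < z3"
    "\<And>z. z \<in> {z1, z2, z3} \<Longrightarrow> z = \<nu>1 * g z"
proof -
  have \<nu>': "\<nu> \<in> {0..\<nu>s}" using \<nu> by auto
  have g0: "g s \<noteq> 0" using nondegenerate[OF s \<nu>' eq fold] by simp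
  (* As \<nu> < \<nu>s, the point \<nu>s g s of [a,b] lies strictly beyond s = \<nu> g s. *)
  have int: "a < s" "s < b"
  proof -
    have m: "\<nu>s * g s \<in> {a..b}" using range[OF s, of \<nu>s] \<nu>s by simp
    have "a < s \<and> s < b"
    proof (cases "g s > 0")
      case True
      then have "\<nu> * g s < \<nu>s * g s" "0 < \<nu> * g s" using \<nu> by auto
      then show ?thesis using m ab eq unfolding atLeastAtMost_iff by linarith
    next
      case False
      then have "\<nu> * g s > \<nu>s * g s" "0 > \<nu> * g s" using g0 \<nu> by (auto simp: mult_less_0_iff)
      then show ?thesis using m ab eq unfolding atLeastAtMost_iff by linarith
    qed
    then show "a < s" "s < b" by auto
  qed
  obtain k c where c: "c \<noteq> 0" "((\<lambda>t. (t - \<nu> * g t) / (t - s) ^ k) \<longlongrightarrow> c) (at s within {a..b})"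
    and k: "even k"
    by (rule leading_term[OF s \<nu>' eq]) (use fold in blast)
  define \<sigma> where "\<sigma> = sgn c"
  have \<sigma>: "\<sigma> = 1 \<or> \<sigma> = -1" using c by (auto simp: \<sigma>_def sgn_if)
  have "\<forall>\<^sub>F t in at s within {a..b}. \<sigma> * (t - \<nu> * g t) > 0"
  proof -
    have "\<forall>\<^sub>F t in at s within {a..b}. t \<noteq> s" by (simp add: eventually_at_filter)
    with eventually_sign[OF c(2,1)] show ?thesis
    proof eventually_elim
      case (elim t)
      then have "(t - s) ^ k > 0" using k by (simp add: zero_less_power_eq)
      then have "sgn ((t - s) ^ k) = 1" by (rule sgn_pos)
      then show ?case using elim by (simp add: \<sigma>_def)
    qed
  qed
  then obtain d where d: "d > 0" "\<And>t. t \<in> {a..b} \<Longrightarrow> t \<noteq> s \<Longrightarrow> dist t s < d \<Longrightarrow> \<sigma> * (t - \<nu> * g t) > 0"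
    unfolding eventually_at by blast
  define \<delta> where "\<delta> = min (d / 2) (min (s - a) (b - s))"
  have \<delta>: "\<delta> > 0" "a \<le> s - \<delta>" "s + \<delta> \<le> b" "\<delta> < d" using d int by (auto simp: \<delta>_def)
  have pos: "\<sigma> * ((s - \<delta>) - \<nu> * g (s - \<delta>)) > 0" "\<sigma> * ((s + \<delta>) - \<nu> * g (s + \<delta>)) > 0"
    using \<delta> int by (auto intro!: d(2) simp: dist_real_def)
  (* \<tau> is the direction in which moving \<nu> lets the extremum \<sigma> (t - \<nu> g t) \<ge> 0 drop below zero. *)
  define \<tau> where "\<tau> = \<sigma> * sgn (g s)"
  define N where "N \<eta> = \<nu> + \<eta> * \<tau>" for \<eta> :: real
  have "((\<lambda>\<eta>. \<sigma> * ((s - \<delta>) - N \<eta> * g (s - \<delta>))) \<longlongrightarrow> \<sigma> * ((s - \<delta>) - N 0 * g (s - \<delta>))) (at_right 0)"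
    "((\<lambda>\<eta>. \<sigma> * ((s + \<delta>) - N \<eta> * g (s + \<delta>))) \<longlongrightarrow> \<sigma> * ((s + \<delta>) - N 0 * g (s + \<delta>))) (at_right 0)"
    "(N \<longlongrightarrow> N 0) (at_right 0)"
    unfolding N_def by (intro tendsto_intros)+
  note lims = this
  have "N 0 = \<nu>" by (simp add: N_def)
  then have "\<forall>\<^sub>F \<eta> in at_right 0. \<sigma> * ((s - \<delta>) - N \<eta> * g (s - \<delta>)) > 0"
    "\<forall>\<^sub>F \<eta> in at_right 0. \<sigma> * ((s + \<delta>) - N \<eta> * g (s + \<delta>)) > 0"
    "\<forall>\<^sub>F \<eta> in at_right 0. N \<eta> > 0" "\<forall>\<^sub>F \<eta> in at_right 0. N \<eta> < \<nu>s"
    using pos \<nu> by (auto intro!: order_tendstoD(1)[OF lims(1)] order_tendstoD(1)[OF lims(2)]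
        order_tendstoD(1)[OF lims(3)] order_tendstoD(2)[OF lims(3)])
  moreover have "\<forall>\<^sub>F \<eta> in at_right (0::real). \<eta> > 0" by (rule eventually_at_right_less)
  ultimately have "\<forall>\<^sub>F \<eta> in at_right 0. \<sigma> * ((s - \<delta>) - N \<eta> * g (s - \<delta>)) > 0 \<and>
      \<sigma> * ((s + \<delta>) - N \<eta> * g (s + \<delta>)) > 0 \<and> N \<eta> > 0 \<and> N \<eta> < \<nu>s \<and> \<eta> > 0"
    by eventually_elim auto
  then obtain \<eta> where \<eta>: "\<sigma> * ((s - \<delta>) - N \<eta> * g (s - \<delta>)) > 0"
    "\<sigma> * ((s + \<delta>) - N \<eta> * g (s + \<delta>)) > 0" "N \<eta> > 0" "N \<eta> < \<nu>s" "\<eta> > 0"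
    using eventually_happens'[OF trivial_limit_at_right_real] by blast
  define f where "f t = t - N \<eta> * g t" for t
  have fc: "continuous_on {x..y} f" if "a \<le> x" "y \<le> b" for x y
    unfolding f_def using continuous_on_subset[OF continuous_g, of "{x..y}"] that
    by (auto intro!: continuous_intros)
  have N: "N \<eta> \<in> {0..\<nu>s}" using \<eta> by auto
  have "f s = - \<eta> * \<tau> * g s" using eq by (simp add: f_def N_def algebra_simps)
  then have "\<sigma> * f s = - \<eta> * (\<sigma> * \<sigma>) * (sgn (g s) * g s)" by (simp add: \<tau>_def)
  moreover have "\<sigma> * \<sigma> = 1" using \<sigma> by auto
  moreover have "sgn (g s) * g s > 0" using g0 by (auto simp: sgn_if)
  ultimately have mid: "\<sigma> * f s < 0" using \<eta>(5) by simp
  have side: "\<sigma> * f (s - \<delta>) > 0" "\<sigma> * f (s + \<delta>) > 0" using \<eta> by (simp_all add: f_def)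
  have ends: "f a \<le> 0" "f b \<ge> 0"
    using range[of a "N \<eta>"] range[of b "N \<eta>"] N ab by (auto simp: f_def)
  have zero: "\<exists>z. x \<le> z \<and> z \<le> y \<and> f z = 0"
    if "a \<le> x" "x \<le> y" "y \<le> b" "f x \<le> 0 \<and> 0 \<le> f y \<or> f y \<le> 0 \<and> 0 \<le> f x" for x y
    using that IVT'[of f x 0 y] IVT2'[of f y 0 x] fc[of x y] by blast
  have sol: "z = N \<eta> * g z" if "f z = 0" for z using that by (simp add: f_def)
  have "\<exists>z1 z2 z3. {z1, z2, z3} \<subseteq> {a..b} \<and> z1 < z2 \<and> z2 < z3 \<and> f z1 = 0 \<and> f z2 = 0 \<and> f z3 = 0"
    using \<sigma>
  proof
    assume 1: "\<sigma> = 1"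
    obtain z1 where z1: "a \<le> z1" "z1 \<le> s - \<delta>" "f z1 = 0"
      using zero[of a "s - \<delta>"] side ends \<delta> int 1 by auto
    obtain z2 where z2: "s - \<delta> \<le> z2" "z2 \<le> s" "f z2 = 0"
      using zero[of "s - \<delta>" s] side mid \<delta> int 1 by auto
    obtain z3 where z3: "s \<le> z3" "z3 \<le> s + \<delta>" "f z3 = 0"
      using zero[of s "s + \<delta>"] side mid \<delta> int 1 by auto
    have "z1 \<noteq> s - \<delta>" "z2 \<noteq> s" "z2 \<noteq> s - \<delta>" using z1 z2 side mid by auto
    then have "{z1, z2, z3} \<subseteq> {a..b} \<and> z1 < z2 \<and> z2 < z3" using z1 z2 z3 \<delta> int by auto
    then show ?thesis using z1 z2 z3 by blast
  next
    assume 1: "\<sigma> = -1"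
    obtain z1 where z1: "s - \<delta> \<le> z1" "z1 \<le> s" "f z1 = 0"
      using zero[of "s - \<delta>" s] side mid \<delta> int 1 by auto
    obtain z2 where z2: "s \<le> z2" "z2 \<le> s + \<delta>" "f z2 = 0"
      using zero[of s "s + \<delta>"] side mid \<delta> int 1 by auto
    obtain z3 where z3: "s + \<delta> \<le> z3" "z3 \<le> b" "f z3 = 0"
      using zero[of "s + \<delta>" b] side ends \<delta> int 1 by auto
    have "z1 \<noteq> s" "z2 \<noteq> s + \<delta>" using z1 z2 side mid by auto
    then have "{z1, z2, z3} \<subseteq> {a..b} \<and> z1 < z2 \<and> z2 < z3" using z1 z2 z3 \<delta> int by auto
    then show ?thesis using z1 z2 z3 by blast
  qed
  then obtain z1 z2 z3 where "{z1, z2, z3} \<subseteq> {a..b}" "z1 < z2" "z2 < z3" "f z1 = 0" "f z2 = 0" "f z3 = 0"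
    by blast
  then show thesis
    using \<eta> by (intro that[of "N \<eta>" z1 z2 z3] sol) auto
qed

end

section \<open>Transfer operators on spaces of distributions\<close>

text \<open>
  The derivatives are Lipschitz, which bounds the Hoelder quotient for points at distance \<open>\<le> 1\<close>, and
  bounded, which bounds it for the others.
\<close>

lemma CT_imp_Cs:
  fixes f :: "real ^ 'd \<Rightarrow> real"
  assumes f: "\<And>k. f \<in> CT k"
  shows "f \<in> Cs s"
proof -
  let ?\<gamma> = "frac s"
  have "bdd_above (range (holder_quot ?\<gamma> h))" if h: "h \<in> CT 1" for h :: "real ^ 'd \<Rightarrow> real"
  proof -
    obtain B where B: "\<And>x. \<bar>h x\<bar> \<le> B" using CT_bounded[OF h] by blast
    have "\<forall>i. \<exists>D. \<forall>x. \<bar>pd i h x\<bar> \<le> D"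
      using CT_bounded CT_pd[of h 0] h by auto
    then obtain D where D: "\<And>i x. \<bar>pd i h x\<bar> \<le> D i" by metis
    have dh: "h differentiable (at x)" for x using h by (auto simp: CT_def differentiable_on_def)
    define E where "E = (\<Sum>i\<in>UNIV. D i)"
    have lip: "\<bar>h x - h y\<bar> \<le> E * dist x y" for x y
    proof -
      have "norm (h x - h y) \<le> E * norm (x - y)"
      proof (rule differentiable_bound[of UNIV])
        show "(h has_derivative (\<lambda>v. \<Sum>i\<in>UNIV. v $ i * pd i h z)) (at z within UNIV)" for z
          using has_derivative_pd_sum[OF dh] by simp
        show "onorm (\<lambda>v. \<Sum>i\<in>UNIV. v $ i * pd i h z) \<le> E" for z
        proof (rule onorm_le)
          fix v :: "real ^ 'd"
          have "norm (\<Sum>i\<in>UNIV. v $ i * pd i h z) \<le> (\<Sum>i\<in>UNIV. norm v * D i)"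
            using D component_le_norm_cart[of v]
            by (intro sum_norm_le) (auto simp: abs_mult intro!: mult_mono)
          then show "norm (\<Sum>i\<in>UNIV. v $ i * pd i h z) \<le> E * norm v"
            by (simp add: E_def sum_distrib_left mult.commute)
        qed
      qed auto
      then show ?thesis by (simp add: dist_norm)
    qed
    have "holder_quot ?\<gamma> h p \<le> max E (2 * B)" for p
    proof -
      obtain x y where p: "p = (x, y)" by (cases p)
      have \<gamma>: "0 \<le> ?\<gamma>" "?\<gamma> \<le> 1" using frac_lt_1[of s] by auto
      have E0: "E \<ge> 0" unfolding E_def using D by (intro sum_nonneg) (meson abs_ge_zero order_trans)
      consider "x = y" | "x \<noteq> y" "dist x y \<le> 1" | "dist x y > 1" by fastforce
      then show ?thesis
      proof cases
        case 1
        then show ?thesis using E0 by (simp add: p holder_quot_def)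
      next
        case 2
        then have "dist x y powr 1 \<le> dist x y powr ?\<gamma>" using \<gamma> by (intro powr_mono') auto
        then have "E * dist x y \<le> E * dist x y powr ?\<gamma>" using E0 2 by (intro mult_left_mono) auto
        then have "\<bar>h x - h y\<bar> \<le> E * dist x y powr ?\<gamma>" using lip[of x y] by linarith
        then have "\<bar>h x - h y\<bar> / dist x y powr ?\<gamma> \<le> E" using 2 by (simp add: divide_le_eq)
        then show ?thesis by (simp add: p holder_quot_def)
      next
        case 3
        then have "1 \<le> dist x y powr ?\<gamma>" using \<gamma> by (simp add: ge_one_powr_ge_zero)
        moreover have "\<bar>h x - h y\<bar> \<le> 2 * B" using B[of x] B[of y] by linarith
        ultimately have "\<bar>h x - h y\<bar> / dist x y powr ?\<gamma> \<le> (2 * B) / 1"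
          by (intro frac_le) auto
        then show ?thesis by (simp add: p holder_quot_def)
      qed
    qed
    then show ?thesis by (intro bdd_aboveI2)
  qed
  moreover have "pds is f \<in> CT 1" for "is" using f CT_pds by blast
  ultimately show ?thesis using f by (auto simp: Cs_def)
qed

lemma integral_cube_eq:
  fixes f :: "real ^ 'd \<Rightarrow> real"
  assumes "continuous_on (cbox 0 1) f"
  shows "(LINT x:cbox 0 1|lborel. f x) = integral (cbox 0 1) f"
  using borel_integrable_compact[OF compact_cbox assms]
  by (intro set_borel_integral_eq_integral(2)) (simp add: set_integrable_def)

text \<open>
  The chain rule behind linear response: the derivative of \<open>\<integral> \<phi> \<circ> T\<^sub>u f\<close> in \<open>u\<close>, where
  \<open>T\<^sub>u = T + u \<beta>\<close>, is \<open>\<integral> (\<nabla>\<phi> \<circ> T\<^sub>u) \<cdot> \<beta> f\<close>.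
\<close>

lemma has_derivative_cube_integral:
  fixes T \<beta> :: "real ^ 'd \<Rightarrow> real ^ 'd" and f \<phi> :: "real ^ 'd \<Rightarrow> real"
  assumes T: "continuous_on UNIV T" and \<beta>: "continuous_on UNIV \<beta>"
    and f: "continuous_on UNIV f" and \<phi>: "Ck 1 \<phi>"
  shows "((\<lambda>u. integral (cbox 0 1) (\<lambda>x. \<phi> (T x + u *\<^sub>R \<beta> x) * f x)) has_real_derivative
     (\<Sum>k\<in>UNIV. integral (cbox 0 1) (\<lambda>x. \<beta> x $ k * pd k \<phi> (T x + u *\<^sub>R \<beta> x) * f x))) (at u within J)"
proof -
  have pdc: "continuous_on UNIV (pd k \<phi>)" for k using \<phi> by simp
  have \<phi>c: "continuous_on UNIV \<phi>" using Ck_continuous[OF \<phi>] .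
  have c: "continuous_on A (\<lambda>x. \<phi> (T x + u *\<^sub>R \<beta> x) * f x)" for A u
    by (intro continuous_intros continuous_on_compose2[OF \<phi>c] continuous_on_compose2[OF T]
        continuous_on_compose2[OF \<beta>] continuous_on_compose2[OF f]) auto
  have c': "continuous_on A (\<lambda>(u, x). \<Sum>k\<in>UNIV. \<beta> x $ k * pd k \<phi> (T x + u *\<^sub>R \<beta> x) * f x)" for A
    unfolding case_prod_unfold
    by (intro continuous_intros continuous_on_compose2[OF pdc] continuous_on_compose2[OF T]
        continuous_on_compose2[OF \<beta>] continuous_on_compose2[OF f]) auto
  have c'': "continuous_on A (\<lambda>x. \<beta> x $ k * pd k \<phi> (T x + u *\<^sub>R \<beta> x) * f x)" for A k
    by (intro continuous_intros continuous_on_compose2[OF pdc] continuous_on_compose2[OF T]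
        continuous_on_compose2[OF \<beta>] continuous_on_compose2[OF f]) auto
  have d: "((\<lambda>u. \<phi> (T x + u *\<^sub>R \<beta> x) * f x) has_field_derivative
      (\<Sum>k\<in>UNIV. \<beta> x $ k * pd k \<phi> (T x + u *\<^sub>R \<beta> x) * f x)) (at u within UNIV)" for u x
  proof -
    have "((\<lambda>u. T x + u *\<^sub>R \<beta> x) has_derivative (\<lambda>h. h *\<^sub>R \<beta> x)) (at u)"
      by (auto intro!: derivative_eq_intros)
    from has_derivative_compose[OF this has_derivative_pd_sum[OF Ck_differentiable[of 0 \<phi>]]] \<phi>
    have "((\<lambda>u. \<phi> (T x + u *\<^sub>R \<beta> x)) has_derivative
        (\<lambda>h. \<Sum>k\<in>UNIV. (h *\<^sub>R \<beta> x) $ k * pd k \<phi> (T x + u *\<^sub>R \<beta> x))) (at u)" by simp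
    from has_derivative_mult_left[OF this, of "f x"]
    show ?thesis
      unfolding has_field_derivative_def
      by (rule has_derivative_eq_rhs) (auto simp: sum_distrib_left sum_distrib_right ac_simps)
  qed
  have "((\<lambda>u. integral (cbox 0 1) (\<lambda>x. \<phi> (T x + u *\<^sub>R \<beta> x) * f x)) has_field_derivative
      integral (cbox 0 1) (\<lambda>x. \<Sum>k\<in>UNIV. \<beta> x $ k * pd k \<phi> (T x + u *\<^sub>R \<beta> x) * f x)) (at u within UNIV)"
    by (rule leibniz_rule_field_derivative[OF d integrable_continuous[OF c] c']) auto
  then show ?thesis
    by (subst (asm) integral_sum) (auto intro: integrable_continuous c'' DERIV_subset)
qed

text \<open>
  The operators on distributions transported to a space embedded by \<open>e\<close>. Where the result of the
  operator lies in the range of \<open>e\<close>, the inverse of \<open>e\<close> recovers it.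
\<close>

definition transfer_op :: "nat \<Rightarrow> ('b \<Rightarrow> 'd::finite dist) \<Rightarrow> (real ^ 'd \<Rightarrow> real ^ 'd) \<Rightarrow> 'b \<Rightarrow> 'b" where
  "transfer_op r e S x = inv e (transfer r S (e x))"

definition mult_op :: "nat \<Rightarrow> ('b \<Rightarrow> 'd::finite dist) \<Rightarrow> (real ^ 'd \<Rightarrow> real) \<Rightarrow> 'b \<Rightarrow> 'b" where
  "mult_op r e a x = inv e (dmult r a (e x))"

definition pd_op :: "nat \<Rightarrow> ('c \<Rightarrow> 'd::finite dist) \<Rightarrow> ('b \<Rightarrow> 'd dist) \<Rightarrow> 'd \<Rightarrow> 'c \<Rightarrow> 'b" where
  "pd_op r e' e i x = inv e (dpd r i (e' x))"

definition incl :: "('c \<Rightarrow> 'd dist) \<Rightarrow> ('b \<Rightarrow> 'd dist) \<Rightarrow> 'c \<Rightarrow> 'b" where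
  "incl e' e x = inv e (e' x)"

text \<open>
  The dense sets on which derivatives in the parameter are computed by hand. The tests have one
  derivative more than the distributions require, because it is spent when a derivative is moved
  from the distribution to the test function.
\<close>

definition smooth_elements :: "nat \<Rightarrow> ('b \<Rightarrow> 'd::finite dist) \<Rightarrow> 'b set" where
  "smooth_elements r e = {h. \<exists>\<phi>\<in>CT r. e h = fun_dist r \<phi>}"

definition smooth_tests :: "nat \<Rightarrow> ('b::banach \<Rightarrow> 'd::finite dist) \<Rightarrow> ('b \<Rightarrow>\<^sub>L real) set" where
  "smooth_tests r e = {l. \<exists>\<phi>\<in>CT (Suc r). \<forall>h. blinfun_apply l h = e h \<phi>}"

locale dist_space =
  fixes r :: nat and e :: "'b::banach \<Rightarrow> 'd::finite dist"
  assumes space: "banach_dist_space r e"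
begin

lemma inj_e: "inj e" and distribution_e: "distribution r (e h)"
  using space by (auto simp: banach_dist_space_def)

lemma e_lincomb: "e (a *\<^sub>R h + b *\<^sub>R g) = (\<lambda>\<phi>. a * e h \<phi> + b * e g \<phi>)"
  using space unfolding banach_dist_space_def by blast

lemma e_add: "e (h + g) \<phi> = e h \<phi> + e g \<phi>" using e_lincomb[of 1 h 1 g] by simp
lemma e_diff: "e (h - g) \<phi> = e h \<phi> - e g \<phi>" using e_lincomb[of 1 h "-1" g] by simp
lemma e_scale: "e (a *\<^sub>R h) \<phi> = a * e h \<phi>" using e_lincomb[of a h 0 0] by simp
lemma e_zero: "e 0 \<phi> = 0" using e_scale[of 0 0] by simp
lemma e_minus: "e (- h) \<phi> = - e h \<phi>" using e_scale[of "-1" h] by simp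
lemma e_sum: "e (\<Sum>i\<in>A. f i) \<phi> = (\<Sum>i\<in>A. e (f i) \<phi>)"
  by (induction A rule: infinite_finite_induct) (auto simp: e_add e_zero)

lemma e_test_lincomb: "\<phi> \<in> CT r \<Longrightarrow> \<psi> \<in> CT r \<Longrightarrow> e h (\<lambda>x. a * \<phi> x + b * \<psi> x) = a * e h \<phi> + b * e h \<psi>"
  using distribution_e[of h] unfolding distribution_def by blast

lemma e_test_zero: "e h (\<lambda>x. 0) = 0"
  using e_test_lincomb[of "\<lambda>x. 0" "\<lambda>x. 0" h 0 0] by simp

lemma e_outside: "\<phi> \<notin> CT r \<Longrightarrow> e h \<phi> = 0"
  using distribution_e by (simp add: distribution_def)

lemma bounded_linear_eval: "bounded_linear (\<lambda>h. e h \<phi>)"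
proof (cases "\<phi> \<in> CT r")
  case True
  obtain C where C: "\<And>h \<phi>. \<phi> \<in> CT r \<Longrightarrow> \<bar>e h \<phi>\<bar> \<le> C * norm h * CT_norm r \<phi>"
    using space unfolding banach_dist_space_def by blast
  show ?thesis
    by (rule bounded_linear_intro[of _ "C * CT_norm r \<phi>"])
       (use C[OF True] in \<open>auto simp: e_add e_scale ac_simps\<close>)
qed (simp add: e_outside bounded_linear_zero)

lemma e_eqI: "(\<And>\<phi>. \<phi> \<in> CT r \<Longrightarrow> e x \<phi> = e y \<phi>) \<Longrightarrow> x = y"
  by (metis e_outside ext injD inj_e)

lemma e_inv: "u \<in> range e \<Longrightarrow> e (inv e u) = u" by (rule f_inv_into_f)
lemma inv_e: "inv e (e x) = x" by (rule inv_f_f[OF inj_e])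
lemma dnorm_e: "dnorm e (e x) = norm x" by (simp add: dnorm_def inv_e)

lemma dense_smooth_elements: "closure (smooth_elements r e) = UNIV"
  using space by (simp add: banach_dist_space_def smooth_elements_def)

lemma fun_dist_in_range: "\<phi> \<in> CT r \<Longrightarrow> fun_dist r \<phi> \<in> range e"
  using space unfolding banach_dist_space_def by (metis rangeI)

text \<open>
  Density of \<open>C\<^sup>r\<close> in the dual combined with density of \<open>C\<^bsup>r+1\<^esup>\<close> in \<open>C\<^sup>r\<close>.
\<close>

lemma dense_smooth_tests: "closure (smooth_tests r e) = UNIV"
proof -
  obtain C where C: "\<And>h \<phi>. \<phi> \<in> CT r \<Longrightarrow> \<bar>e h \<phi>\<bar> \<le> C * norm h * CT_norm r \<phi>"
    using space unfolding banach_dist_space_def by blast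
  have "l \<in> closure (smooth_tests r e)" if l: "\<phi> \<in> CT r" "\<And>h. blinfun_apply l h = e h \<phi>" for l \<phi>
    unfolding closure_approachable
  proof (intro allI impI)
    fix \<epsilon> :: real assume \<epsilon>: "\<epsilon> > 0"
    then have "\<epsilon> / (\<bar>C\<bar> + 1) > 0" by simp
    then obtain \<psi> where \<psi>: "\<psi> \<in> CT (Suc r)" "CT_norm r (\<lambda>x. \<phi> x - \<psi> x) < \<epsilon> / (\<bar>C\<bar> + 1)"
      by (rule CT_Suc_dense[OF l(1)])
    have \<psi>r: "\<psi> \<in> CT r" using \<psi>(1) by (rule CT_mono) simp
    define m where "m = Blinfun (\<lambda>h. e h \<psi>)"
    have m: "blinfun_apply m h = e h \<psi>" for h
      by (simp add: m_def bounded_linear_Blinfun_apply[OF bounded_linear_eval])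
    have N: "0 \<le> CT_norm r (\<lambda>x. \<phi> x - \<psi> x)" by (intro CT_norm_nonneg CT_diff l \<psi>r)
    have "norm (m - l) \<le> \<bar>C\<bar> * CT_norm r (\<lambda>x. \<phi> x - \<psi> x)"
    proof (rule norm_blinfun_bound)
      fix h
      have "e h (\<lambda>x. 1 * \<phi> x + (- 1) * \<psi> x) = 1 * e h \<phi> + (- 1) * e h \<psi>"
        by (rule e_test_lincomb[OF l(1) \<psi>r])
      then have "norm (blinfun_apply (m - l) h) = \<bar>e h (\<lambda>x. \<phi> x - \<psi> x)\<bar>"
        by (simp add: blinfun.diff_left m l(2) abs_minus_commute)
      also have "\<dots> \<le> C * norm h * CT_norm r (\<lambda>x. \<phi> x - \<psi> x)" by (intro C CT_diff l \<psi>r)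
      also have "\<dots> \<le> \<bar>C\<bar> * norm h * CT_norm r (\<lambda>x. \<phi> x - \<psi> x)"
        using N by (intro mult_right_mono) auto
      finally show "norm (blinfun_apply (m - l) h) \<le> \<bar>C\<bar> * CT_norm r (\<lambda>x. \<phi> x - \<psi> x) * norm h"
        by (simp add: ac_simps)
    qed (use N in simp)
    also have "\<dots> \<le> (\<bar>C\<bar> + 1) * CT_norm r (\<lambda>x. \<phi> x - \<psi> x)" using N by (intro mult_right_mono) auto
    also have "\<dots> < (\<bar>C\<bar> + 1) * (\<epsilon> / (\<bar>C\<bar> + 1))" using \<psi>(2) by (intro mult_strict_left_mono) auto
    also have "\<dots> = \<epsilon>" by simp
    finally have "dist m l < \<epsilon>" by (simp add: dist_norm)
    moreover have "m \<in> smooth_tests r e" using \<psi>(1) m by (auto simp: smooth_tests_def)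
    ultimately show "\<exists>y\<in>smooth_tests r e. dist y l < \<epsilon>" by blast
  qed
  then have "{l :: 'b \<Rightarrow>\<^sub>L real. \<exists>\<phi>\<in>CT r. \<forall>h. blinfun_apply l h = e h \<phi>} \<subseteq> closure (smooth_tests r e)"
    by blast
  then have "closure {l :: 'b \<Rightarrow>\<^sub>L real. \<exists>\<phi>\<in>CT r. \<forall>h. blinfun_apply l h = e h \<phi>} \<subseteq> closure (smooth_tests r e)"
    by (rule closure_minimal) simp
  then show ?thesis using space unfolding banach_dist_space_def by (metis top.extremum_uniqueI)
qed

lemma transfer_op:
  assumes "transfer_bounded r S e"
  shows "bounded_linear (transfer_op r e S)" "e (transfer_op r e S x) = transfer r S (e x)"
proof -
  obtain M where M: "bounded_linear M" "\<And>h. e (M h) = transfer r S (e h)"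
    using assms by (auto simp: transfer_bounded_def)
  have "transfer_op r e S = M" by (auto simp: transfer_op_def M(2)[symmetric] inv_e)
  with M show "bounded_linear (transfer_op r e S)" "e (transfer_op r e S x) = transfer r S (e x)" by auto
qed

lemma e_transfer_op:
  assumes "transfer_bounded r S e" "\<phi> \<in> CT r"
  shows "e (transfer_op r e S x) \<phi> = e x (\<lambda>y. \<phi> (S y))"
  using transfer_op(2)[OF assms(1)] assms(2) by (simp add: transfer_def comp_def)

lemma mult_op:
  assumes "mult_bounded r s C e" "\<And>k. a \<in> CT k"
  shows "bounded_linear (mult_op r e a)" "e (mult_op r e a x) = dmult r a (e x)"
proof -
  obtain M where M: "bounded_linear M" "\<And>h. e (M h) = dmult r a (e h)"
    using assms CT_imp_Cs[of a s] unfolding mult_bounded_def by blast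
  have "mult_op r e a = M" by (auto simp: mult_op_def M(2)[symmetric] inv_e)
  with M show "bounded_linear (mult_op r e a)" "e (mult_op r e a x) = dmult r a (e x)" by auto
qed

lemma fold_transfer_eq:
  "transfer_bounded r S e \<Longrightarrow> fold (transfer r) (replicate n S) (e x) = e ((transfer_op r e S ^^ n) x)"
  by (induction n arbitrary: x) (simp_all add: transfer_op(2)[symmetric] funpow_swap1)

end

locale dist_space_pair =
  big: dist_space r e' + small: dist_space r e
  for r :: nat and e' :: "'c::banach \<Rightarrow> 'd::finite dist" and e :: "'b::banach \<Rightarrow> 'd dist" +
  assumes nested: "nested e' e" and pd: "\<And>i. pd_bounded r i e' e"
begin

abbreviation "\<iota> \<equiv> incl e' e"

lemma e_incl: "e (\<iota> x) = e' x"
  unfolding incl_def using nested by (intro small.e_inv) (auto simp: nested_def)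

lemma norm_incl_le: "norm (\<iota> x) \<le> norm x"
  using nested by (auto simp: incl_def nested_def dnorm_def[symmetric] big.dnorm_e)


lemma bounded_linear_incl: "bounded_linear \<iota>"
proof (rule bounded_linear_intro[of _ 1])
  show "\<iota> (x + y) = \<iota> x + \<iota> y" for x y
    by (rule small.e_eqI) (simp add: e_incl small.e_add big.e_add)
  show "\<iota> (c *\<^sub>R x) = c *\<^sub>R \<iota> x" for c x
    by (rule small.e_eqI) (simp add: e_incl small.e_scale big.e_scale)
qed (simp add: norm_incl_le)

lemma pd_op: "bounded_linear (pd_op r e' e i)" "is_dpd r i (e' x) (e (pd_op r e' e i x))"
    "e (pd_op r e' e i x) = dpd r i (e' x)"
proof -
  obtain M where M: "bounded_linear M" "\<And>h. is_dpd r i (e' h) (e (M h))"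
    using pd[of i] by (auto simp: pd_bounded_def)
  have "pd_op r e' e i = M"
    by (auto simp: pd_op_def dpd_eqI[OF M(2)] small.inv_e)
  with M show "bounded_linear (pd_op r e' e i)" "is_dpd r i (e' x) (e (pd_op r e' e i x))" by auto
  then show "e (pd_op r e' e i x) = dpd r i (e' x)" by (simp add: dpd_eqI)
qed

lemma e_pd_op: "\<phi> \<in> CT (Suc r) \<Longrightarrow> e (pd_op r e' e i x) \<phi> = - e' x (pd i \<phi>)"
  using pd_op(2) by (auto simp: is_dpd_def)

lemma pd_op_mean_zero: "e (pd_op r e' e i x) one_fun = 0"
  by (simp add: e_pd_op pd_const big.e_test_zero)

lemma incl_smooth_elements: "\<iota> ` smooth_elements r e' \<subseteq> smooth_elements r e"
  by (auto simp: smooth_elements_def e_incl)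

lemma dense_incl_smooth_elements: "closure (\<iota> ` smooth_elements r e') = UNIV"
proof -
  have "smooth_elements r e \<subseteq> \<iota> ` smooth_elements r e'"
  proof
    fix h assume "h \<in> smooth_elements r e"
    then obtain \<phi> where \<phi>: "\<phi> \<in> CT r" "e h = fun_dist r \<phi>" by (auto simp: smooth_elements_def)
    let ?x = "inv e' (fun_dist r \<phi>)"
    have x: "e' ?x = fun_dist r \<phi>" using \<phi>(1) by (intro big.e_inv big.fun_dist_in_range)
    then have "\<iota> ?x = h" using \<phi>(2) by (intro small.e_eqI) (simp add: e_incl)
    moreover have "?x \<in> smooth_elements r e'" using x \<phi>(1) by (auto simp: smooth_elements_def)
    ultimately show "h \<in> \<iota> ` smooth_elements r e'" by blast
  qed
  then have "closure (smooth_elements r e) \<subseteq> closure (\<iota> ` smooth_elements r e')" by (rule closure_mono)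
  then show ?thesis using small.dense_smooth_elements by (metis top.extremum_uniqueI)
qed

end

section \<open>Linear and quadratic response of the invariant density\<close>

text \<open>
  The maps \<open>T\<^bsub>\<nu>,h\<^esub>\<close> depend on \<open>(\<nu>, h)\<close> through the single number \<open>u = \<nu> h(\<alpha>)\<close>.
\<close>

definition shifted_map :: "(real ^ 'd \<Rightarrow> real ^ 'd) \<Rightarrow> (real ^ 'd \<Rightarrow> real ^ 'd) \<Rightarrow> real \<Rightarrow> real ^ 'd \<Rightarrow> real ^ 'd" where
  "shifted_map T \<beta> u x = T x + u *\<^sub>R \<beta> x"

locale transfer_family = dist_space r e
  for r :: nat and e :: "'b::banach \<Rightarrow> 'd::finite dist" +
  fixes T \<beta> :: "real ^ 'd \<Rightarrow> real ^ 'd" and J :: "real set" and M :: real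
  assumes convex_J: "convex J"
    and T_cont: "continuous_on UNIV T"
    and \<beta>_smooth: "\<And>k i. (\<lambda>x. \<beta> x $ i) \<in> CT k"
    and torus_map: "\<And>u. u \<in> J \<Longrightarrow> torus_map r (shifted_map T \<beta> u)"
    and transfer: "\<And>u. u \<in> J \<Longrightarrow> transfer_bounded r (shifted_map T \<beta> u) e"
    and mult: "\<exists>s C. mult_bounded r s C e"
    and power_bound: "\<And>u n x. u \<in> J \<Longrightarrow> norm ((transfer_op r e (shifted_map T \<beta> u) ^^ n) x) \<le> M * norm x"
    and M_nonneg: "M \<ge> 0"
begin

abbreviation "\<L> u \<equiv> transfer_op r e (shifted_map T \<beta> u)"
abbreviation "\<beta>_op k \<equiv> mult_op r e (\<lambda>x. \<beta> x $ k)"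

lemma bounded_linear_\<L>: "u \<in> J \<Longrightarrow> bounded_linear (\<L> u)"
  by (rule transfer_op(1)[OF transfer])

lemma e_\<L>: "u \<in> J \<Longrightarrow> \<phi> \<in> CT r \<Longrightarrow> e (\<L> u x) \<phi> = e x (\<lambda>y. \<phi> (shifted_map T \<beta> u y))"
  by (rule e_transfer_op[OF transfer])

lemma norm_\<L>_le: "u \<in> J \<Longrightarrow> norm (\<L> u x) \<le> M * norm x"
  using power_bound[of u 1 x] by simp

lemma mean_\<L>: "u \<in> J \<Longrightarrow> e (\<L> u x) one_fun = e x one_fun"
  by (simp add: e_\<L>)

lemma CT_shifted: "u \<in> J \<Longrightarrow> \<phi> \<in> CT r \<Longrightarrow> (\<lambda>y. \<phi> (shifted_map T \<beta> u y)) \<in> CT r"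
  by (rule CT_compose[OF _ torus_map])

lemma bounded_linear_\<beta>_op: "bounded_linear (\<beta>_op k)"
  using mult mult_op(1) \<beta>_smooth by blast

lemma \<beta>_op_dist: "e (\<beta>_op k x) = dmult r (\<lambda>x. \<beta> x $ k) (e x)"
  using mult mult_op(2) \<beta>_smooth by blast

lemma e_\<beta>_op: "\<phi> \<in> CT r \<Longrightarrow> e (\<beta>_op k x) \<phi> = e x (\<lambda>y. \<beta> y $ k * \<phi> y)"
  by (simp add: \<beta>_op_dist dmult_def)

lemma continuous_\<beta>: "continuous_on UNIV \<beta>"
  using CT_continuous[OF \<beta>_smooth]
  by (subst continuous_on_componentwise) (auto simp: Basis_vec_def inner_axis)

definition one_elt :: 'b where
  "one_elt = inv e (fun_dist r one_fun)"

lemma e_one_elt: "e one_elt = fun_dist r one_fun"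
  unfolding one_elt_def by (intro e_inv fun_dist_in_range) simp

lemma mean_one_elt: "e one_elt one_fun = 1"
proof -
  have "(LINT x:cbox 0 (1 :: real ^ 'd)|lborel. 1 :: real) = integral (cbox 0 (1 :: real ^ 'd)) (\<lambda>x. 1)"
    by (rule integral_cube_eq) simp
  also have "\<dots> = 1" by (subst integral_const) (simp add: content_cbox_cart interval_ne_empty_cart)
  finally show ?thesis by (simp add: e_one_elt fun_dist_def)
qed

lemma nonneg_one_elt: "dist_nonneg r (e one_elt)"
  by (auto simp: dist_nonneg_def e_one_elt fun_dist_def set_lebesgue_integral_def intro!: integral_nonneg_AE)

lemma nonneg_\<L>: "u \<in> J \<Longrightarrow> dist_nonneg r (e x) \<Longrightarrow> dist_nonneg r (e (\<L> u x))"
  using CT_shifted by (auto simp: dist_nonneg_def e_\<L>)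

end

locale mixing_transfer_family = transfer_family r e T \<beta> J M
  for r :: nat and e :: "'b::banach \<Rightarrow> 'd::finite dist" and T \<beta> J M +
  fixes \<theta> :: real and N :: nat
  assumes contract: "\<And>u n x. u \<in> J \<Longrightarrow> e x one_fun = 0 \<Longrightarrow> n \<ge> N \<Longrightarrow>
      norm ((transfer_op r e (shifted_map T \<beta> u) ^^ n) x) \<le> \<theta> ^ n * norm x"
    and \<theta>: "0 < \<theta>" "\<theta> < 1"
begin

sublocale mixing_family J \<L> "\<lambda>x. e x one_fun" one_elt M \<theta> N
  by (rule mixing_family.intro)
    (auto intro: bounded_linear_\<L> bounded_linear_eval mean_\<L> power_bound contract \<theta> mean_one_elt M_nonneg)

text \<open>Positivity passes to the limit of the iterates of the constant density.\<close>

lemma nonneg_dens: "u \<in> J \<Longrightarrow> dist_nonneg r (e (dens u))"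
  unfolding dist_nonneg_def
proof (intro ballI impI)
  fix \<phi> :: "real ^ 'd \<Rightarrow> real" assume u: "u \<in> J" and \<phi>: "\<phi> \<in> CT r" "\<forall>x. 0 \<le> \<phi> x"
  have nn: "dist_nonneg r (e ((\<L> u ^^ n) one_elt))" for n
    by (induction n) (auto simp: nonneg_one_elt nonneg_\<L> u)
  have "(\<lambda>n. e ((\<L> u ^^ n) one_elt) \<phi>) \<longlonglongrightarrow> e (dens u) \<phi>"
    by (rule bounded_linear.tendsto[OF bounded_linear_eval pow_tendsto_dens[OF u]])
  then show "0 \<le> e (dens u) \<phi>"
    by (rule LIMSEQ_le_const) (use nn \<phi> in \<open>auto simp: dist_nonneg_def\<close>)
qed

end

locale transfer_family_pair =
  dist_space_pair r e' e + big: transfer_family r e' T \<beta> J M + small: transfer_family r e T \<beta> J M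
  for r :: nat and e' :: "'c::banach \<Rightarrow> 'd::finite dist" and e :: "'b::banach \<Rightarrow> 'd dist" and T \<beta> J M
begin

text \<open>
  The map \<open>h \<mapsto> div (L\<^sub>u (\<beta> h))\<close>, which is minus the derivative of \<open>u \<mapsto> L\<^sub>u h\<close>.
\<close>

definition drift :: "real \<Rightarrow> 'c \<Rightarrow> 'b" where
  "drift u x = (\<Sum>k\<in>UNIV. pd_op r e' e k (big.\<L> u (big.\<beta>_op k x)))"

definition drift_bound :: real where
  "drift_bound = (\<Sum>k\<in>UNIV. onorm (pd_op r e' e k) * (M * onorm (big.\<beta>_op k)))"

lemma bounded_linear_drift: "u \<in> J \<Longrightarrow> bounded_linear (drift u)"
  unfolding drift_def[abs_def]
  by (intro bounded_linear_sum bounded_linear_compose[OF pd_op(1)]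
      bounded_linear_compose[OF big.bounded_linear_\<L>] big.bounded_linear_\<beta>_op)

lemma norm_drift_le:
  assumes u: "u \<in> J" shows "norm (drift u x) \<le> drift_bound * norm x"
proof -
  have "norm (pd_op r e' e k (big.\<L> u (big.\<beta>_op k x)))
      \<le> onorm (pd_op r e' e k) * (M * onorm (big.\<beta>_op k)) * norm x" for k
  proof -
    have "norm (pd_op r e' e k (big.\<L> u (big.\<beta>_op k x)))
        \<le> onorm (pd_op r e' e k) * norm (big.\<L> u (big.\<beta>_op k x))"
      by (rule onorm[OF pd_op(1)])
    also have "\<dots> \<le> onorm (pd_op r e' e k) * (M * (onorm (big.\<beta>_op k) * norm x))"
      by (intro mult_left_mono order_trans[OF big.norm_\<L>_le[OF u]] onorm[OF big.bounded_linear_\<beta>_op]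
          big.M_nonneg onorm_pos_le[OF pd_op(1)])
    finally show ?thesis by (simp add: ac_simps)
  qed
  then show ?thesis
    unfolding drift_def drift_bound_def sum_distrib_right by (intro sum_norm_le) auto
qed

lemma mean_drift: "e (drift u x) one_fun = 0"
  by (simp add: drift_def small.e_sum pd_op_mean_zero)

lemma incl_\<L>: "u \<in> J \<Longrightarrow> \<iota> (big.\<L> u x) = small.\<L> u (\<iota> x)"
  by (rule small.e_eqI) (simp add: e_incl small.e_\<L> big.e_\<L>)

lemma incl_\<beta>_op: "\<iota> (big.\<beta>_op k x) = small.\<beta>_op k (\<iota> x)"
  by (rule small.e_eqI) (simp add: e_incl small.e_\<beta>_op big.e_\<beta>_op)

text \<open>
  For a smooth density \<open>f0\<close> and a smooth test function \<open>\<phi>\<close> both sides are integrals over the cube,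
  and the claim is the chain rule followed by an integration by parts, which is the definition of the
  distributional derivative.
\<close>

lemma weak_derivative:
  assumes f: "f \<in> smooth_elements r e'" and l: "l \<in> smooth_tests r e" and u: "u \<in> J"
  shows "((\<lambda>u. blinfun_apply l (small.\<L> u (\<iota> f))) has_real_derivative
     - blinfun_apply l (drift u f)) (at u within J)"
proof -
  obtain f0 where f0: "f0 \<in> CT r" "e' f = fun_dist r f0" using f by (auto simp: smooth_elements_def)
  obtain \<phi> where \<phi>: "\<phi> \<in> CT (Suc r)" "\<And>h. blinfun_apply l h = e h \<phi>"
    using l by (auto simp: smooth_tests_def)
  have \<phi>r: "\<phi> \<in> CT r" using \<phi>(1) by (rule CT_mono) simp
  have f0c: "continuous_on A f0" for A by (rule CT_continuous[OF f0(1)])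
  have int: "e' f \<psi> = integral (cbox 0 1) (\<lambda>x. \<psi> x * f0 x)" if "\<psi> \<in> CT r" for \<psi>
    unfolding f0(2) using that
    by (simp add: fun_dist_def integral_cube_eq continuous_on_mult CT_continuous[OF that] f0c)
  have 1: "blinfun_apply l (small.\<L> v (\<iota> f)) = integral (cbox 0 1) (\<lambda>x. \<phi> (T x + v *\<^sub>R \<beta> x) * f0 x)"
    if v: "v \<in> J" for v
    using int[OF small.CT_shifted[OF v \<phi>r]]
    by (simp add: \<phi>(2) small.e_\<L> v \<phi>r e_incl shifted_map_def)
  have pdk: "pd k \<phi> \<in> CT r" for k by (rule CT_pd[OF \<phi>(1)])
  have "- blinfun_apply l (drift u f) =
      (\<Sum>k\<in>UNIV. e' f (\<lambda>x. \<beta> x $ k * pd k \<phi> (shifted_map T \<beta> u x)))"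
    by (simp add: \<phi>(2) drift_def small.e_sum e_pd_op \<phi>(1) big.e_\<L> u pdk big.e_\<beta>_op
        big.CT_shifted sum_negf)
  also have "\<dots> = (\<Sum>k\<in>UNIV. integral (cbox 0 1) (\<lambda>x. \<beta> x $ k * pd k \<phi> (T x + u *\<^sub>R \<beta> x) * f0 x))"
    using int[OF CT_mult[OF small.\<beta>_smooth big.CT_shifted[OF u pdk]]] by (simp add: shifted_map_def)
  finally have 2: "- blinfun_apply l (drift u f) =
      (\<Sum>k\<in>UNIV. integral (cbox 0 1) (\<lambda>x. \<beta> x $ k * pd k \<phi> (T x + u *\<^sub>R \<beta> x) * f0 x))" .
  have "Ck 1 \<phi>" using \<phi>(1) Ck_mono[of "Suc r" \<phi> 1] by (auto simp: CT_def simp del: Ck.simps)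
  from has_derivative_cube_integral[OF small.T_cont small.continuous_\<beta> f0c this, of u J]
  show ?thesis
    unfolding 2 by (rule has_field_derivative_transform_within[of _ _ _ _ 1]) (simp_all add: 1 u)
qed

sublocale weakly_differentiable J small.\<L> drift \<iota> "smooth_elements r e'" "smooth_tests r e" "max M drift_bound"
proof (rule weakly_differentiable.intro)
  show "norm (small.\<L> u y) \<le> max M drift_bound * norm y" if "u \<in> J" for u y
    using order_trans[OF small.norm_\<L>_le[OF that] mult_right_mono[of M "max M drift_bound"]] by simp
  show "norm (drift u x) \<le> max M drift_bound * norm x" if "u \<in> J" for u x
    using order_trans[OF norm_drift_le[OF that] mult_right_mono[of drift_bound "max M drift_bound"]] by simp
qed (auto simp: small.convex_J bounded_linear_incl small.bounded_linear_\<L> bounded_linear_drift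
      big.dense_smooth_elements dense_incl_smooth_elements small.dense_smooth_tests weak_derivative)

lemma drift_increment:
  "u \<in> J \<Longrightarrow> v \<in> J \<Longrightarrow> drift u x - drift v x =
    (\<Sum>k\<in>UNIV. pd_op r e' e k (big.\<L> u (big.\<beta>_op k x) - big.\<L> v (big.\<beta>_op k x)))"
  by (simp add: drift_def sum_subtractf bounded_linear.linear[OF pd_op(1)] linear_diff)

end

text \<open>
  Response theory for the invariant densities. The densities live in the smallest space \<open>e3\<close>; the
  first derivative exists in \<open>e1\<close> and belongs to \<open>e2\<close>, and the second order expansion holds in the
  norm of \<open>e0\<close> with a coefficient in \<open>e1\<close>.
\<close>

locale density_response =
  X3: mixing_transfer_family r e3 T \<beta> J M \<theta> N + X2: mixing_transfer_family r e2 T \<beta> J M \<theta> N +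
  X1: mixing_transfer_family r e1 T \<beta> J M \<theta> N + X0: transfer_family r e0 T \<beta> J M +
  P32: transfer_family_pair r e3 e2 T \<beta> J M + P21: transfer_family_pair r e2 e1 T \<beta> J M +
  P10: transfer_family_pair r e1 e0 T \<beta> J M
  for r :: nat and e0 :: "'b0::banach \<Rightarrow> 'd::finite dist" and e1 :: "'b1::banach \<Rightarrow> 'd dist"
    and e2 :: "'b2::banach \<Rightarrow> 'd dist" and e3 :: "'b3::banach \<Rightarrow> 'd dist" and T \<beta> J M \<theta> N
begin

abbreviation "i0 \<equiv> incl e1 e0"
abbreviation "i1 \<equiv> incl e2 e1"
abbreviation "i2 \<equiv> incl e3 e2"

lemma i1_pd_op: "i1 (pd_op r e3 e2 k x) = pd_op r e2 e1 k (i2 x)"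
  by (rule inj_onD[OF X1.inj_e]) (simp_all add: P21.e_incl P32.pd_op(3) P21.pd_op(3) P32.e_incl)

lemma i0_pd_op: "i0 (pd_op r e2 e1 k x) = pd_op r e1 e0 k (i1 x)"
  by (rule inj_onD[OF X0.inj_e]) (simp_all add: P10.e_incl P21.pd_op(3) P10.pd_op(3) P21.e_incl)

lemma i1_drift: "u \<in> J \<Longrightarrow> i1 (P32.drift u x) = P21.drift u (i2 x)"
  by (simp add: P32.drift_def P21.drift_def bounded_linear.linear[OF P21.bounded_linear_incl] linear_sum
      i1_pd_op P32.incl_\<L> P32.incl_\<beta>_op)

lemma i0_drift: "u \<in> J \<Longrightarrow> i0 (P21.drift u x) = P10.drift u (i1 x)"
  by (simp add: P21.drift_def P10.drift_def bounded_linear.linear[OF P10.bounded_linear_incl] linear_sum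
      i0_pd_op P21.incl_\<L> P21.incl_\<beta>_op)

lemma drift_tendsto:
  assumes "s \<in> J"
  shows "((\<lambda>u. P21.drift u x) \<longlongrightarrow> P21.drift s x) (at s within J)"
    "((\<lambda>u. P10.drift u y) \<longlongrightarrow> P10.drift s y) (at s within J)"
  unfolding P21.drift_def P10.drift_def
  by (intro tendsto_sum bounded_linear.tendsto[OF P21.pd_op(1)] bounded_linear.tendsto[OF P10.pd_op(1)]
      P32.strong_continuity P21.strong_continuity assms)+

text \<open>The second derivative \<open>h \<mapsto> \<Sum>\<^sub>i\<^sub>j \<partial>\<^sub>i \<partial>\<^sub>j L (\<beta>\<^sub>i \<beta>\<^sub>j h)\<close> of the transfer operator.\<close>

definition drift2 :: "real \<Rightarrow> 'b3 \<Rightarrow> 'b1" where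
  "drift2 s x = (\<Sum>k\<in>UNIV. pd_op r e2 e1 k (P32.drift s (X3.\<beta>_op k x)))"

lemma bounded_linear_drift2: "s \<in> J \<Longrightarrow> bounded_linear (drift2 s)"
  unfolding drift2_def[abs_def]
  by (intro bounded_linear_sum bounded_linear_compose[OF P21.pd_op(1)]
      bounded_linear_compose[OF P32.bounded_linear_drift] X3.bounded_linear_\<beta>_op)

definition second_order_bound :: "real \<Rightarrow> real" where
  "second_order_bound s = max (onorm (drift2 s))
     (\<Sum>k\<in>UNIV. onorm (pd_op r e2 e1 k) * (max M P32.drift_bound * onorm (X3.\<beta>_op k)))"

text \<open>
  The drift applied to an element of \<open>e3\<close> involves the transfer operator on \<open>e2\<close> at an element of \<open>e3\<close>,
  where it is Lipschitz, followed by one derivative into \<open>e1\<close>. This is what bounds the second order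
  remainder in the norm of \<open>e1\<close>.
\<close>

lemma drift_lipschitz:
  assumes s: "s \<in> J" and u: "u \<in> J"
  shows "norm (P21.drift u (i2 x) - P21.drift s (i2 x)) \<le> second_order_bound s * \<bar>u - s\<bar> * norm x"
proof -
  let ?b = "max M P32.drift_bound"
  let ?y = "\<lambda>k. X3.\<beta>_op k x"
  have b: "0 \<le> ?b" using X0.M_nonneg by simp
  have "norm (P21.drift u (i2 x) - P21.drift s (i2 x)) \<le>
      (\<Sum>k\<in>UNIV. onorm (pd_op r e2 e1 k) * (?b * onorm (X3.\<beta>_op k)) * (\<bar>u - s\<bar> * norm x))"
    unfolding P21.drift_increment[OF u s] P32.incl_\<beta>_op[symmetric]
  proof (rule sum_norm_le)
    fix k
    have "norm (pd_op r e2 e1 k (X2.\<L> u (i2 (?y k)) - X2.\<L> s (i2 (?y k)))) \<le>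
        onorm (pd_op r e2 e1 k) * (?b * \<bar>u - s\<bar> * (onorm (X3.\<beta>_op k) * norm x))"
      by (intro order_trans[OF onorm[OF P21.pd_op(1)]] order_trans[OF P32.lipschitz[OF s u]] mult_left_mono
          onorm[OF X3.bounded_linear_\<beta>_op] onorm_pos_le[OF P21.pd_op(1)] mult_nonneg_nonneg b abs_ge_zero)
    then show "norm (pd_op r e2 e1 k (X2.\<L> u (i2 (?y k)) - X2.\<L> s (i2 (?y k)))) \<le>
        onorm (pd_op r e2 e1 k) * (?b * onorm (X3.\<beta>_op k)) * (\<bar>u - s\<bar> * norm x)"
      by (simp add: ac_simps)
  qed
  also have "\<dots> = (\<Sum>k\<in>UNIV. onorm (pd_op r e2 e1 k) * (?b * onorm (X3.\<beta>_op k))) * (\<bar>u - s\<bar> * norm x)"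
    by (simp add: sum_distrib_right)
  also have "\<dots> \<le> second_order_bound s * (\<bar>u - s\<bar> * norm x)"
    by (intro mult_right_mono) (auto simp: second_order_bound_def)
  finally show ?thesis by (simp add: ac_simps)
qed

lemma twice_differentiable:
  assumes s: "s \<in> J"
  shows "twice_weakly_differentiable J X1.\<L> P21.drift i1 (smooth_elements r e2) (smooth_tests r e1)
     (max M P21.drift_bound) X0.\<L> P10.drift i0 (smooth_elements r e1) (smooth_tests r e0)
     (max M P10.drift_bound) i2 (smooth_elements r e3) s (drift2 s) (second_order_bound s)"
proof (intro twice_weakly_differentiable.intro twice_weakly_differentiable_axioms.intro
    P21.weakly_differentiable_axioms P10.weakly_differentiable_axioms)
  show "bounded_linear i2" by (rule P32.bounded_linear_incl)
  show "bounded_linear (drift2 s)" by (rule bounded_linear_drift2[OF s])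
  show "norm (drift2 s x) \<le> second_order_bound s * norm x" for x
    by (rule order_trans[OF onorm[OF bounded_linear_drift2[OF s]]])
       (auto simp: second_order_bound_def intro!: mult_right_mono)
  show "closure (smooth_elements r e3) = UNIV" by (rule X3.dense_smooth_elements)
  show "i2 ` smooth_elements r e3 \<subseteq> smooth_elements r e2" by (rule P32.incl_smooth_elements)
  then show "i1 ` i2 ` smooth_elements r e3 \<subseteq> smooth_elements r e1"
    using P21.incl_smooth_elements by blast
  show "s \<in> J" by (rule s)
  show "i0 (X1.\<L> u x) = X0.\<L> u (i0 x)" if "u \<in> J" for u x by (rule P10.incl_\<L>[OF that])
  show "i0 (P21.drift u x) = P10.drift u (i1 x)" if "u \<in> J" for u x by (rule i0_drift[OF that])
  show "norm (P21.drift u (i2 x) - P21.drift s (i2 x)) \<le> second_order_bound s * \<bar>u - s\<bar> * norm x"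
    if "u \<in> J" for u x by (rule drift_lipschitz[OF s that])
  fix x
  let ?y = "i1 (i2 x)"
  have lim: "((\<lambda>u. \<Sum>k\<in>UNIV. pd_op r e1 e0 k
        ((1 / (u - s)) *\<^sub>R (X1.\<L> u (i1 (X2.\<beta>_op k (i2 x))) - X1.\<L> s (i1 (X2.\<beta>_op k (i2 x))))))
      \<longlongrightarrow> (\<Sum>k\<in>UNIV. pd_op r e1 e0 k (- P21.drift s (X2.\<beta>_op k (i2 x))))) (at s within J)"
    by (intro tendsto_sum bounded_linear.tendsto[OF P10.pd_op(1)] P21.strong_derivative drift_tendsto s)
  have "(\<Sum>k\<in>UNIV. pd_op r e1 e0 k (- P21.drift s (X2.\<beta>_op k (i2 x)))) = - i0 (drift2 s x)"
    by (simp add: drift2_def bounded_linear.linear[OF P10.bounded_linear_incl] linear_sum i0_pd_op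
        i1_drift s P32.incl_\<beta>_op bounded_linear.linear[OF P10.pd_op(1)] linear_neg sum_negf)
  with lim have lim: "((\<lambda>u. \<Sum>k\<in>UNIV. pd_op r e1 e0 k
        ((1 / (u - s)) *\<^sub>R (X1.\<L> u (i1 (X2.\<beta>_op k (i2 x))) - X1.\<L> s (i1 (X2.\<beta>_op k (i2 x))))))
      \<longlongrightarrow> - i0 (drift2 s x)) (at s within J)" by simp
  show "((\<lambda>u. (1 / (u - s)) *\<^sub>R (P10.drift u ?y - P10.drift s ?y)) \<longlongrightarrow> - i0 (drift2 s x)) (at s within J)"
    by (rule Lim_transform_eventually[OF lim])
       (auto simp: eventually_at_filter P10.drift_increment s P21.incl_\<beta>_op scaleR_sum_right
         linear_cmul[OF bounded_linear.linear[OF P10.pd_op(1)]] intro!: always_eventually)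
qed

lemma incl_dens: "u \<in> J \<Longrightarrow> i2 (X3.dens u) = X2.dens u" "u \<in> J \<Longrightarrow> i1 (X2.dens u) = X1.dens u"
  by (auto intro!: X2.dens_unique X1.dens_unique
      simp: P32.e_incl P21.e_incl X3.dens_mean X2.dens_mean X3.dens_fixed X2.dens_fixed
        simp flip: P32.incl_\<L> P21.incl_\<L>)

lemma incl_res:
  assumes u: "u \<in> J" and f: "e2 f one_fun = 0"
  shows "i1 (X2.res u f) = X1.res u (i1 f)"
proof (rule X1.res_unique[OF u, symmetric])
  show "e1 (i1 (X2.res u f)) one_fun = 0" by (simp add: P21.e_incl X2.mean_res u f)
  have "i1 (X2.res u f) - X1.\<L> u (i1 (X2.res u f)) = i1 (X2.res u f - X2.\<L> u (X2.res u f))"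
    by (simp add: P21.incl_\<L> u linear_diff bounded_linear.linear[OF P21.bounded_linear_incl])
  then show "i1 (X2.res u f) - X1.\<L> u (i1 (X2.res u f)) = i1 f" by (simp add: X2.res_eq u f)
qed

text \<open>
  The first two coefficients of the expansion of the density. The linear response is needed twice: in
  \<open>e1\<close>, where it is the derivative of the density, and in \<open>e2\<close>, where the drift can be applied to it.
\<close>

definition response2 :: "real \<Rightarrow> 'b2" where
  "response2 s = X2.res s (- P32.drift s (X3.dens s))"

definition response :: "real \<Rightarrow> 'b1" where
  "response s = X1.res s (- P21.drift s (X2.dens s))"

definition quadratic_response :: "real \<Rightarrow> 'b1" where
  "quadratic_response s = X1.res s ((1 / 2) *\<^sub>R drift2 s (X3.dens s) - P21.drift s (response2 s))"

lemma mean_drift2: "e1 (drift2 s x) one_fun = 0"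
  by (simp add: drift2_def X1.e_sum P21.pd_op_mean_zero)

lemma i1_response2: "s \<in> J \<Longrightarrow> i1 (response2 s) = response s"
  unfolding response2_def response_def
  by (subst incl_res)
     (simp_all add: X2.e_minus P32.mean_drift linear_neg bounded_linear.linear[OF P21.bounded_linear_incl]
       i1_drift incl_dens)

lemma mean_response: "s \<in> J \<Longrightarrow> e1 (response s) one_fun = 0"
  unfolding response_def by (intro X1.mean_res) (auto simp: X1.e_minus P21.mean_drift)

lemma response_eq: "s \<in> J \<Longrightarrow> response s - X1.\<L> s (response s) = - P21.drift s (X2.dens s)"
  unfolding response_def by (intro X1.res_eq) (auto simp: X1.e_minus P21.mean_drift)

lemma mean_quadratic_source:
  "e1 ((1 / 2) *\<^sub>R drift2 s x - P21.drift s y) one_fun = 0"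
  by (simp add: X1.e_diff X1.e_scale P21.mean_drift mean_drift2)

text \<open>
  The increment of the density is the resolvent applied to the increment of the operator; the latter
  has a derivative in \<open>e1\<close> because the density belongs to \<open>e2\<close>.
\<close>

theorem density_derivative:
  assumes s: "s \<in> J"
  shows "((\<lambda>t. (1 / (t - s)) *\<^sub>R (X1.dens t - X1.dens s)) \<longlongrightarrow> response s) (at s within J)"
  unfolding response_def
proof (rule X1.dens_derivative[OF s])
  show "((\<lambda>t. X1.\<L> t x) \<longlongrightarrow> X1.\<L> s x) (at s within J)" for x by (rule P21.strong_continuity[OF s])
  show "((\<lambda>t. (1 / (t - s)) *\<^sub>R (X1.\<L> t (X1.dens s) - X1.\<L> s (X1.dens s)))
      \<longlongrightarrow> - P21.drift s (X2.dens s)) (at s within J)"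
    using P21.strong_derivative[OF s drift_tendsto(1)[OF s], of "X2.dens s"] by (simp add: incl_dens s)
qed (simp add: X1.e_minus P21.mean_drift)

text \<open>
  Applying \<open>Id - L\<^sub>t\<close> to the remainder of the expansion gives \<open>(t - s)\<^sup>2 Z t\<close>. The three parts of \<open>Z t\<close>
  are the second order remainder of the transfer operator at \<open>h\<close>, the first order remainder at the
  response \<open>\<Theta>\<close>, and an increment at the coefficient \<open>Y\<close>. The last two tend to zero in \<open>e1\<close>. The first
  is only bounded there and tends to zero in \<open>e0\<close>, so that the weak continuity of the resolvent on
  bounded families is needed.
\<close>

theorem density_second_order:
  assumes s: "s \<in> J"
  shows "((\<lambda>t. (1 / (t - s)\<^sup>2) *\<^sub>R i0 (X1.dens t - X1.dens s - (t - s) *\<^sub>R response s))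
     \<longlongrightarrow> i0 (quadratic_response s)) (at s within J)"
proof -
  interpret W: twice_weakly_differentiable J X1.\<L> P21.drift i1 "smooth_elements r e2" "smooth_tests r e1"
     "max M P21.drift_bound" X0.\<L> P10.drift i0 "smooth_elements r e1" "smooth_tests r e0"
     "max M P10.drift_bound" i2 "smooth_elements r e3" s "drift2 s" "second_order_bound s"
    by (rule twice_differentiable[OF s])
  interpret i0: bounded_linear i0 by (rule P10.bounded_linear_incl)
  define h where "h = X3.dens s"
  define \<Theta> where "\<Theta> = response s"
  define Y where "Y = quadratic_response s"
  define X where "X = (1 / 2) *\<^sub>R drift2 s h - P21.drift s (response2 s)"
  have Y: "Y - X1.\<L> s Y = X" "e1 Y one_fun = 0"
    using X1.res_eq[OF s mean_quadratic_source] X1.mean_res[OF s mean_quadratic_source]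
    by (auto simp: Y_def quadratic_response_def X_def h_def)
  have h1: "i1 (i2 h) = X1.dens s" "i2 h = X2.dens s" by (simp_all add: h_def incl_dens s)
  have \<Theta>: "\<Theta> - X1.\<L> s \<Theta> = - P21.drift s (X2.dens s)" "i1 (response2 s) = \<Theta>" "e1 \<Theta> one_fun = 0"
    by (simp_all add: \<Theta>_def response_eq i1_response2 mean_response s)
  define Z1 where "Z1 t = (1 / (t - s)\<^sup>2) *\<^sub>R W.remainder t h" for t
  define Z2 where "Z2 t = (1 / (t - s)) *\<^sub>R (X1.\<L> t \<Theta> - X1.\<L> s \<Theta>) + P21.drift s (response2 s)" for t
  define Z3 where "Z3 t = X1.\<L> t Y - X1.\<L> s Y" for t
  define Z where "Z t = Z1 t + Z2 t + Z3 t" for t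
  have Z2: "(Z2 \<longlongrightarrow> 0) (at s within J)"
    using tendsto_add[OF P21.strong_derivative[OF s drift_tendsto(1)[OF s], of "response2 s"]
        tendsto_const[of "P21.drift s (response2 s)"]]
    by (simp add: Z2_def[abs_def] \<Theta>(2))
  have Z3: "(Z3 \<longlongrightarrow> 0) (at s within J)"
    using P21.strong_continuity[OF s, of Y] by (simp add: Z3_def[abs_def] LIM_zero)
  have iZ1: "((\<lambda>t. i0 (Z1 t)) \<longlongrightarrow> 0) (at s within J)"
    using W.remainder_tendsto[of h] by (simp add: Z1_def i0.scaleR)
  have Jt: "\<forall>\<^sub>F t in at s within J. t \<in> J \<and> t \<noteq> s" by (simp add: eventually_at_filter)
  have Z1b: "\<forall>\<^sub>F t in at s within J. norm (Z1 t) \<le> 2 * second_order_bound s * norm h"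
    using Jt
  proof eventually_elim
    case (elim t)
    have "norm (Z1 t) = norm (W.remainder t h) / (t - s)\<^sup>2" by (simp add: Z1_def)
    also have "\<dots> \<le> 2 * second_order_bound s * norm h"
      using W.norm_remainder_le[of t h] elim by (simp add: pos_divide_le_eq ac_simps)
    finally show ?case .
  qed
  have Zmean: "e1 (Z t) one_fun = 0" if t: "t \<in> J" "t \<noteq> s" for t
    using t s
    by (simp add: Z_def Z1_def Z2_def Z3_def W.remainder_def X1.e_add X1.e_diff X1.e_scale X1.mean_\<L>
        P21.mean_drift mean_drift2)
  have lim: "((\<lambda>t. i0 (X1.res t (Z t))) \<longlongrightarrow> 0) (at s within J)"
  proof (rule X1.res_tendsto_zero_weak[where ?L0.0=X0.\<L> and ?M0.0=M and B="2 * second_order_bound s * norm h + 1 + 1"])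
    show "\<forall>\<^sub>F t in at s within J. e1 (Z t) one_fun = 0 \<and> norm (Z t) \<le> 2 * second_order_bound s * norm h + 1 + 1"
      using Jt Z1b tendstoD[OF Z2, of 1, simplified] tendstoD[OF Z3, of 1, simplified]
    proof eventually_elim
      case (elim t)
      have "norm (Z t) \<le> norm (Z1 t) + norm (Z2 t) + norm (Z3 t)"
        unfolding Z_def by (intro norm_triangle_le add_mono norm_triangle_ineq) auto
      then show ?case using elim Zmean[of t] by auto
    qed
    have "((\<lambda>t. i0 (Z1 t) + i0 (Z2 t) + i0 (Z3 t)) \<longlongrightarrow> 0 + i0 0 + i0 0) (at s within J)"
      by (intro tendsto_intros iZ1 i0.tendsto Z2 Z3)
    then show "((\<lambda>t. i0 (Z t)) \<longlongrightarrow> 0) (at s within J)" by (simp add: Z_def i0.add i0.zero)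
  qed (use Jt in \<open>auto simp: P10.bounded_linear_incl P10.incl_\<L> X0.power_bound elim: eventually_mono\<close>)
  have eq: "X1.res t (Z t) = (1 / (t - s)\<^sup>2) *\<^sub>R (X1.dens t - X1.dens s - (t - s) *\<^sub>R \<Theta>) - Y"
    if t: "t \<in> J" "t \<noteq> s" for t
  proof (rule X1.res_unique[OF t(1)])
    let ?w = "X1.dens t - X1.dens s - (t - s) *\<^sub>R \<Theta>"
    interpret Lt: bounded_linear "X1.\<L> t" by (rule X1.bounded_linear_\<L>[OF t(1)])
    show "e1 ((1 / (t - s)\<^sup>2) *\<^sub>R ?w - Y) one_fun = 0"
      using t s Y \<Theta> by (simp add: X1.e_diff X1.e_scale X1.dens_mean)
    have w: "?w - X1.\<L> t ?w = W.remainder t h + ((t - s)\<^sup>2 / 2) *\<^sub>R drift2 s h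
        + (t - s) *\<^sub>R (X1.\<L> t \<Theta> - X1.\<L> s \<Theta>)"
    proof -
      have a: "X1.\<L> t ?w = X1.dens t - X1.\<L> t (X1.dens s) - (t - s) *\<^sub>R X1.\<L> t \<Theta>"
        by (simp add: Lt.diff Lt.scaleR X1.dens_fixed t)
      have b: "(t - s) *\<^sub>R \<Theta> = (t - s) *\<^sub>R X1.\<L> s \<Theta> - (t - s) *\<^sub>R P21.drift s (X2.dens s)"
      proof -
        have "X1.\<L> s \<Theta> - P21.drift s (X2.dens s) = \<Theta>" using \<Theta>(1) by (simp add: algebra_simps)
        then show ?thesis by (simp only: scaleR_right_diff_distrib[symmetric])
      qed
      show ?thesis
        unfolding a unfolding b W.remainder_def h1(2) incl_dens(2)[OF s] X1.dens_fixed[OF s]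
        by (simp add: algebra_simps)
    qed
    have "(1 / (t - s)\<^sup>2) *\<^sub>R ?w - Y - X1.\<L> t ((1 / (t - s)\<^sup>2) *\<^sub>R ?w - Y)
        = (1 / (t - s)\<^sup>2) *\<^sub>R (?w - X1.\<L> t ?w) - (Y - X1.\<L> t Y)"
      by (simp add: Lt.diff Lt.scaleR scaleR_right_diff_distrib)
    also have "\<dots> = Z1 t + (1 / 2) *\<^sub>R drift2 s h + (1 / (t - s)) *\<^sub>R (X1.\<L> t \<Theta> - X1.\<L> s \<Theta>) - (Y - X1.\<L> t Y)"
      unfolding w using t by (simp add: Z1_def scaleR_add_right power2_eq_square)
    also have "Y - X1.\<L> t Y = X - Z3 t" using Y(1) by (simp add: Z3_def algebra_simps)
    finally show "(1 / (t - s)\<^sup>2) *\<^sub>R ?w - Y - X1.\<L> t ((1 / (t - s)\<^sup>2) *\<^sub>R ?w - Y) = Z t"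
      by (simp add: Z_def Z2_def X_def algebra_simps)
  qed
  have "((\<lambda>t. i0 ((1 / (t - s)\<^sup>2) *\<^sub>R (X1.dens t - X1.dens s - (t - s) *\<^sub>R \<Theta>) - Y)) \<longlongrightarrow> 0) (at s within J)"
  proof (rule Lim_transform_eventually[OF lim])
    show "\<forall>\<^sub>F t in at s within J. i0 (X1.res t (Z t)) =
        i0 ((1 / (t - s)\<^sup>2) *\<^sub>R (X1.dens t - X1.dens s - (t - s) *\<^sub>R \<Theta>) - Y)"
      by (rule eventually_mono[OF Jt]) (elim conjE, rule arg_cong[OF eq])
  qed
  then show ?thesis
    by (simp add: i0.diff i0.scaleR LIM_zero_iff \<Theta>_def Y_def)
qed

end

section \<open>Reduction of the fixed point problem to a scalar equation\<close>

text \<open>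
  By the Sherman-Morrison formula, \<open>Id - c l(\<cdot>) v\<close> has the inverse \<open>Id + d l(\<cdot>) v\<close> with
  \<open>d = c / (1 - c l(v))\<close>; and if \<open>c l(v) = 1\<close>, then \<open>v\<close> lies in the kernel.
\<close>

lemma invertible_on_rank_one_perturbation:
  fixes v :: "'b::real_normed_vector" and c :: real
  assumes m: "bounded_linear m" and l: "bounded_linear l" and v: "m v = (0::real)"
  defines "V \<equiv> {x. m x = 0}" and "A \<equiv> (\<lambda>x. x - (c * l x) *\<^sub>R v)"
  shows "invertible_on V A \<longleftrightarrow> c * l v \<noteq> (1::real)"
proof
  interpret m: bounded_linear m by (rule m)
  interpret l: bounded_linear l by (rule l)
  assume inv: "invertible_on V A"
  show "c * l v \<noteq> 1"
  proof
    assume 1: "c * l v = 1"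
    then have "A v = A 0" by (simp add: A_def l.zero)
    moreover have "inj_on A V" using inv by (auto simp: invertible_on_def bij_betw_def)
    moreover have "v \<in> V" "0 \<in> V" using v by (auto simp: V_def m.zero)
    ultimately have "v = 0" by (auto dest: inj_onD)
    then show False using 1 by (simp add: l.zero)
  qed
next
  interpret m: bounded_linear m by (rule m)
  interpret l: bounded_linear l by (rule l)
  assume ne: "c * l v \<noteq> 1"
  define d where "d = c / (1 - c * l v)"
  have d: "d - c - c * d * l v = 0" using ne by (simp add: d_def field_simps)
  define B where "B x = x + (d * l x) *\<^sub>R v" for x
  have AB: "A (B x) = x" for x
  proof -
    have "A (B x) = x + ((d - c - c * d * l v) * l x) *\<^sub>R v"
      by (simp add: A_def B_def l.add l.scaleR algebra_simps)
    then show ?thesis by (simp add: d)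
  qed
  have BA: "B (A x) = x" for x
  proof -
    have "B (A x) = x + ((d - c - c * d * l v) * l x) *\<^sub>R v"
      by (simp add: A_def B_def l.diff l.scaleR algebra_simps)
    then show ?thesis by (simp add: d)
  qed
  have AV: "A x \<in> V" if "x \<in> V" for x using that v by (simp add: V_def A_def m.diff m.scaleR)
  have BV: "B x \<in> V" if "x \<in> V" for x using that v by (simp add: V_def B_def m.add m.scaleR)
  have bij: "bij_betw A V V"
    by (rule bij_betwI[of A V V B]) (auto simp: AB BA AV BV)
  have "inv_into V A x = B x" if "x \<in> V" for x
    using that bij AB BV by (intro inv_into_f_eq) (auto simp: bij_betw_def)
  moreover have "\<exists>C. \<forall>x\<in>V. norm (B x) \<le> C * norm x"
  proof -
    obtain K where K: "\<And>x. norm (l x) \<le> norm x * K" using l.bounded by blast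
    have "norm (B x) \<le> (1 + \<bar>d\<bar> * K * norm v) * norm x" for x
    proof -
      have "norm (B x) \<le> norm x + \<bar>d\<bar> * \<bar>l x\<bar> * norm v"
        unfolding B_def using norm_triangle_ineq[of x "(d * l x) *\<^sub>R v"] by (simp add: abs_mult)
      also have "\<dots> \<le> norm x + \<bar>d\<bar> * (norm x * K) * norm v"
        using K[of x] by (intro add_left_mono mult_right_mono mult_left_mono) auto
      finally show ?thesis by (simp add: algebra_simps)
    qed
    then show ?thesis by blast
  qed
  ultimately show "invertible_on V A" using bij by (auto simp: invertible_on_def)
qed

text \<open>
  The interval \<open>[a, b]\<close> contains every parameter \<open>\<nu> h(\<alpha>)\<close> that a nonnegative normalised \<open>h\<close> can
  produce, so that the family of transfer operators over \<open>[a, b]\<close> describes the whole problem.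
\<close>

locale self_consistent = density_response r e0 e1 e2 e3 T \<beta> "{a..b}" M \<theta> N
  for r :: nat and e0 :: "'b0::banach \<Rightarrow> 'd::finite dist" and e1 :: "'b1::banach \<Rightarrow> 'd dist"
    and e2 :: "'b2::banach \<Rightarrow> 'd dist" and e3 :: "'b3::banach \<Rightarrow> 'd dist" and T \<beta> a b M \<theta> N +
  fixes \<alpha> :: "real ^ 'd \<Rightarrow> real" and \<nu>s Ks :: real
  assumes ab: "a \<le> 0" "0 \<le> b" and \<nu>s: "\<nu>s > 0"
    and Ks: "M * norm X1.one_elt \<le> Ks"
    and parameter: "\<And>\<nu> h. \<nu> \<in> {0..\<nu>s} \<Longrightarrow> dist_nonneg r (e1 h) \<Longrightarrow> e1 h one_fun = 1 \<Longrightarrow> \<nu> * e1 h \<alpha> \<in> {a..b}"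
begin

abbreviation "J \<equiv> {a..b}"
abbreviation "S \<equiv> shifted_map T \<beta>"

lemma Tmap_eq: "Tmap T \<alpha> \<beta> \<nu> h = S (\<nu> * h \<alpha>)"
  by (auto simp: Tmap_def shifted_map_def)

lemma X1_transfer: "u \<in> J \<Longrightarrow> transfer r (S u) (e1 x) = e1 (X1.\<L> u x)"
  using X1.transfer_op(2)[OF X1.transfer] by simp

lemma X2_transfer: "u \<in> J \<Longrightarrow> transfer r (S u) (e2 x) = e2 (X2.\<L> u x)"
  using X2.transfer_op(2)[OF X2.transfer] by simp

lemma X3_transfer: "u \<in> J \<Longrightarrow> transfer r (S u) (e3 x) = e3 (X3.\<L> u x)"
  using X3.transfer_op(2)[OF X3.transfer] by simp

lemma transfer_fixed_iff:
  "u \<in> J \<Longrightarrow> e1 x one_fun = 1 \<Longrightarrow> transfer r (S u) (e1 x) = e1 x \<longleftrightarrow> x = X1.dens u"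
  by (metis X1.dens_fixed X1.dens_unique X1.inv_e X1_transfer)

lemma dens_in_W: "u \<in> J \<Longrightarrow> X1.dens u \<in> W_set r e1 Ks"
  using Ks X1.norm_dens_le by (auto simp: W_set_def X1.dens_mean X1.nonneg_dens intro: order_trans)

lemma H_fun_eq:
  assumes "\<nu> * e1 h \<alpha> \<in> J"
  shows "H_fun r T \<alpha> \<beta> e1 Ks \<nu> h = X1.dens (\<nu> * e1 h \<alpha>)"
  unfolding H_fun_def Tmap_eq
  using assms dens_in_W transfer_fixed_iff X1.dens_mean
  by (intro the_equality) (auto simp: W_set_def)

lemma W_parameter: "\<nu> \<in> {0..\<nu>s} \<Longrightarrow> h \<in> W_set r e1 Ks \<Longrightarrow> \<nu> * e1 h \<alpha> \<in> J"
  by (intro parameter) (auto simp: W_set_def)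

text \<open>
  A fixed point for \<open>\<nu>\<close> is the density at a parameter \<open>s\<close> that reproduces itself: \<open>s = \<nu> g s\<close>.
\<close>

definition g :: "real \<Rightarrow> real" where "g s = e1 (X1.dens s) \<alpha>"

lemma F_fun_zero_iff:
  assumes "\<nu> * e1 h \<alpha> \<in> J"
  shows "F_fun r T \<alpha> \<beta> e1 Ks \<nu> h = 0 \<longleftrightarrow> h = X1.dens (\<nu> * e1 h \<alpha>)"
  by (simp add: F_fun_def H_fun_eq[OF assms])

lemma resolvent_eq:
  assumes u: "u \<in> J" and f: "e1 f one_fun = 0"
  shows "resolvent r e1 (S u) (e1 f) = X1.res u f"
  unfolding resolvent_def
proof (rule the_equality)
  have *: "(\<lambda>\<phi>. e1 y \<phi> - transfer r (S u) (e1 y) \<phi>) = e1 (y - X1.\<L> u y)" for y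
    by (rule ext) (simp only: X1_transfer[OF u] X1.e_diff)
  show "X1.res u f \<in> V_set e1 \<and> (\<lambda>\<phi>. e1 (X1.res u f) \<phi> - transfer r (S u) (e1 (X1.res u f)) \<phi>) = e1 f"
    unfolding * by (simp add: V_set_def X1.mean_res[OF u f] X1.res_eq[OF u f])
  fix y assume "y \<in> V_set e1 \<and> (\<lambda>\<phi>. e1 y \<phi> - transfer r (S u) (e1 y) \<phi>) = e1 f"
  then have "e1 y one_fun = 0" "y - X1.\<L> u y = f"
    unfolding * using X1.inj_e by (auto simp: V_set_def dest: injD)
  then show "y = X1.res u f" by (simp add: X1.res_unique[OF u])
qed

lemma e1_dens: "u \<in> J \<Longrightarrow> e1 (X1.dens u) = e2 (X2.dens u)" "u \<in> J \<Longrightarrow> e1 (X1.dens u) = e3 (X3.dens u)"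
  by (metis P21.e_incl incl_dens(2), metis P21.e_incl P32.e_incl incl_dens)

lemma Theta_eq:
  assumes "\<nu> * e1 h \<alpha> \<in> J"
  shows "Theta r T \<alpha> \<beta> e1 Ks \<nu> h = response (\<nu> * e1 h \<alpha>)"
proof -
  define u where "u = \<nu> * e1 h \<alpha>"
  have u: "u \<in> J" using assms by (simp add: u_def)
  have "(\<lambda>\<phi>. \<Sum>i\<in>UNIV. dpd r i (transfer r (S u) (dmult r (\<lambda>x. \<beta> x $ i) (e1 (X1.dens u)))) \<phi>)
      = e1 (P21.drift u (X2.dens u))"
    by (rule ext) (simp only: P21.drift_def X1.e_sum P21.pd_op(3) X2_transfer[OF u, symmetric]
        X2.\<beta>_op_dist e1_dens(1)[OF u])
  then have "Theta r T \<alpha> \<beta> e1 Ks \<nu> h = - X1.res u (P21.drift u (X2.dens u))"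
    using resolvent_eq[OF u P21.mean_drift]
    by (simp add: Theta_def Let_def Tmap_eq H_fun_eq[OF assms] u_def[symmetric])
  also have "\<dots> = response u"
    using X1.res_scale[OF u P21.mean_drift, of "-1"] by (simp add: response_def)
  finally show ?thesis by (simp add: u_def)
qed

text \<open>
  The double sum is \<open>(Id - L)\<^sup>-\<^sup>1\<close> of the drift of \<open>(Id - L)\<^sup>-\<^sup>1\<close> of the drift of the density, that is, of
  minus the linear response; together with the second sum it makes up twice the quadratic
  response.
\<close>

lemma D2hF_eq:
  assumes "\<nu> * e1 h \<alpha> \<in> J"
  shows "D2hF r T \<alpha> \<beta> e1 Ks \<nu> h \<phi> \<psi> =
    - ((\<nu>\<^sup>2 * e1 \<phi> \<alpha> * e1 \<psi> \<alpha>) *\<^sub>R (2 *\<^sub>R quadratic_response (\<nu> * e1 h \<alpha>)))"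
proof -
  define u where "u = \<nu> * e1 h \<alpha>"
  have u: "u \<in> J" using assms by (simp add: u_def)
  let ?b = "\<lambda>i x. \<beta> x $ i" and ?L = "transfer r (S u)" and ?R = "resolvent r e1 (S u)"
  let ?H = "e1 (X1.dens u)" and ?h = "X3.dens u"
  define f where "f j = pd_op r e3 e2 j (X3.\<L> u (X3.\<beta>_op j ?h))" for j
  have fm: "e2 (f j) one_fun = 0" for j by (simp add: f_def P32.pd_op_mean_zero)
  have f_sum: "(\<Sum>j\<in>UNIV. f j) = P32.drift u ?h" by (simp add: f_def P32.drift_def)
  have "dpd r j (?L (dmult r (?b j) ?H)) = e1 (i1 (f j))" for j
    by (simp only: f_def P21.e_incl P32.pd_op(3) X3_transfer[OF u, symmetric] X3.\<beta>_op_dist e1_dens(2)[OF u])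
  then have "?R (dpd r j (?L (dmult r (?b j) ?H))) = i1 (X2.res u (f j))" for j
    using resolvent_eq[OF u, of "i1 (f j)"] fm[of j] by (simp add: incl_res[OF u fm] P21.e_incl)
  then have "dpd r i (?L (dmult r (?b i) (e1 (?R (dpd r j (?L (dmult r (?b j) ?H)))))))
      = e1 (pd_op r e2 e1 i (X2.\<L> u (X2.\<beta>_op i (X2.res u (f j)))))" for i j
    by (simp only: P21.e_incl P21.pd_op(3) X2_transfer[OF u, symmetric] X2.\<beta>_op_dist)
  then have "(\<Sum>i\<in>UNIV. \<Sum>j\<in>UNIV. ?R (dpd r i (?L (dmult r (?b i) (e1 (?R (dpd r j (?L (dmult r (?b j) ?H)))))))))
      = (\<Sum>i\<in>UNIV. \<Sum>j\<in>UNIV. X1.res u (pd_op r e2 e1 i (X2.\<L> u (X2.\<beta>_op i (X2.res u (f j))))))"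
    by (simp add: resolvent_eq[OF u] P21.pd_op_mean_zero)
  also have "\<dots> = X1.res u (\<Sum>i\<in>UNIV. \<Sum>j\<in>UNIV. pd_op r e2 e1 i (X2.\<L> u (X2.\<beta>_op i (X2.res u (f j)))))"
    by (simp add: X1.res_sum[OF u] X1.e_sum P21.pd_op_mean_zero)
  also have "(\<Sum>i\<in>UNIV. \<Sum>j\<in>UNIV. pd_op r e2 e1 i (X2.\<L> u (X2.\<beta>_op i (X2.res u (f j)))))
      = P21.drift u (\<Sum>j\<in>UNIV. X2.res u (f j))"
    by (simp add: P21.drift_def linear_sum bounded_linear.linear[OF P21.pd_op(1)]
        bounded_linear.linear[OF X2.bounded_linear_\<L>[OF u]] bounded_linear.linear[OF X2.bounded_linear_\<beta>_op])
  also have "(\<Sum>j\<in>UNIV. X2.res u (f j)) = X2.res u (P32.drift u ?h)"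
    by (simp add: X2.res_sum[OF u] fm flip: f_sum)
  also have "\<dots> = - response2 u"
    using X2.res_scale[OF u P32.mean_drift, of "-1"] by (simp add: response2_def)
  also have "X1.res u (P21.drift u (- response2 u)) = - X1.res u (P21.drift u (response2 u))"
    using X1.res_scale[OF u P21.mean_drift, of "-1"]
    by (simp add: linear_neg bounded_linear.linear[OF P21.bounded_linear_drift[OF u]])
  finally have 1: "(\<Sum>i\<in>UNIV. \<Sum>j\<in>UNIV. ?R (dpd r i (?L (dmult r (?b i) (e1 (?R (dpd r j (?L (dmult r (?b j) ?H)))))))))
      = - X1.res u (P21.drift u (response2 u))" .
  have mm: "dmult r (\<lambda>x. ?b i x * ?b j x) (e3 ?h) = e3 (X3.\<beta>_op j (X3.\<beta>_op i ?h))" for i j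
    by (auto simp: X3.\<beta>_op_dist dmult_def CT_mult X3.\<beta>_smooth mult.assoc)
  have "(\<lambda>g. \<Sum>i\<in>UNIV. \<Sum>j\<in>UNIV. dpd r i (dpd r j (?L (dmult r (\<lambda>x. ?b i x * ?b j x) ?H))) g)
      = e1 (drift2 u ?h)"
    by (rule ext) (simp only: e1_dens(2)[OF u] mm[symmetric] X3_transfer[OF u, symmetric] drift2_def
        P32.drift_def X1.e_sum linear_sum[OF bounded_linear.linear[OF P21.pd_op(1)]] P21.pd_op(3) P32.pd_op(3))
  then have 2: "?R (\<lambda>g. \<Sum>i\<in>UNIV. \<Sum>j\<in>UNIV. dpd r i (dpd r j (?L (dmult r (\<lambda>x. ?b i x * ?b j x) ?H))) g)
      = X1.res u (drift2 u ?h)"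
    by (simp add: resolvent_eq[OF u] mean_drift2)
  have "quadratic_response u = (1 / 2) *\<^sub>R X1.res u (drift2 u ?h) - X1.res u (P21.drift u (response2 u))"
    using X1.res_lincomb[OF u mean_drift2[of u ?h] P21.mean_drift[of u "response2 u"], of "1/2" "-1"]
    by (simp add: quadratic_response_def)
  then have 3: "2 *\<^sub>R quadratic_response u = 2 *\<^sub>R (- X1.res u (P21.drift u (response2 u))) + X1.res u (drift2 u ?h)"
    by (simp add: scaleR_right_diff_distrib)
  show ?thesis
    unfolding D2hF_def Let_def Tmap_eq H_fun_eq[OF assms] u_def[symmetric] 1 2 3 ..
qed

definition g' :: "real \<Rightarrow> real" where "g' s = e1 (response s) \<alpha>"
definition g2 :: "real \<Rightarrow> real" where "g2 s = e1 (quadratic_response s) \<alpha>"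

lemma g_derivative:
  assumes s: "s \<in> J"
  shows "(g has_real_derivative g' s) (at s within J)"
  using bounded_linear.tendsto[OF X1.bounded_linear_eval density_derivative[OF s], of \<alpha>]
  by (simp add: has_field_derivative_iff g_def[abs_def] g'_def X1.e_scale X1.e_diff)

lemma g_taylor:
  assumes s: "s \<in> J"
  shows "((\<lambda>t. (g t - g s - (t - s) * g' s) / (t - s)\<^sup>2) \<longlongrightarrow> g2 s) (at s within J)"
  using bounded_linear.tendsto[OF X0.bounded_linear_eval density_second_order[OF s], of \<alpha>]
  by (simp add: g_def g'_def g2_def X0.e_scale P10.e_incl X1.e_diff X1.e_scale)

lemma dens_differentiable:
  assumes s: "s \<in> J"
  shows "X1.dens differentiable (at s within J)"
proof -
  have "((\<lambda>t. (1 / (t - s)) *\<^sub>R (X1.dens t - X1.dens s) - response s) \<longlongrightarrow> 0) (at s within J)"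
    using density_derivative[OF s] by (rule LIM_zero)
  then have "((\<lambda>t. norm ((1 / (t - s)) *\<^sub>R (X1.dens t - X1.dens s) - response s)) \<longlongrightarrow> 0) (at s within J)"
    by (rule tendsto_norm_zero)
  then have "((\<lambda>t. norm ((1 / norm (t - s)) *\<^sub>R (X1.dens t - (X1.dens s + (t - s) *\<^sub>R response s)))) \<longlongrightarrow> 0) (at s within J)"
  proof (rule Lim_transform_eventually)
    have "norm ((1 / (t - s)) *\<^sub>R (X1.dens t - X1.dens s) - response s) =
        norm ((1 / norm (t - s)) *\<^sub>R (X1.dens t - (X1.dens s + (t - s) *\<^sub>R response s)))" if "t \<noteq> s" for t
    proof -
      have "(1 / (t - s)) *\<^sub>R (X1.dens t - X1.dens s) - response s =
          (1 / (t - s)) *\<^sub>R (X1.dens t - (X1.dens s + (t - s) *\<^sub>R response s))"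
        using that by (simp add: scaleR_right_diff_distrib scaleR_add_right)
      then show ?thesis by simp
    qed
    then show "\<forall>\<^sub>F t in at s within J. norm ((1 / (t - s)) *\<^sub>R (X1.dens t - X1.dens s) - response s) =
        norm ((1 / norm (t - s)) *\<^sub>R (X1.dens t - (X1.dens s + (t - s) *\<^sub>R response s)))"
      by (simp only: eventually_at_filter) (rule always_eventually, blast)
  qed
  then have "(X1.dens has_derivative (\<lambda>h. h *\<^sub>R response s)) (at s within J)"
    unfolding has_derivative_within
    by (intro conjI bounded_linear_scaleR_left) (rule tendsto_norm_zero_cancel)
  then show ?thesis by (auto simp: differentiable_def)
qed

lemma DhF_invertible_iff:
  assumes u: "\<nu> * e1 h \<alpha> \<in> J"
  shows "invertible_on (V_set e1) (DhF r T \<alpha> \<beta> e1 Ks \<nu> h) \<longleftrightarrow> \<nu> * g' (\<nu> * e1 h \<alpha>) \<noteq> 1"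
proof -
  have "V_set e1 = {x. e1 x one_fun = 0}" by (simp add: V_set_def)
  moreover have "DhF r T \<alpha> \<beta> e1 Ks \<nu> h = (\<lambda>x. x - (\<nu> * e1 x \<alpha>) *\<^sub>R response (\<nu> * e1 h \<alpha>))"
    by (auto simp: DhF_def Theta_eq[OF u])
  ultimately show ?thesis
    using invertible_on_rank_one_perturbation[OF X1.bounded_linear_eval X1.bounded_linear_eval mean_response[OF u],
        of \<nu> \<alpha>]
    by (simp add: g'_def)
qed

lemma scaled_g_in_J: "s \<in> J \<Longrightarrow> \<nu> \<in> {0..\<nu>s} \<Longrightarrow> \<nu> * g s \<in> J"
  unfolding g_def by (intro parameter) (auto simp: X1.nonneg_dens X1.dens_mean)

lemma F_zero_dens: "s \<in> J \<Longrightarrow> s = \<nu> * g s \<Longrightarrow> F_fun r T \<alpha> \<beta> e1 Ks \<nu> (X1.dens s) = 0"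
  by (metis F_fun_zero_iff g_def)

lemma Ltilde_dens: "s \<in> J \<Longrightarrow> s = \<nu> * g s \<Longrightarrow> Ltilde r T \<alpha> \<beta> \<nu> (e1 (X1.dens s)) = e1 (X1.dens s)"
  unfolding Ltilde_def Tmap_eq by (metis X1.dens_fixed X1_transfer g_def)

lemma fixed_pt_param:
  assumes \<nu>: "\<nu> \<in> {0..\<nu>s}" and h: "fixed_pt r T \<alpha> \<beta> e1 Ks \<nu> h"
  obtains s where "s \<in> J" "s = \<nu> * g s" "h = X1.dens s"
proof -
  obtain \<mu> where \<mu>: "prob_space \<mu>" "sets \<mu> = sets borel"
    "e1 h = (\<lambda>\<phi>. if \<phi> \<in> CT r then (LINT x|\<mu>. \<phi> x) else 0)"
    using h by (auto simp: fixed_pt_def prob_dist_def)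
  have "e1 h one_fun = 1" using prob_space.prob_space[OF \<mu>(1)] by (simp add: \<mu>(3))
  moreover have "dist_nonneg r (e1 h)" by (auto simp: dist_nonneg_def \<mu>(3))
  ultimately have u: "\<nu> * e1 h \<alpha> \<in> J" using \<nu> by (intro parameter)
  then have "h = X1.dens (\<nu> * e1 h \<alpha>)" using h by (simp add: fixed_pt_def H_fun_eq)
  with u show thesis by (intro that[of "\<nu> * e1 h \<alpha>"]) (simp_all add: g_def)
qed

text \<open>
  The hypothesis on \<open>F\<close> is the nondegeneracy of the scalar equation. The curves are \<open>s \<mapsto> (s / g s, h\<^sub>s)\<close>
  over the intervals of the branch and, if \<open>g 0 = 0\<close>, the trivial branch \<open>\<nu> \<mapsto> (\<nu>, h\<^sub>0)\<close>.
\<close>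

theorem bifurcation_curves:
  assumes hyp: "\<forall>\<nu>\<in>{0..\<nu>s}. \<forall>h\<in>W_set r e1 Ks. F_fun r T \<alpha> \<beta> e1 Ks \<nu> h = 0 \<longrightarrow>
       invertible_on (V_set e1) (DhF r T \<alpha> \<beta> e1 Ks \<nu> h) \<or>
       (is_direct_sum (DhF r T \<alpha> \<beta> e1 Ks \<nu> h ` V_set e1) (span {DnuF r T \<alpha> \<beta> e1 Ks \<nu> h})
          (V_set e1) \<and>
        e1 (D2hF r T \<alpha> \<beta> e1 Ks \<nu> h (Theta r T \<alpha> \<beta> e1 Ks \<nu> h) (Theta r T \<alpha> \<beta> e1 Ks \<nu> h)) \<alpha> \<noteq> 0 \<and>
        e1 h \<alpha> \<noteq> 0)"
  shows "\<exists>(n::nat) (I :: nat \<Rightarrow> real set) (G :: nat \<Rightarrow> real \<Rightarrow> real) (hh :: nat \<Rightarrow> real \<Rightarrow> 'b1).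
       (\<forall>k<n. is_interval (I k) \<and> I k \<noteq> {} \<and> (\<lambda>y. (G k y, hh k y)) differentiable_on I k) \<and>
       (\<forall>k<n. \<forall>y\<in>I k. G k y \<in> {0..\<nu>s}) \<and>
       (\<forall>\<nu>\<in>{0..\<nu>s}. \<forall>h. fixed_pt r T \<alpha> \<beta> e1 Ks \<nu> h \<longrightarrow>
          (\<exists>k<n. \<exists>y\<in>I k. G k y = \<nu> \<and> hh k y = h)) \<and>
       (\<forall>k<n. \<forall>y\<in>I k. e1 (hh k y) \<in> range e3 \<and> hh k y \<in> W_set r e1 Ks \<and>
          Ltilde r T \<alpha> \<beta> (G k y) (e1 (hh k y)) = e1 (hh k y) \<and>
          F_fun r T \<alpha> \<beta> e1 Ks (G k y) (hh k y) = 0) \<and>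
       (\<forall>k<n. \<forall>\<nu>\<in>{0..\<nu>s}. finite {y \<in> I k. G k y = \<nu>}) \<and>
       ((\<exists>\<nu>\<in>{0<..<\<nu>s}. \<exists>h\<in>W_set r e1 Ks. F_fun r T \<alpha> \<beta> e1 Ks \<nu> h = 0 \<and>
           \<not> invertible_on (V_set e1) (DhF r T \<alpha> \<beta> e1 Ks \<nu> h)) \<longrightarrow>
        (\<exists>\<nu>1\<in>{0<..<\<nu>s}.
           card (\<Union>k<n. {y \<in> I k. G k y = \<nu>1}) \<ge> 3 \<and>
           card (\<Union>k<n. hh k ` {y \<in> I k. G k y = \<nu>1}) \<ge> 3))"
proof -
  interpret scalar_bifurcation a b \<nu>s g g' g2
  proof
    fix s \<nu> assume s: "s \<in> J" and \<nu>: "\<nu> \<in> {0..\<nu>s}" and eq: "s = \<nu> * g s" and fold: "\<nu> * g' s = 1"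
    have u: "\<nu> * e1 (X1.dens s) \<alpha> = s" using eq by (simp add: g_def)
    have uJ: "\<nu> * e1 (X1.dens s) \<alpha> \<in> J" using u s by simp
    have "\<not> invertible_on (V_set e1) (DhF r T \<alpha> \<beta> e1 Ks \<nu> (X1.dens s))"
      using DhF_invertible_iff[OF uJ] fold by (simp add: u)
    moreover have "F_fun r T \<alpha> \<beta> e1 Ks \<nu> (X1.dens s) = 0" by (rule F_zero_dens[OF s eq])
    ultimately have "e1 (D2hF r T \<alpha> \<beta> e1 Ks \<nu> (X1.dens s) (Theta r T \<alpha> \<beta> e1 Ks \<nu> (X1.dens s))
        (Theta r T \<alpha> \<beta> e1 Ks \<nu> (X1.dens s))) \<alpha> \<noteq> 0" "e1 (X1.dens s) \<alpha> \<noteq> 0"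
      using hyp \<nu> dens_in_W[OF s] by blast+
    then show "g s \<noteq> 0 \<and> g2 s \<noteq> 0"
      by (auto simp: g_def g2_def D2hF_eq[OF uJ] u X1.e_minus X1.e_scale)
  qed (simp_all only: ab \<nu>s scaled_g_in_J g_derivative g_taylor)
  obtain \<I> where \<I>: "finite \<I>" "\<Union>\<I> = branch" "\<forall>I\<in>\<I>. is_interval I \<and> I \<noteq> {}"
    by (rule branch_intervals) blast
  (* The trivial branch is parametrised over an interval disjoint from [a,b], so that parameters
     of different curves never coincide as real numbers when they are counted. *)
  define X where "X = {b + 1..b + 1 + \<nu>s}"
  define \<K> where "\<K> = (if g 0 = 0 then insert X \<I> else \<I>)"
  define G where "G y = (if y \<le> b then y / g y else y - (b + 1))" for y
  define hh where "hh y = (if y \<le> b then X1.dens y else X1.dens 0)" for y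
  have J0: "0 \<in> J" using ab by simp
  have "finite \<K>" using \<I>(1) by (simp add: \<K>_def)
  then obtain xs where xs: "set xs = \<K>" using finite_list by blast
  define I where "I k = xs ! k" for k
  define n where "n = length xs"
  have I\<K>: "I k \<in> \<K>" if "k < n" for k using that xs by (auto simp: I_def n_def)
  have \<K>I: "\<exists>k<n. I k = K" if "K \<in> \<K>" for K
    using that by (auto simp: I_def n_def xs[symmetric] in_set_conv_nth)
  have UI: "(\<Union>k<n. I k) = \<Union>\<K>" using I\<K> \<K>I by blast
  have branchD: "y \<in> J" "g y \<noteq> 0" "y / g y \<in> {0..\<nu>s}" "y \<le> b" if "y \<in> branch" for y
    using that by (auto simp: branch_def)
  have XD: "\<not> y \<le> b" if "y \<in> X" for y using that by (auto simp: X_def)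
  have cases_y: "y \<in> branch \<or> g 0 = 0 \<and> y \<in> X" if "k < n" "y \<in> I k" for k y
    using I\<K>[OF that(1)] that(2) \<I>(2) by (auto simp: \<K>_def split: if_splits)
  have param: "\<exists>s\<in>J. s = G y * g s \<and> hh y = X1.dens s \<and> G y \<in> {0..\<nu>s}" if "k < n" "y \<in> I k" for k y
    using cases_y[OF that]
  proof
    assume y: "y \<in> branch"
    show ?thesis using branchD[OF y] by (intro bexI[of _ y]) (auto simp: G_def hh_def)
  next
    assume y: "g 0 = 0 \<and> y \<in> X"
    then show ?thesis using XD[of y] J0 by (intro bexI[of _ 0]) (auto simp: G_def hh_def X_def)
  qed
  have point: "\<exists>y\<in>\<Union>\<K>. G y = \<nu> \<and> hh y = X1.dens s" if s: "s \<in> J" "s = \<nu> * g s" and \<nu>: "\<nu> \<in> {0..\<nu>s}" for s \<nu>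
  proof (cases "g s = 0")
    case True
    with s(2) have "s = 0" by simp
    with True have "g 0 = 0" by simp
    then have "X \<in> \<K>" by (simp add: \<K>_def)
    moreover have "b + 1 + \<nu> \<in> X" using \<nu> by (auto simp: X_def)
    ultimately show ?thesis using \<nu> \<open>s = 0\<close>
      by (intro bexI[of _ "b + 1 + \<nu>"]) (auto simp: G_def hh_def)
  next
    case False
    then have \<nu>_eq: "s / g s = \<nu>" using s(2) by (simp add: divide_eq_eq)
    then have "s \<in> branch" using False s(1) \<nu> by (auto simp: branch_def)
    then have "s \<in> \<Union>\<K>" using \<I>(2) by (auto simp: \<K>_def)
    then show ?thesis using \<nu>_eq s(1) by (intro bexI[of _ s]) (auto simp: G_def hh_def)
  qed
  have fin: "finite {y \<in> \<Union>\<K>. G y = \<nu>}" if \<nu>: "\<nu> \<in> {0..\<nu>s}" for \<nu>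
  proof (rule finite_subset)
    show "finite (insert (b + 1 + \<nu>) {s \<in> J. s = \<nu> * g s})" using finite_solutions[OF \<nu>] by simp
    show "{y \<in> \<Union>\<K>. G y = \<nu>} \<subseteq> insert (b + 1 + \<nu>) {s \<in> J. s = \<nu> * g s}"
    proof
      fix y assume y: "y \<in> {y \<in> \<Union>\<K>. G y = \<nu>}"
      then have "y \<in> branch \<or> y \<in> X" using \<I>(2) by (auto simp: \<K>_def split: if_splits)
      then show "y \<in> insert (b + 1 + \<nu>) {s \<in> J. s = \<nu> * g s}"
      proof
        assume "y \<in> branch"
        then show ?thesis using branchD[of y] y by (auto simp: G_def)
      next
        assume "y \<in> X"
        then show ?thesis using XD[of y] y by (auto simp: G_def)
      qed
    qed
  qed
  have diff: "(\<lambda>y. (G y, hh y)) differentiable_on K" if K: "K \<in> \<K>" for K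
  proof (cases "K \<subseteq> branch")
    case True
    show ?thesis
      unfolding differentiable_on_def
    proof
      fix y assume y: "y \<in> K"
      then have yb: "y \<in> branch" using True by blast
      have KJ: "K \<subseteq> J" using True branchD(1) by blast
      obtain D where D: "(X1.dens has_derivative D) (at y within K)"
        using differentiable_within_subset[OF dens_differentiable[OF branchD(1)[OF yb]] KJ]
        by (auto simp: differentiable_def)
      have "((\<lambda>y. y / g y) has_field_derivative (1 * g y - y * g' y) / (g y * g y)) (at y within K)"
        by (intro DERIV_divide DERIV_ident DERIV_subset[OF g_derivative KJ] branchD[OF yb])
      then have "((\<lambda>y. (y / g y, X1.dens y)) has_derivative
          (\<lambda>h. ((1 * g y - y * g' y) / (g y * g y) * h, D h))) (at y within K)"
        unfolding has_field_derivative_def by (rule has_derivative_Pair[OF _ D])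
      then have "(\<lambda>y. (y / g y, X1.dens y)) differentiable (at y within K)"
        by (auto simp: differentiable_def)
      then show "(\<lambda>y. (G y, hh y)) differentiable (at y within K)"
        by (rule differentiable_transform_within[of _ _ _ 1])
           (use y True branchD(4) in \<open>auto simp: G_def hh_def\<close>)
    qed
  next
    case False
    then have KX: "K = X" using K \<I>(2) by (auto simp: \<K>_def split: if_splits)
    have d: "(\<lambda>y. (y - (b + 1), X1.dens 0)) differentiable (at y within K)" for y
      by (auto simp: differentiable_def intro!: exI[of _ "\<lambda>h. (h, 0)"] derivative_eq_intros)
    show ?thesis
      unfolding differentiable_on_def
    proof
      fix y assume y: "y \<in> K"
      show "(\<lambda>y. (G y, hh y)) differentiable (at y within K)"
      proof (rule differentiable_transform_within[OF d zero_less_one y])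
        fix z assume "z \<in> K"
        then show "(z - (b + 1), X1.dens 0) = (G z, hh z)"
          using XD[of z] KX by (simp add: G_def hh_def)
      qed
    qed
  qed
  have three: "\<exists>\<nu>1\<in>{0<..<\<nu>s}. card {y \<in> \<Union>\<K>. G y = \<nu>1} \<ge> 3 \<and> card (hh ` {y \<in> \<Union>\<K>. G y = \<nu>1}) \<ge> 3"
    if \<nu>: "\<nu> \<in> {0<..<\<nu>s}" and h: "h \<in> W_set r e1 Ks" "F_fun r T \<alpha> \<beta> e1 Ks \<nu> h = 0"
      "\<not> invertible_on (V_set e1) (DhF r T \<alpha> \<beta> e1 Ks \<nu> h)" for \<nu> h
  proof -
    define s where "s = \<nu> * e1 h \<alpha>"
    have s: "s \<in> J" unfolding s_def using \<nu> h(1) by (intro W_parameter) auto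
    have hs: "h = X1.dens s" using F_fun_zero_iff[of \<nu> h] s h(2) by (simp add: s_def)
    have eq: "s = \<nu> * g s" using hs by (simp add: s_def g_def)
    have "\<nu> * g' s = 1" using DhF_invertible_iff[of \<nu> h] s h(3) by (simp add: s_def)
    then obtain \<nu>1 z1 z2 z3 where z: "\<nu>1 \<in> {0<..<\<nu>s}" "{z1, z2, z3} \<subseteq> J" "z1 < z2" "z2 < z3"
      "\<And>z. z \<in> {z1, z2, z3} \<Longrightarrow> z = \<nu>1 * g z"
      by (rule fold_three_solutions[OF s \<nu> eq]) blast
    have \<nu>1: "\<nu>1 \<in> {0..\<nu>s}" using z(1) by auto
    (* The density at a solution z determines z = \<nu>1 g z. *)
    have inj: "inj_on X1.dens {z1, z2, z3}"
      by (rule inj_onI) (metis z(5) g_def)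
    have "X1.dens ` {z1, z2, z3} \<subseteq> hh ` {y \<in> \<Union>\<K>. G y = \<nu>1}"
    proof (rule image_subsetI)
      fix z assume "z \<in> {z1, z2, z3}"
      then obtain y where "y \<in> \<Union>\<K>" "G y = \<nu>1" "hh y = X1.dens z"
        using point[OF _ z(5) \<nu>1, of z] z(2) by blast
      then show "X1.dens z \<in> hh ` {y \<in> \<Union>\<K>. G y = \<nu>1}" by force
    qed
    then have "card (X1.dens ` {z1, z2, z3}) \<le> card (hh ` {y \<in> \<Union>\<K>. G y = \<nu>1})"
      using fin[OF \<nu>1] by (intro card_mono) auto
    moreover have "card (X1.dens ` {z1, z2, z3}) = 3"
      unfolding card_image[OF inj] using z(3,4) by simp
    ultimately have c: "3 \<le> card (hh ` {y \<in> \<Union>\<K>. G y = \<nu>1})" by simp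
    moreover have "card (hh ` {y \<in> \<Union>\<K>. G y = \<nu>1}) \<le> card {y \<in> \<Union>\<K>. G y = \<nu>1}"
      by (rule card_image_le[OF fin[OF \<nu>1]])
    ultimately show ?thesis using z(1) by (intro bexI[of _ \<nu>1]) auto
  qed
  have U1: "(\<Union>k<n. {y \<in> I k. G y = \<nu>}) = {y \<in> \<Union>\<K>. G y = \<nu>}" for \<nu> using UI by blast
  have U2: "(\<Union>k<n. hh ` {y \<in> I k. G y = \<nu>}) = hh ` {y \<in> \<Union>\<K>. G y = \<nu>}" for \<nu> using UI by blast
  show ?thesis
  proof (rule exI[of _ n], rule exI[of _ I], rule exI[of _ "\<lambda>_. G"], rule exI[of _ "\<lambda>_. hh"],
      intro conjI allI impI ballI)
    fix k assume k: "k < n"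
    show "is_interval (I k)" "I k \<noteq> {}"
      using I\<K>[OF k] \<I>(3) \<nu>s by (auto simp: \<K>_def X_def is_interval_cc split: if_splits)
    show "(\<lambda>y. (G y, hh y)) differentiable_on I k" by (rule diff[OF I\<K>[OF k]])
    show "finite {y \<in> I k. G y = \<nu>}" if "\<nu> \<in> {0..\<nu>s}" for \<nu>
      by (rule finite_subset[OF _ fin[OF that]]) (use I\<K>[OF k] in blast)
    fix y assume y: "y \<in> I k"
    obtain s where s: "s \<in> J" "s = G y * g s" "hh y = X1.dens s" "G y \<in> {0..\<nu>s}"
      using param[OF k y] by blast
    show "G y \<in> {0..\<nu>s}" by (rule s)
    show "e1 (hh y) \<in> range e3" "hh y \<in> W_set r e1 Ks"
      using s by (auto simp: e1_dens(2) dens_in_W)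
    show "Ltilde r T \<alpha> \<beta> (G y) (e1 (hh y)) = e1 (hh y)"
      unfolding s(3) by (rule Ltilde_dens[OF s(1,2)])
    show "F_fun r T \<alpha> \<beta> e1 Ks (G y) (hh y) = 0"
      unfolding s(3) by (rule F_zero_dens[OF s(1,2)])
  next
    fix \<nu> h assume \<nu>: "\<nu> \<in> {0..\<nu>s}" and h: "fixed_pt r T \<alpha> \<beta> e1 Ks \<nu> h"
    obtain s where s: "s \<in> J" "s = \<nu> * g s" "h = X1.dens s" by (rule fixed_pt_param[OF \<nu> h])
    obtain y where "y \<in> \<Union>\<K>" "G y = \<nu>" "hh y = h" using point[OF s(1,2) \<nu>] s(3) by blast
    then show "\<exists>k<n. \<exists>y\<in>I k. G y = \<nu> \<and> hh y = h" using UI by blast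
  next
    assume "\<exists>\<nu>\<in>{0<..<\<nu>s}. \<exists>h\<in>W_set r e1 Ks. F_fun r T \<alpha> \<beta> e1 Ks \<nu> h = 0 \<and>
           \<not> invertible_on (V_set e1) (DhF r T \<alpha> \<beta> e1 Ks \<nu> h)"
    then show "\<exists>\<nu>1\<in>{0<..<\<nu>s}. card (\<Union>k<n. {y \<in> I k. G y = \<nu>1}) \<ge> 3 \<and>
           card (\<Union>k<n. hh ` {y \<in> I k. G y = \<nu>1}) \<ge> 3"
      unfolding U1 U2 using three by blast
  qed
qed

end

section \<open>From the standing assumptions to the scalar problem\<close>

lemma prob_dist_point_mass:
  "prob_dist r (\<lambda>\<phi>. if \<phi> \<in> CT r then \<phi> x else 0)"
  unfolding prob_dist_def
proof (intro exI conjI)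
  show "prob_space (return borel x)" by (rule prob_space_return) simp
  have "(LINT y|return borel x. \<phi> y) = \<phi> x" if "\<phi> \<in> CT r" for \<phi> :: "real ^ 'a \<Rightarrow> real"
    using borel_measurable_continuous_onI[OF CT_continuous[OF that]] by (intro integral_return) auto
  then show "(\<lambda>\<phi>. if \<phi> \<in> CT r then \<phi> x else 0) =
      (\<lambda>\<phi>. if \<phi> \<in> CT r then LINT y|return borel x. \<phi> y else 0)" by auto
qed simp

lemma lasota_yorke_power_bound:
  assumes e': "dist_space r e'" and tr: "transfer_bounded r S e'" and nested: "nested e' e"
    and ly: "lasota_yorke r \<T> C K \<theta> e0 e' e" and S: "S \<in> \<T>"
    and c: "K \<ge> 0" "C \<ge> 0" "0 \<le> \<theta>" "\<theta> \<le> 1"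
  shows "norm ((transfer_op r e' S ^^ n) x) \<le> (C + K) * norm x"
proof -
  interpret dist_space r e' by (rule e')
  have "set (replicate n S) \<subseteq> \<T>" using S by auto
  then have "dnorm e' (fold (transfer r) (replicate n S) (e' x)) \<le>
      C * \<theta> ^ length (replicate n S) * dnorm e' (e' x) + K * dnorm e (e' x)"
    using ly unfolding lasota_yorke_def by blast
  then have "norm ((transfer_op r e' S ^^ n) x) \<le> C * \<theta> ^ n * norm x + K * dnorm e (e' x)"
    unfolding fold_transfer_eq[OF tr] dnorm_e by simp
  also have "K * dnorm e (e' x) \<le> K * norm x"
    using nested c by (intro mult_left_mono) (auto simp: nested_def dnorm_e)
  also have "C * \<theta> ^ n * norm x \<le> C * 1 * norm x"
    using c by (intro mult_right_mono mult_left_mono power_le_one) auto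
  finally show ?thesis by (simp add: algebra_simps)
qed

text \<open>
  The bound is assumed on the elements of \<open>e1\<close> only; it extends to all of \<open>e0\<close> by density.
\<close>

lemma lasota_yorke_weak_power_bound:
  fixes e0 :: "'b0::banach \<Rightarrow> 'd::finite dist" and e1 :: "'b1::banach \<Rightarrow> 'd dist"
  assumes pair: "dist_space_pair r e1 e0" and tr: "transfer_bounded r S e0"
    and ly: "lasota_yorke r \<T> C K \<theta> e0 e1 e" and S: "S \<in> \<T>"
  shows "norm ((transfer_op r e0 S ^^ n) x) \<le> C * norm x"
proof -
  interpret dist_space_pair r e1 e0 by (rule pair)
  have bl: "bounded_linear (transfer_op r e0 S ^^ n)"
  proof (induction n)
    case 0
    show ?case using bounded_linear_ident by (simp add: id_def)
  next
    case (Suc n)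
    show ?case using bounded_linear_compose[OF small.transfer_op(1)[OF tr] Suc] by (simp add: comp_def)
  qed
  have "closed {x. norm ((transfer_op r e0 S ^^ n) x) \<le> C * norm x}"
    by (intro closed_Collect_le continuous_on_norm continuous_on_mult continuous_on_const continuous_on_id
        linear_continuous_on[OF bl])
  moreover have "norm ((transfer_op r e0 S ^^ n) (\<iota> y)) \<le> C * norm (\<iota> y)" for y
  proof -
    have "set (replicate n S) \<subseteq> \<T>" using S by auto
    then have "dnorm e0 (fold (transfer r) (replicate n S) (e1 y)) \<le> C * dnorm e0 (e1 y)"
      using ly unfolding lasota_yorke_def by blast
    then have "dnorm e0 (fold (transfer r) (replicate n S) (e0 (\<iota> y))) \<le> C * dnorm e0 (e0 (\<iota> y))"
      by (simp only: e_incl)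
    then show ?thesis by (simp only: small.fold_transfer_eq[OF tr] small.dnorm_e)
  qed
  ultimately have "closure (\<iota> ` smooth_elements r e1) \<subseteq> {x. norm ((transfer_op r e0 S ^^ n) x) \<le> C * norm x}"
    by (intro closure_minimal) auto
  then show ?thesis unfolding dense_incl_smooth_elements by blast
qed

lemma mean_zero_contraction_power:
  assumes e: "dist_space r e" and tr: "transfer_bounded r S e"
    and contr: "mean_zero_contraction r (replicate n S) \<theta> e" and x: "e x one_fun = 0"
  shows "norm ((transfer_op r e S ^^ n) x) \<le> \<theta> ^ n * norm x"
proof -
  interpret dist_space r e by (rule e)
  obtain c where c: "c < \<theta> ^ n"
    "\<And>u. u \<in> range e \<Longrightarrow> u one_fun = 0 \<Longrightarrow> dnorm e (fold (transfer r) (replicate n S) u) \<le> c * dnorm e u"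
    using contr unfolding mean_zero_contraction_def length_replicate by blast
  have "norm ((transfer_op r e S ^^ n) x) \<le> c * norm x"
    using c(2)[OF rangeI x] unfolding fold_transfer_eq[OF tr] dnorm_e .
  also have "\<dots> \<le> \<theta> ^ n * norm x" using c(1) by (intro mult_right_mono) auto
  finally show ?thesis .
qed

theorem theorem2p13:
  fixes r :: nat
    and T \<beta> :: "real ^ 'd::finite \<Rightarrow> real ^ 'd"
    and \<alpha> :: "real ^ 'd \<Rightarrow> real"
    and \<T> :: "(real ^ 'd \<Rightarrow> real ^ 'd) set"
    and \<nu>s K C cbar chat \<theta> :: real
    and e0 :: "'b0::banach \<Rightarrow> 'd dist"
    and e1 :: "'b1::banach \<Rightarrow> 'd dist"
    and e2 :: "'b2::banach \<Rightarrow> 'd dist"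
    and e3 :: "'b3::banach \<Rightarrow> 'd dist"
  assumes r: "r > 12"
    and T: "\<And>k. torus_map k T"
    and \<alpha>: "\<And>k. \<alpha> \<in> CT k"
    and \<beta>: "\<And>k i. (\<lambda>x. \<beta> x $ i) \<in> CT k"
    and \<T>: "\<And>S. S \<in> \<T> \<Longrightarrow> torus_map r S \<and> torus_surj S"
    and \<T>_comp: "\<And>S S'. S \<in> \<T> \<Longrightarrow> S' \<in> \<T> \<Longrightarrow> S \<circ> S' \<in> \<T>"
    and \<nu>s: "\<nu>s > 0"
    and T_in: "\<And>\<nu> h. \<nu> \<in> {0..\<nu>s} \<Longrightarrow> prob_dist r h \<Longrightarrow> Tmap T \<alpha> \<beta> \<nu> h \<in> \<T>"
    and spaces: "banach_dist_space r e0" "banach_dist_space r e1"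
      "banach_dist_space r e2" "banach_dist_space r e3"
    and nested: "nested e1 e0" "nested e2 e1" "nested e3 e2"
    and const_bounds: "K \<ge> 1" "C \<ge> 1" "cbar > 0" "chat > 0" "0 < \<theta>" "\<theta> < 1"
    and A1: "\<And>S. S \<in> \<T> \<Longrightarrow> transfer_bounded r S e0 \<and> transfer_bounded r S e1 \<and>
      transfer_bounded r S e2 \<and> transfer_bounded r S e3"
    and A2: "\<And>i. pd_bounded r i e1 e0 \<and> pd_bounded r i e2 e1 \<and> pd_bounded r i e3 e2"
    and A3: "mult_bounded r (cbar * 0 + chat) C e0" "mult_bounded r (cbar * 1 + chat) C e1"
      "mult_bounded r (cbar * 2 + chat) C e2" "mult_bounded r (cbar * 3 + chat) C e3"
      "\<And>h. \<bar>e0 h one_fun\<bar> \<le> C * norm h"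
    and A4: "compactly_nested e1 e0" "compactly_nested e2 e1" "compactly_nested e3 e2"
    and A5: "lasota_yorke r \<T> C K \<theta> e0 e1 e0" "lasota_yorke r \<T> C K \<theta> e0 e2 e1"
      "lasota_yorke r \<T> C K \<theta> e0 e3 e2"
    and A6: "\<exists>nbar. \<forall>Ss. length Ss \<ge> nbar \<and> set Ss \<subseteq> \<T> \<longrightarrow>
      mean_zero_contraction r Ss \<theta> e1 \<and> mean_zero_contraction r Ss \<theta> e2 \<and>
      mean_zero_contraction r Ss \<theta> e3"
  shows "\<exists>K0>0. \<forall>Ks\<ge>K0.
    (\<forall>\<nu>\<in>{0..\<nu>s}. \<forall>h\<in>W_set r e1 Ks. F_fun r T \<alpha> \<beta> e1 Ks \<nu> h = 0 \<longrightarrow>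
       invertible_on (V_set e1) (DhF r T \<alpha> \<beta> e1 Ks \<nu> h) \<or>
       (is_direct_sum (DhF r T \<alpha> \<beta> e1 Ks \<nu> h ` V_set e1) (span {DnuF r T \<alpha> \<beta> e1 Ks \<nu> h})
          (V_set e1) \<and>
        e1 (D2hF r T \<alpha> \<beta> e1 Ks \<nu> h (Theta r T \<alpha> \<beta> e1 Ks \<nu> h) (Theta r T \<alpha> \<beta> e1 Ks \<nu> h)) \<alpha> \<noteq> 0 \<and>
        e1 h \<alpha> \<noteq> 0)) \<longrightarrow>
    (\<exists>(n::nat) (I :: nat \<Rightarrow> real set) (G :: nat \<Rightarrow> real \<Rightarrow> real) (hh :: nat \<Rightarrow> real \<Rightarrow> 'b1).
       (\<forall>k<n. is_interval (I k) \<and> I k \<noteq> {} \<and> (\<lambda>y. (G k y, hh k y)) differentiable_on I k) \<and>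
       (\<forall>k<n. \<forall>y\<in>I k. G k y \<in> {0..\<nu>s}) \<and>
       (\<forall>\<nu>\<in>{0..\<nu>s}. \<forall>h. fixed_pt r T \<alpha> \<beta> e1 Ks \<nu> h \<longrightarrow>
          (\<exists>k<n. \<exists>y\<in>I k. G k y = \<nu> \<and> hh k y = h)) \<and>
       (\<forall>k<n. \<forall>y\<in>I k. e1 (hh k y) \<in> range e3 \<and> hh k y \<in> W_set r e1 Ks \<and>
          Ltilde r T \<alpha> \<beta> (G k y) (e1 (hh k y)) = e1 (hh k y) \<and>
          F_fun r T \<alpha> \<beta> e1 Ks (G k y) (hh k y) = 0) \<and>
       (\<forall>k<n. \<forall>\<nu>\<in>{0..\<nu>s}. finite {y \<in> I k. G k y = \<nu>}) \<and>
       ((\<exists>\<nu>\<in>{0<..<\<nu>s}. \<exists>h\<in>W_set r e1 Ks. F_fun r T \<alpha> \<beta> e1 Ks \<nu> h = 0 \<and>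
           \<not> invertible_on (V_set e1) (DhF r T \<alpha> \<beta> e1 Ks \<nu> h)) \<longrightarrow>
        (\<exists>\<nu>1\<in>{0<..<\<nu>s}.
           card (\<Union>k<n. {y \<in> I k. G k y = \<nu>1}) \<ge> 3 \<and>
           card (\<Union>k<n. hh k ` {y \<in> I k. G k y = \<nu>1}) \<ge> 3)))"
proof -
  obtain xm where xm: "\<And>x. \<alpha> xm \<le> \<alpha> x"
    using compact_attains_inf[OF CT_compact_range[OF \<alpha>]] by auto
  obtain xM where xM: "\<And>x. \<alpha> x \<le> \<alpha> xM"
    using compact_attains_sup[OF CT_compact_range[OF \<alpha>]] by auto
  define a where "a = min 0 (\<nu>s * \<alpha> xm)"
  define b where "b = max 0 (\<nu>s * \<alpha> xM)"
  let ?J = "{a..b}" and ?S = "shifted_map T \<beta>"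
  (* Every u in [a,b] is \<nu> \<alpha>(x) for some \<nu> and some x, so the map comes from the point mass at x. *)
  have S_in: "?S u \<in> \<T>" if u: "u \<in> ?J" for u
  proof -
    have "\<exists>\<nu>\<in>{0..\<nu>s}. \<exists>x. u = \<nu> * \<alpha> x"
    proof -
      consider "u = 0" | "u > 0" | "u < 0" by linarith
      then show ?thesis
      proof cases
        case 1
        then show ?thesis using \<nu>s by (intro bexI[of _ 0]) auto
      next
        case 2
        then have *: "u \<le> \<nu>s * \<alpha> xM" using u by (auto simp: b_def)
        then have "\<alpha> xM > 0" using 2 \<nu>s by (metis less_le_trans zero_less_mult_pos)
        then show ?thesis using * 2
          by (intro bexI[of _ "u / \<alpha> xM"] exI[of _ xM]) (auto simp: pos_divide_le_eq)
      next
        case 3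
        then have *: "\<nu>s * \<alpha> xm \<le> u" using u by (auto simp: a_def)
        then have "\<nu>s * \<alpha> xm < 0" using 3 by linarith
        then have "\<alpha> xm < 0" using \<nu>s by (simp add: mult_less_0_iff)
        then show ?thesis using * 3
          by (intro bexI[of _ "u / \<alpha> xm"] exI[of _ xm]) (auto simp: neg_divide_le_eq divide_nonpos_neg)
      qed
    qed
    then obtain \<nu> x where \<nu>: "\<nu> \<in> {0..\<nu>s}" "u = \<nu> * \<alpha> x" by blast
    have "Tmap T \<alpha> \<beta> \<nu> (\<lambda>\<phi>. if \<phi> \<in> CT r then \<phi> x else 0) = ?S u"
      by (auto simp: Tmap_def shifted_map_def \<nu>(2) \<alpha>)
    with T_in[OF \<nu>(1) prob_dist_point_mass[of r x]] show ?thesis by simp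
  qed
  have tr: "transfer_bounded r (?S u) e0" "transfer_bounded r (?S u) e1"
    "transfer_bounded r (?S u) e2" "transfer_bounded r (?S u) e3" if "u \<in> ?J" for u
    using A1[OF S_in[OF that]] by auto
  have ds: "dist_space r e0" "dist_space r e1" "dist_space r e2" "dist_space r e3"
    using spaces by (auto simp: dist_space_def)
  have pairs: "dist_space_pair r e1 e0" "dist_space_pair r e2 e1" "dist_space_pair r e3 e2"
    using ds nested A2 by (auto simp: dist_space_pair_def dist_space_pair_axioms_def)
  have c: "K \<ge> 0" "C \<ge> 0" "0 \<le> \<theta>" "\<theta> \<le> 1" using const_bounds by auto
  obtain N where N: "\<And>Ss. length Ss \<ge> N \<Longrightarrow> set Ss \<subseteq> \<T> \<Longrightarrow>
      mean_zero_contraction r Ss \<theta> e1 \<and> mean_zero_contraction r Ss \<theta> e2 \<and> mean_zero_contraction r Ss \<theta> e3"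
    using A6 by blast
  have contr: "mean_zero_contraction r (replicate n (?S u)) \<theta> e1"
    "mean_zero_contraction r (replicate n (?S u)) \<theta> e2"
    "mean_zero_contraction r (replicate n (?S u)) \<theta> e3" if "u \<in> ?J" "n \<ge> N" for u n
  proof -
    have "set (replicate n (?S u)) \<subseteq> \<T>" using S_in[OF that(1)] by auto
    with N[of "replicate n (?S u)"] that(2)
    show "mean_zero_contraction r (replicate n (?S u)) \<theta> e1" "mean_zero_contraction r (replicate n (?S u)) \<theta> e2"
      "mean_zero_contraction r (replicate n (?S u)) \<theta> e3" by auto
  qed
  have T_cont: "continuous_on UNIV T"
    using T[of 0] by (subst continuous_on_componentwise) (auto simp: torus_map_def Basis_vec_def inner_axis)
  have tm: "torus_map r (?S u)" if "u \<in> ?J" for u using \<T>[OF S_in[OF that]] by simp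
  note fam = transfer_family.intro[OF _ transfer_family_axioms.intro]
  have f0: "transfer_family r e0 T \<beta> ?J (C + K)"
  proof (rule fam[OF ds(1) _ T_cont \<beta> tm tr(1)])
    fix u n x assume u: "u \<in> ?J"
    have "norm ((transfer_op r e0 (?S u) ^^ n) x) \<le> C * norm x"
      by (rule lasota_yorke_weak_power_bound[OF pairs(1) tr(1)[OF u] A5(1) S_in[OF u]])
    also have "\<dots> \<le> (C + K) * norm x" using c by (intro mult_right_mono) auto
    finally show "norm ((transfer_op r e0 (?S u) ^^ n) x) \<le> (C + K) * norm x" .
  qed (use A3(1) c in auto)
  have f1: "transfer_family r e1 T \<beta> ?J (C + K)"
    by (rule fam[OF ds(2) _ T_cont \<beta> tm tr(2) _ lasota_yorke_power_bound[OF ds(2) tr(2) nested(1) A5(1) S_in c]])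
       (use A3(2) c in auto)
  have f2: "transfer_family r e2 T \<beta> ?J (C + K)"
    by (rule fam[OF ds(3) _ T_cont \<beta> tm tr(3) _ lasota_yorke_power_bound[OF ds(3) tr(3) nested(2) A5(2) S_in c]])
       (use A3(3) c in auto)
  have f3: "transfer_family r e3 T \<beta> ?J (C + K)"
    by (rule fam[OF ds(4) _ T_cont \<beta> tm tr(4) _ lasota_yorke_power_bound[OF ds(4) tr(4) nested(3) A5(3) S_in c]])
       (use A3(4) c in auto)
  note mix = mixing_transfer_family.intro[OF _ mixing_transfer_family_axioms.intro]
  have m1: "mixing_transfer_family r e1 T \<beta> ?J (C + K) \<theta> N"
    by (rule mix[OF f1 mean_zero_contraction_power[OF ds(2) tr(2) contr(1)]]) (use const_bounds in auto)
  have m2: "mixing_transfer_family r e2 T \<beta> ?J (C + K) \<theta> N"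
    by (rule mix[OF f2 mean_zero_contraction_power[OF ds(3) tr(3) contr(2)]]) (use const_bounds in auto)
  have m3: "mixing_transfer_family r e3 T \<beta> ?J (C + K) \<theta> N"
    by (rule mix[OF f3 mean_zero_contraction_power[OF ds(4) tr(4) contr(3)]]) (use const_bounds in auto)
  have dr: "density_response r e0 e1 e2 e3 T \<beta> ?J (C + K) \<theta> N"
    by (intro density_response.intro transfer_family_pair.intro m1 m2 m3 f0 f1 f2 f3 pairs)
  interpret E1: transfer_family r e1 T \<beta> ?J "C + K" by (rule f1)
  (* The invariant densities are limits of iterates of the constant density, hence satisfy this bound. *)
  define K0 where "K0 = (C + K) * norm E1.one_elt + 1"
  have "K0 > 0" using c by (simp add: K0_def add_nonneg_pos)
  have par: "\<nu> * e1 h \<alpha> \<in> ?J" if \<nu>: "\<nu> \<in> {0..\<nu>s}" and h: "dist_nonneg r (e1 h)" "e1 h one_fun = 1" for \<nu> h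
  proof -
    have pos: "p * e1 h \<alpha> + q \<ge> 0" if pq: "\<And>x. p * \<alpha> x + q * 1 \<ge> 0" for p q
    proof -
      have "(\<lambda>x. p * \<alpha> x + q * 1) \<in> CT r" by (rule CT_lincomb[OF \<alpha> CT_const])
      then have "(\<forall>x. p * \<alpha> x + q * 1 \<ge> 0) \<longrightarrow> e1 h (\<lambda>x. p * \<alpha> x + q * 1) \<ge> 0"
        by (rule bspec[OF h(1)[unfolded dist_nonneg_def], of "\<lambda>x. p * \<alpha> x + q * 1"])
      moreover have "e1 h (\<lambda>x. p * \<alpha> x + q * 1) = p * e1 h \<alpha> + q * e1 h one_fun"
        by (rule E1.e_test_lincomb[OF \<alpha> CT_const])
      ultimately show ?thesis using pq by (simp add: h(2))
    qed
    have lo: "\<alpha> xm \<le> e1 h \<alpha>" using pos[of 1 "- \<alpha> xm"] xm by simp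
    have hi: "e1 h \<alpha> \<le> \<alpha> xM" using pos[of "-1" "\<alpha> xM"] xM by simp
    have 1: "\<nu> * \<alpha> xm \<le> \<nu> * e1 h \<alpha>" "\<nu> * e1 h \<alpha> \<le> \<nu> * \<alpha> xM"
      using \<nu> lo hi by (auto intro: mult_left_mono)
    have "a \<le> \<nu> * \<alpha> xm"
    proof (cases "\<alpha> xm \<ge> 0")
      case True
      then show ?thesis using \<nu> by (simp add: a_def min_le_iff_disj)
    next
      case False
      then have "\<nu>s * \<alpha> xm \<le> \<nu> * \<alpha> xm" using \<nu> by (intro mult_right_mono_neg) auto
      then show ?thesis by (simp add: a_def)
    qed
    moreover have "\<nu> * \<alpha> xM \<le> b"
    proof (cases "\<alpha> xM \<le> 0")
      case True
      then show ?thesis using \<nu> by (simp add: b_def le_max_iff_disj mult_nonneg_nonpos)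
    next
      case False
      then have "\<nu> * \<alpha> xM \<le> \<nu>s * \<alpha> xM" using \<nu> by (intro mult_right_mono) auto
      then show ?thesis by (simp add: b_def)
    qed
    ultimately show ?thesis using 1 by auto
  qed
  have sc: "self_consistent r e0 e1 e2 e3 T \<beta> a b (C + K) \<theta> N \<alpha> \<nu>s Ks" if "K0 \<le> Ks" for Ks
    by (intro self_consistent.intro dr self_consistent_axioms.intro)
       (use that \<nu>s par in \<open>auto simp: a_def b_def K0_def\<close>)
  show ?thesis
    by (rule exI[of _ K0], rule conjI[OF \<open>K0 > 0\<close>], intro allI impI,
        rule self_consistent.bifurcation_curves[OF sc])
qed

end
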